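(* Let $f \in C_c^\infty(\mathbb{H}^n)$. The sonar transform $\mathcal{S}[f]$ determines the Radon transform of $f$ by means of the following operator identities, each applied to $f$. (1) Horizontal planes: $\mathcal{R}_h = \mathcal{D}_{\frac{n-1}{2}} \circ \mathcal{R}_h \circ \mathcal{S}$, i.e. $\mathcal{R}_h[f](y) = (\mathcal{D}_{\frac{n-1}{2}} \circ \mathcal{R}_h \circ \mathcal{S})[f](y)$ for all $y>0$. (2) Vertical planes (here $n \ge 2$): $\mathcal{R}_v = \mathcal{L} \circ \mathcal{S}$, i.e. $\mathcal{R}_v[f](\omega,p) = \lim_{|s|\to\infty} \mathcal{S}[f](\omega s, |p-s|)$ for all $\omega \in S^{n-2}$ and $p \ge 0$. (3) Slanted planes (here $n \ge 2$): $\mathcal{R}_s = \mathcal{W} \circ \mathcal{R}_{1/y} \circ \mathcal{D}_{\frac{n-2}{2}} \circ \overline{\mathcal{R}} \circ \mathcal{S}$, i.e. $\mathcal{R}_s[f](\omega,p,\beta) = (\mathcal{W} \circ \mathcal{R}_{1/y} \circ \mathcal{D}_{\frac{n-2}{2}} \circ \overline{\mathcal{R}} \circ \mathcal{S})[f](\omega,p,\beta)$ for all $\omega \in S^{n-2}$, $p \in \mathbb{R}$, $\beta \in (0,\pi/2)$.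
   Context: Let $n \ge 1$ and $\mathbb{H}^n = \mathbb{R}^{n-1} \times (0,\infty)$, with points written $(x,y)$, $x \in \mathbb{R}^{n-1}$, $y>0$. $C_c^\infty(\mathbb{H}^n)$ is the set of smooth compactly supported functions on $\mathbb{R}^n$ with support contained in $\mathbb{H}^n$. The hyperplane $\mathbb{R}^{n-1}\times\{0\}$ is called the centerset. $S^{n-2}$ is the unit sphere in $\mathbb{R}^{n-1}$. Sonar transform: $\mathcal{S}[f](x,y)$ is the integral of $f$ over the sphere in $\mathbb{R}^n$ with center $(x,0)$ and radius $y$ with respect to area measure; explicitly $$\mathcal{S}[f](x,y) = \int_{|t|<y} f\left(x+t,\sqrt{y^2-|t|^2}\right) \frac{y\,dt}{\sqrt{y^2-|t|^2}}, \quad t \in \mathbb{R}^{n-1}.$$ For fixed $y$, $\mathcal{S}[f](\cdot,y)$ is compactly supported. Centerset Radon transform: it acts on the variable $x$, for each fixed $y$: $\overline{\mathcal{R}}[g](\omega,p,y) = \overline{\mathcal{R}}[g(\cdot,y)](\omega,p) = \int_{\omega\cdot x = p} g(x,y)\,dm(x)$, for $\omega \in S^{n-2}$, $p\in\mathbb{R}$, where $dm$ is $(n-2)$-dimensional surface measure on the hyperplane $\{x \in \mathbb{R}^{n-1} : \omega\cdot x = p\}$. (For $n=2$ this hyperplane is a point and $dm$ is the unit point mass.) Restrictions of the classical Radon transform (integration of $f$ over hyperplanes of $\mathbb{R}^n$ with respect to surface measure) to three classes of hyperplanes: - horizontal planes $\{x_n = y\}$: $\mathcal{R}_h[g](y)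 = \int_{\mathbb{R}^{n-1}} g(x,y)\,dx$; - vertical planes $\{(x,y): \omega\cdot x = p\}$, $\omega\in S^{n-2}$, $p\ge 0$: $\mathcal{R}_v[f](\omega,p) = \int_0^\infty \overline{\mathcal{R}}[f(\cdot,y)](\omega,p)\,dy$; - slanted planes $\{(x,y): \omega\cdot x - y\cot\beta = p\}$, $\omega\in S^{n-2}$, $p\in\mathbb{R}$, $\beta\in(0,\pi/2)$: $\mathcal{R}_s[f](\omega,p,\beta) = \int_0^\infty \overline{\mathcal{R}}[f(\cdot, s\sin\beta)](\omega, p+s\cos\beta)\,ds$. Fractional operators (always acting on the last variable): for $\nu>0$, $$\mathcal{I}_\nu[g](y) = \frac{2\pi^\nu}{\Gamma(\nu)}\, y \int_0^y (y^2-s^2)^{\nu-1} g(s)\,ds, \quad \mathcal{I}_0 = \mathrm{id};$$ $\mathcal{D}_1[g](y) = \frac{1}{2\pi}\frac{d}{dy}\left[\frac{g(y)}{y}\right]$; for $\nu>0$, $\mathcal{D}_\nu = \mathcal{D}_1^{\lceil\nu\rceil}\circ \mathcal{I}_{\lceil\nu\rceil-\nu}$, where $\lceil\nu\rceil$ is the smallest integer $\ge\nu$; $\mathcal{D}_0=\mathrm{id}$. Further, for functions of $\beta\in(0,\pi/2)$, $$\mathcal{W}[g](\beta) = \frac{1}{\pi}\frac{d}{d\beta}\int_0^\beta \frac{\cos\theta}{\sqrt{\sin^2\beta-\sin^2\theta}}\, g(\theta)\,d\theta.$$ Weighted Radon transform: for a weight $\sigma:(0,\infty)\to(0,\infty)$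 and a function $g(\omega,p,y)$ with $\omega \in S^{n-2}$, $(p,y)\in\mathbb{H}^2$, $$\mathcal{R}_\sigma[g](\omega,p,\beta) = \int_0^\infty g(\omega, p+s, s\sin\beta)\,\sigma(s)\,ds, \quad \beta\in(0,\pi/2);$$ $\mathcal{R}_{1/y}$ is the case $\sigma(s)=1/s$. Limit operator: $\mathcal{L}[g](\omega,p) = \lim_{|s|\to\infty} g(\omega s, |p-s|)$, with $s \in \mathbb{R}$, for $\omega\in S^{n-2}$. The operators are applied by their defining formulas to the (not necessarily compactly supported) functions arising in the compositions. *)

theory Defs
  imports "HOL-Analysis.Analysis"
begin

text \<open>
  The space R^n (n at least 1) is an arbitrary \<^class>\<open>euclidean_space\<close> \<open>'a\<close> with
  \<open>n = DIM('a)\<close>, together with a basis vector \<open>e\<close> that points in the direction of the last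
  coordinate.  R^(n-1) is the subspace \<open>centerset e\<close> orthogonal to \<open>e\<close>, and the
  point written (x,y), with x in R^(n-1) and y real, is \<open>x + y *\<^sub>R e\<close>.  This includes
  n = 1, where \<open>centerset e = {0}\<close>.
\<close>

definition centerset :: "'a::euclidean_space \<Rightarrow> 'a set" where
  "centerset e = {x. x \<bullet> e = 0}"

definition upper_half :: "'a::euclidean_space \<Rightarrow> 'a set" where
  "upper_half e = {z. 0 < z \<bullet> e}"

text \<open>The unit sphere S^(n-2) of R^(n-1); it is empty for n = 1.\<close>

definition horizontal_sphere :: "'a::euclidean_space \<Rightarrow> 'a set" where
  "horizontal_sphere e = {\<omega> \<in> centerset e. norm \<omega> = 1}"

primrec C_k :: "nat \<Rightarrow> ('a::euclidean_space \<Rightarrow> real) \<Rightarrow> bool" where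
  "C_k 0 f \<longleftrightarrow> continuous_on UNIV f"
| "C_k (Suc k) f \<longleftrightarrow>
     f differentiable_on UNIV \<and> (\<forall>b\<in>Basis. C_k k (\<lambda>x. frechet_derivative f (at x) b))"

definition Cc_infinity :: "'a::euclidean_space \<Rightarrow> ('a \<Rightarrow> real) set" where
  "Cc_infinity e = {f. (\<forall>k. C_k k f) \<and> compact (closure {z. f z \<noteq> 0}) \<and>
                       closure {z. f z \<noteq> 0} \<subseteq> upper_half e}"

text \<open>
  Lebesgue (surface) measure on a linear subspace: the image of Lebesgue measure under the
  isometric coordinates given by an orthonormal basis.  It does not depend on the basis, since
  Lebesgue measure is invariant under orthogonal maps.  On \<open>{0}\<close> it is the unit point mass,
  because the product measure over the empty index set is a unit point mass.
\<close>

definition orthonormal_basis_of :: "'a::euclidean_space set \<Rightarrow> 'a set \<Rightarrow> bool" where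
  "orthonormal_basis_of V B \<longleftrightarrow>
     B \<subseteq> V \<and> pairwise orthogonal B \<and> (\<forall>b\<in>B. norm b = 1) \<and> span B = V"

definition subspace_measure :: "'a::euclidean_space set \<Rightarrow> 'a measure" where
  "subspace_measure V =
     (let B = (SOME B. orthonormal_basis_of V B)
      in distr (\<Pi>\<^sub>M b\<in>B. lborel) borel (\<lambda>u. \<Sum>b\<in>B. u b *\<^sub>R b))"

lemma ex_orthonormal_basis_of:
  assumes "subspace V"
  shows "\<exists>B. orthonormal_basis_of V B"
  using orthonormal_basis_subspace[OF assms] unfolding orthonormal_basis_of_def by metis

definition sonar :: "'a::euclidean_space \<Rightarrow> ('a \<Rightarrow> real) \<Rightarrow> 'a \<Rightarrow> real" where
  "sonar e f z =
     (let y = z \<bullet> e; x = z - y *\<^sub>R e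
      in LINT t:{t. norm t < y}|subspace_measure (centerset e).
           f (x + t + sqrt (y\<^sup>2 - (norm t)\<^sup>2) *\<^sub>R e) * (y / sqrt (y\<^sup>2 - (norm t)\<^sup>2)))"

text \<open>
  The hyperplane of all \<open>x\<close> in R^(n-1) with \<open>\<omega> \<bullet> x = p\<close> consists of the points
  \<open>p *\<^sub>R \<omega> + u\<close> with \<open>u\<close> in R^(n-1) orthogonal to \<open>\<omega>\<close>.
\<close>

definition centerset_radon ::
  "'a::euclidean_space \<Rightarrow> ('a \<Rightarrow> real) \<Rightarrow> 'a \<Rightarrow> real \<Rightarrow> real \<Rightarrow> real" where
  "centerset_radon e g \<omega> p y =
     (LINT u|subspace_measure {u \<in> centerset e. \<omega> \<bullet> u = 0}. g ((p *\<^sub>R \<omega> + u) + y *\<^sub>R e))"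

definition radon_h :: "'a::euclidean_space \<Rightarrow> ('a \<Rightarrow> real) \<Rightarrow> real \<Rightarrow> real" where
  "radon_h e g y = (LINT x|subspace_measure (centerset e). g (x + y *\<^sub>R e))"

definition radon_v :: "'a::euclidean_space \<Rightarrow> ('a \<Rightarrow> real) \<Rightarrow> 'a \<Rightarrow> real \<Rightarrow> real" where
  "radon_v e f \<omega> p = (LINT y:{0<..}|lborel. centerset_radon e f \<omega> p y)"

definition radon_s ::
  "'a::euclidean_space \<Rightarrow> ('a \<Rightarrow> real) \<Rightarrow> 'a \<Rightarrow> real \<Rightarrow> real \<Rightarrow> real" where
  "radon_s e f \<omega> p \<beta> =
     (LINT s:{0<..}|lborel. centerset_radon e f \<omega> (p + s * cos \<beta>) (s * sin \<beta>))"

definition frac_int :: "real \<Rightarrow> (real \<Rightarrow> real) \<Rightarrow> real \<Rightarrow> real" where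
  "frac_int \<nu> g y =
     (if \<nu> = 0 then g y
      else 2 * pi powr \<nu> / Gamma \<nu> * y *
           (LINT s:{0<..<y}|lborel. (y\<^sup>2 - s\<^sup>2) powr (\<nu> - 1) * g s))"

definition D1 :: "(real \<Rightarrow> real) \<Rightarrow> real \<Rightarrow> real" where
  "D1 g y = 1 / (2 * pi) * deriv (\<lambda>y. g y / y) y"

text \<open>For \<open>\<nu> = 0\<close> the formula reduces to the identity.\<close>

definition frac_deriv :: "real \<Rightarrow> (real \<Rightarrow> real) \<Rightarrow> real \<Rightarrow> real" where
  "frac_deriv \<nu> g = (D1 ^^ nat \<lceil>\<nu>\<rceil>) (frac_int (of_int \<lceil>\<nu>\<rceil> - \<nu>) g)"

definition W_op :: "(real \<Rightarrow> real) \<Rightarrow> real \<Rightarrow> real" where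
  "W_op g \<beta> =
     1 / pi * deriv (\<lambda>\<beta>. LINT \<theta>:{0<..<\<beta>}|lborel.
                          cos \<theta> / sqrt ((sin \<beta>)\<^sup>2 - (sin \<theta>)\<^sup>2) * g \<theta>) \<beta>"

definition weighted_radon ::
  "(real \<Rightarrow> real) \<Rightarrow> ('a \<Rightarrow> real \<Rightarrow> real \<Rightarrow> real) \<Rightarrow> 'a \<Rightarrow> real \<Rightarrow> real \<Rightarrow> real" where
  "weighted_radon \<sigma> g \<omega> p \<beta> = (LINT s:{0<..}|lborel. g \<omega> (p + s) (s * sin \<beta>) * \<sigma> s)"

text \<open>
  \<open>has_limit_op e g \<omega> p l\<close>: the limit operator applied to \<open>g\<close> exists at \<open>(\<omega>, p)\<close>
  and has the value \<open>l\<close>.  On the reals, \<^const>\<open>at_infinity\<close> is two-sided.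
\<close>

definition has_limit_op ::
  "'a::euclidean_space \<Rightarrow> ('a \<Rightarrow> real) \<Rightarrow> 'a \<Rightarrow> real \<Rightarrow> real \<Rightarrow> bool" where
  "has_limit_op e g \<omega> p l \<longleftrightarrow>
     ((\<lambda>s::real. g (s *\<^sub>R \<omega> + \<bar>p - s\<bar> *\<^sub>R e)) \<longlongrightarrow> l) at_infinity"

end

theory Submission
  imports Defs
begin

text \<open>
  Everything rests on one computation.  Fix an \<open>m\<close>-dimensional subspace \<open>V\<close> and a function \<open>F\<close>
  of the height.  The integral of \<open>F\<close> over the upper half of the sphere of radius \<open>y\<close>, with the area
  element \<open>y / sqrt (y\<^sup>2 - |v|\<^sup>2)\<close> over \<open>v \<in> V\<close>, is \<open>I_(m/2) F y\<close>
  (\<open>integral_sphere_density\<close>).  For \<open>m = 1\<close> this is the substitution \<open>s = sqrt (y\<^sup>2 - a\<^sup>2)\<close>;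
  slicing off one dimension at a time gives the general case, because the fractional integrals form
  a semigroup, \<open>I_\<nu> I_\<mu> = I_(\<nu>+\<mu>)\<close>, and this in turn is Euler's Beta integral.  The same semigroup
  law shows \<open>D_\<nu> I_\<nu> F = F\<close> for continuous \<open>F\<close> that vanish near \<open>0\<close>: it reduces the claim to
  \<open>D_1 I_1 F = F\<close>, which is the fundamental theorem of calculus (\<open>frac_deriv_frac_int\<close>).

  Horizontal planes.  If the centre of a sphere of radius \<open>y\<close> runs through the centerset, each point of
  the sphere sweeps out a horizontal plane, so \<open>R_h S f = I_((n-1)/2) (R_h f)\<close>, and \<open>D_((n-1)/2)\<close> inverts this
  (\<open>radon_h_eq\<close>).

  Vertical planes.  The spheres with centre \<open>s \<omega>\<close> and radius \<open>|p - s|\<close> pass through \<open>p \<omega>\<close> and flatten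
  to the plane \<open>\<omega> \<bullet> x = p\<close>.  As graphs over the centerset they degenerate, so the near part of the
  sphere is written as a graph over the limiting plane instead; on the bounded support of \<open>f\<close> the
  integrands then converge boundedly (\<open>tendsto_sonar_at_top\<close>).

  Slanted planes.  Averaging over the directions orthogonal to \<open>\<omega>\<close> turns \<open>f\<close> into a function \<open>g\<close> on a
  half-plane (\<open>profile\<close>).  Slicing the spheres the other way round,
  the averaged sonar transform is \<open>I_((n-2)/2)\<close> of the integrals of \<open>g\<close> over half-circles centred on
  the axis (\<open>centerset_radon_sonar\<close>), and \<open>D_((n-2)/2)\<close> recovers those integrals.  It remains to see
  that \<open>W R_(1/y)\<close> maps half-circle integrals to ray integrals.  The half-circles that
  enter at angle \<open>\<theta>\<close> have centre \<open>s\<close> and radius \<open>s sin \<theta>\<close>; they all touch the ray of angle \<open>\<theta>\<close>.  The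
  integral that \<open>W\<close> differentiates runs over \<open>\<theta> < \<beta>\<close>, hence over the circles inside the wedge of angle
  \<open>\<beta>\<close>.  For fixed \<open>s\<close> one passes from (abscissa, \<open>\<theta>\<close>) to Cartesian coordinates \<open>(x, y)\<close>, and the
  remaining integral over \<open>s\<close> is an arcsine integral with the value \<open>\<pi> / sqrt (x\<^sup>2 + y\<^sup>2)\<close> inside
  the wedge and \<open>0\<close> outside.  In polar coordinates this is \<open>\<pi>\<close> times the integral over \<open>\<alpha> < \<beta>\<close> of
  the ray integrals (\<open>nn_integral_wedge\<close>), and differentiation in \<open>\<beta>\<close> finishes the proof.

  All changes of variables are proved for nonnegative Borel functions, where Tonelli's theorem
  applies freely, and are then transferred to signed integrands as identities between image
  measures (\<open>integral_transfer\<close>).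
\<close>

section \<open>Changes of variables\<close>

text \<open>
  The substitutions below are singular at the end points and their integrands may have infinite
  integral.  Both sides are therefore compared as measures, set by set, where the
  change-of-variables theorem for absolutely integrable functions decides finiteness as well.
\<close>

lemma nn_integral_inj_substitution:
  fixes g g' :: "real \<Rightarrow> real" and f :: "real \<Rightarrow> ennreal"
  assumes S[measurable]: "S \<in> sets borel" and gS[measurable]: "g ` S \<in> sets borel"
    and der: "\<And>x. x \<in> S \<Longrightarrow> (g has_real_derivative g' x) (at x within S)"
    and inj: "inj_on g S"
    and [measurable]: "g \<in> borel_measurable borel" "g' \<in> borel_measurable borel"
    and f[measurable]: "f \<in> borel_measurable borel"
  shows "(\<integral>\<^sup>+x. f x * indicator (g ` S) x \<partial>lborel) = (\<integral>\<^sup>+x. f (g x) * ennreal \<bar>g' x\<bar> * indicator S x \<partial>lborel)"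
proof -
  let ?N = "density lborel (\<lambda>x. ennreal \<bar>g' x\<bar> * indicator S x)"
  have eq: "distr ?N borel g = density lborel (indicator (g ` S))"
  proof (rule measure_eqI)
    fix A assume "A \<in> sets (distr ?N borel g)"
    then have A[measurable]: "A \<in> sets borel" by simp
    \<comment> \<open>The two measures of \<open>A\<close> are either both finite and equal, or both infinite.\<close>
    let ?\<phi> = "\<lambda>x. \<bar>g' x\<bar> * indicat_real A (g x)"
    have SL: "S \<in> sets lebesgue" using S by simp
    note cov = has_absolute_integral_change_of_variables_1'[OF SL der inj, where f = "indicat_real A"]
    have L: "emeasure (distr ?N borel g) A = (\<integral>\<^sup>+x. ennreal (?\<phi> x) * indicator S x \<partial>lborel)"
      by (subst emeasure_distr, simp, simp, subst emeasure_density, measurable)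
         (auto intro!: nn_integral_cong simp: indicator_def)
    have R: "emeasure (density lborel (indicator (g ` S))) A = emeasure lborel (A \<inter> g ` S)"
      by (subst emeasure_density) (auto simp: indicator_inter_arith[symmetric] Int_commute)
    have indI: "set_integrable lborel (g ` S) (indicat_real A)" if "emeasure lborel (A \<inter> g ` S) < \<infinity>"
      unfolding set_integrable_def using that
      by (auto simp: indicator_inter_arith[symmetric] Int_commute integrable_indicator_iff)
    show "emeasure (distr ?N borel g) A = emeasure (density lborel (indicator (g ` S))) A"
    proof (cases "emeasure lborel (A \<inter> g ` S) < \<infinity>")
      case True
      have "indicat_real A absolutely_integrable_on (g ` S)"
        using indI[OF True] unfolding set_integrable_def
        by (intro integrable_completion[THEN iffD2]) auto
      moreover have "integral (g ` S) (indicat_real A) = measure lborel (A \<inter> g ` S)"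
        using indI[OF True] by (subst set_borel_integral_eq_integral(2)[symmetric])
          (auto simp: set_lebesgue_integral_def indicator_inter_arith[symmetric] Int_commute)
      ultimately have c: "?\<phi> absolutely_integrable_on S" "integral S ?\<phi> = measure lborel (A \<inter> g ` S)"
        using cov by auto
      have "(?\<phi> has_integral measure lborel (A \<inter> g ` S)) S"
        using c by (metis has_integral_integral set_lebesgue_integral_eq_integral(1))
      from nn_integral_has_integral_lebesgue'[OF _ this]
      have "(\<integral>\<^sup>+x. ennreal (?\<phi> x) * indicator S x \<partial>lborel) = ennreal (measure lborel (A \<inter> g ` S))" by simp
      then show ?thesis unfolding L R using True by (simp add: emeasure_eq_ennreal_measure)
    next
      case False
      have "(\<integral>\<^sup>+x. ennreal (?\<phi> x) * indicator S x \<partial>lborel) = \<infinity>"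
      proof (rule ccontr)
        assume "\<not> ?thesis"
        then have fin: "(\<integral>\<^sup>+x. ennreal (?\<phi> x) * indicator S x \<partial>lborel) < \<infinity>"
          by (simp add: top.not_eq_extremum)
        have eq: "(\<integral>\<^sup>+x. ennreal (norm (indicator S x *\<^sub>R ?\<phi> x)) \<partial>lborel)
            = (\<integral>\<^sup>+x. ennreal (?\<phi> x) * indicator S x \<partial>lborel)"
          by (intro nn_integral_cong) (auto simp: indicator_def)
        have "set_integrable lborel S ?\<phi>" unfolding set_integrable_def
        proof (rule integrableI_bounded)
          show "(\<integral>\<^sup>+x. ennreal (norm (indicator S x *\<^sub>R ?\<phi> x)) \<partial>lborel) < \<infinity>"
            unfolding eq by (rule fin)
        qed measurable
        then have "?\<phi> absolutely_integrable_on S" unfolding set_integrable_def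
          by (intro integrable_completion[THEN iffD2]) auto
        then have "indicat_real A absolutely_integrable_on (g ` S)"
          using absolutely_integrable_change_of_variables_1'[OF SL der inj, where f = "indicat_real A"] by simp
        then have "set_integrable lborel (g ` S) (indicat_real A)" unfolding set_integrable_def
          by (simp add: integrable_completion)
        then have "emeasure lborel (A \<inter> g ` S) < \<infinity>" unfolding set_integrable_def
          by (auto simp: indicator_inter_arith[symmetric] Int_commute integrable_indicator_iff)
        with False show False by simp
      qed
      moreover have "emeasure lborel (A \<inter> g ` S) = \<infinity>"
        using False top.not_eq_extremum by (metis infinity_ennreal_def)
      ultimately show ?thesis unfolding L R by simp
    qed
  qed simp
  have "(\<integral>\<^sup>+x. f x * indicator (g ` S) x \<partial>lborel) = (\<integral>\<^sup>+x. f x \<partial>density lborel (indicator (g ` S)))"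
    by (subst nn_integral_density) (auto simp: mult.commute)
  also have "\<dots> = (\<integral>\<^sup>+x. f x \<partial>distr ?N borel g)" by (simp add: eq)
  also have "\<dots> = (\<integral>\<^sup>+x. f (g x) \<partial>?N)" by (subst nn_integral_distr) auto
  also have "\<dots> = (\<integral>\<^sup>+x. f (g x) * ennreal \<bar>g' x\<bar> * indicator S x \<partial>lborel)"
    by (subst nn_integral_density) (auto intro!: nn_integral_cong simp: mult_ac)
  finally show ?thesis .
qed

text \<open>
  An identity of nonnegative integrals for all test functions says that two weighted image measures
  agree.  It hence also holds for signed functions, and integrability carries over from one side to
  the other; no absolute convergence has to be checked before the substitution.
\<close>

lemma
  fixes g :: "'c::topological_space \<Rightarrow> real" and w :: "'m \<Rightarrow> real" and v :: "'n \<Rightarrow> real"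
  assumes [measurable]: "w \<in> borel_measurable M" "\<phi> \<in> M \<rightarrow>\<^sub>M borel"
      "v \<in> borel_measurable N" "\<psi> \<in> N \<rightarrow>\<^sub>M borel" "g \<in> borel_measurable borel"
    and pos: "\<And>x. 0 \<le> w x" "\<And>x. 0 \<le> v x"
    and H: "\<And>h :: 'c \<Rightarrow> ennreal. h \<in> borel_measurable borel \<Longrightarrow>
       (\<integral>\<^sup>+x. ennreal (w x) * h (\<phi> x) \<partial>M) = (\<integral>\<^sup>+x. ennreal (v x) * h (\<psi> x) \<partial>N)"
  shows integrable_transfer: "integrable M (\<lambda>x. w x * g (\<phi> x)) \<longleftrightarrow> integrable N (\<lambda>x. v x * g (\<psi> x))"
    and integral_transfer: "(LINT x|M. w x * g (\<phi> x)) = (LINT x|N. v x * g (\<psi> x))"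
proof -
  let ?A = "distr (density M (\<lambda>x. ennreal (w x))) borel \<phi>"
  let ?B = "distr (density N (\<lambda>x. ennreal (v x))) borel \<psi>"
  have eq: "?A = ?B"
  proof (rule measure_eqI)
    fix A assume "A \<in> sets ?A"
    then have A[measurable]: "A \<in> sets borel" by simp
    have "emeasure ?A A = (\<integral>\<^sup>+x. indicator A x \<partial>?A)" by simp
    also have "\<dots> = (\<integral>\<^sup>+x. ennreal (w x) * indicator A (\<phi> x) \<partial>M)"
      by (simp add: nn_integral_distr nn_integral_density del: nn_integral_indicator)
    also have "\<dots> = (\<integral>\<^sup>+x. ennreal (v x) * indicator A (\<psi> x) \<partial>N)" by (rule H) simp
    also have "\<dots> = (\<integral>\<^sup>+x. indicator A x \<partial>?B)"
      by (simp add: nn_integral_distr nn_integral_density del: nn_integral_indicator)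
    finally show "emeasure ?A A = emeasure ?B A" by simp
  qed simp
  have "integrable ?A g \<longleftrightarrow> integrable M (\<lambda>x. w x * g (\<phi> x))"
    by (subst integrable_distr_eq) (auto simp: integrable_real_density pos)
  moreover have "integrable ?B g \<longleftrightarrow> integrable N (\<lambda>x. v x * g (\<psi> x))"
    by (subst integrable_distr_eq) (auto simp: integrable_real_density pos)
  ultimately show "integrable M (\<lambda>x. w x * g (\<phi> x)) \<longleftrightarrow> integrable N (\<lambda>x. v x * g (\<psi> x))"
    by (simp add: eq)
  have "(LINT x|?A. g x) = (LINT x|M. w x * g (\<phi> x))"
    by (subst integral_distr) (auto simp: integral_real_density pos)
  moreover have "(LINT x|?B. g x) = (LINT x|N. v x * g (\<psi> x))"
    by (subst integral_distr) (auto simp: integral_real_density pos)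
  ultimately show "(LINT x|M. w x * g (\<phi> x)) = (LINT x|N. v x * g (\<psi> x))" by (simp add: eq)
qed

text \<open>
  On the quarter circle \<open>a\<^sup>2 + h\<^sup>2 = q\<^sup>2\<close> the element of angle is \<open>da / h = dh / a\<close> up to sign,
  which is symmetric in the two coordinates.
\<close>

lemma nn_integral_half_circle:
  fixes \<Phi> :: "real \<Rightarrow> real \<Rightarrow> ennreal"
  assumes [measurable]: "(\<lambda>(a,h). \<Phi> a h) \<in> borel_measurable (borel \<Otimes>\<^sub>M borel)"
  shows "(\<integral>\<^sup>+a. \<Phi> a (sqrt (q\<^sup>2 - a\<^sup>2)) * ennreal (1 / sqrt (q\<^sup>2 - a\<^sup>2)) * indicator {0<..<q} a \<partial>lborel)
       = (\<integral>\<^sup>+h. \<Phi> (sqrt (q\<^sup>2 - h\<^sup>2)) h * ennreal (1 / sqrt (q\<^sup>2 - h\<^sup>2)) * indicator {0<..<q} h \<partial>lborel)"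
proof -
  let ?g = "\<lambda>h. sqrt (q\<^sup>2 - h\<^sup>2)"
  have pos: "0 < q\<^sup>2 - h\<^sup>2" if "h \<in> {0<..<q}" for h
    using that by (simp add: power_strict_mono)
  \<comment> \<open>The substitution is an involution of the interval.\<close>
  have gg: "?g (?g h) = h" "?g h \<in> {0<..<q}" if "h \<in> {0<..<q}" for h
  proof -
    show "?g (?g h) = h" using that pos[OF that] by simp
    show "?g h \<in> {0<..<q}" using that pos[OF that] by (auto intro!: real_less_lsqrt)
  qed
  have img: "?g ` {0<..<q} = {0<..<q}" using gg by (metis (no_types, lifting) image_eqI subsetI subset_antisym image_subsetI)
  have "(\<integral>\<^sup>+a. \<Phi> a (?g a) * ennreal (1 / ?g a) * indicator (?g ` {0<..<q}) a \<partial>lborel)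
      = (\<integral>\<^sup>+h. \<Phi> (?g h) (?g (?g h)) * ennreal (1 / ?g (?g h)) * ennreal \<bar>- h / ?g h\<bar> * indicator {0<..<q} h \<partial>lborel)"
  proof (rule nn_integral_inj_substitution)
    show "(?g has_real_derivative - x / sqrt (q\<^sup>2 - x\<^sup>2)) (at x within {0<..<q})" if "x \<in> {0<..<q}" for x
      using pos[OF that] by (auto intro!: derivative_eq_intros simp: field_simps)
    show "inj_on ?g {0<..<q}" using gg by (metis (no_types, lifting) inj_onI)
  qed (auto simp: img)
  also have "\<dots> = (\<integral>\<^sup>+h. \<Phi> (?g h) h * ennreal (1 / ?g h) * indicator {0<..<q} h \<partial>lborel)"
  proof (intro nn_integral_cong)
    fix h show "\<Phi> (?g h) (?g (?g h)) * ennreal (1 / ?g (?g h)) * ennreal \<bar>- h / ?g h\<bar> * indicator {0<..<q} h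
       = \<Phi> (?g h) h * ennreal (1 / ?g h) * indicator {0<..<q} h"
    proof (cases "h \<in> {0<..<q}")
      case True
      have "ennreal (1 / h) * ennreal \<bar>- h / ?g h\<bar> = ennreal (1 / ?g h)"
        using True gg[OF True] by (subst ennreal_mult[symmetric]) auto
      with True show ?thesis by (simp add: gg mult.assoc del: abs_divide)
    qed auto
  qed
  finally show ?thesis by (simp add: img)
qed

text \<open>
  The substitution \<open>t = (s\<^sup>2 - r\<^sup>2) / (y\<^sup>2 - r\<^sup>2)\<close> turns the left-hand side into Euler's
  integral for \<open>Beta b a\<close>.
\<close>

lemma nn_integral_powr_Beta:
  fixes a b r y :: real
  assumes a: "0 < a" and b: "0 < b" and r: "0 \<le> r" "r < y"
  shows "(\<integral>\<^sup>+s. ennreal ((y\<^sup>2 - s\<^sup>2) powr (a - 1) * (s\<^sup>2 - r\<^sup>2) powr (b - 1) * s) * indicator {r<..<y} s \<partial>lborel)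
       = ennreal (Beta a b / 2 * (y\<^sup>2 - r\<^sup>2) powr (a + b - 1))"
proof -
  define D where "D = y\<^sup>2 - r\<^sup>2"
  have D: "0 < D" unfolding D_def using r by (simp add: power_strict_mono)
  let ?g = "\<lambda>s. (s\<^sup>2 - r\<^sup>2) / D"
  let ?f = "\<lambda>t. t powr (b - 1) * (1 - t) powr (a - 1)"
  have "D powr (1 - a - b) = D powr (- (b - 1) + - (a - 1) + - 1)" by (simp add: algebra_simps)
  also have "\<dots> = inverse (D powr (b - 1)) * inverse (D powr (a - 1)) * inverse D"
    using D by (simp only: powr_add powr_minus) simp
  finally have Dp: "D powr (1 - a - b) = inverse (D powr (b - 1)) * inverse (D powr (a - 1)) * inverse D" .
  have img: "?g ` {r<..<y} = {0<..<1}"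
  proof (intro equalityI subsetI)
    fix t assume "t \<in> ?g ` {r<..<y}"
    then obtain s where s: "s \<in> {r<..<y}" "t = ?g s" by auto
    have "r\<^sup>2 < s\<^sup>2" "s\<^sup>2 < y\<^sup>2" using s r by (auto simp: power_strict_mono)
    then have "0 < ?g s" "?g s < 1" using D by (simp_all add: pos_divide_less_eq) (simp add: D_def)
    then show "t \<in> {0<..<1}" using s by simp
  next
    fix t :: real assume t: "t \<in> {0<..<1}"
    let ?s = "sqrt (r\<^sup>2 + t * D)"
    have "r < ?s" using t D r by (intro real_less_rsqrt) auto
    moreover have "?s < y"
    proof (rule real_less_lsqrt)
      have "t * D < 1 * D" using t D by (intro mult_strict_right_mono) auto
      then show "r\<^sup>2 + t * D < y\<^sup>2" by (simp add: D_def)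
    qed (use r in auto)
    moreover have "?g ?s = t" using t D by (simp add: add_nonneg_nonneg)
    ultimately show "t \<in> ?g ` {r<..<y}" by (metis (no_types, lifting) greaterThanLessThan_iff image_eqI)
  qed
  have "(?f has_integral Beta b a) {0..1}" by (rule has_integral_Beta_real[OF b a])
  then have "(?f has_integral Beta b a) {0<..<1}" by (simp add: has_integral_Icc_iff_Ioo)
  from nn_integral_has_integral_lebesgue'[OF _ this]
  have "ennreal (Beta b a) = (\<integral>\<^sup>+t. ennreal (?f t) * indicator {0<..<1} t \<partial>lborel)" by simp
  also have "\<dots> = (\<integral>\<^sup>+t. ennreal (?f t) * indicator (?g ` {r<..<y}) t \<partial>lborel)" by (simp add: img)
  also have "\<dots> = (\<integral>\<^sup>+s. ennreal (?f (?g s)) * ennreal \<bar>2 * s / D\<bar> * indicator {r<..<y} s \<partial>lborel)"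
  proof (rule nn_integral_inj_substitution)
    show "(?g has_real_derivative 2 * x / D) (at x within {r<..<y})" for x
      using D by (auto intro!: derivative_eq_intros)
    show "inj_on ?g {r<..<y}"
    proof (rule inj_onI)
      fix s s' assume "s \<in> {r<..<y}" "s' \<in> {r<..<y}" "?g s = ?g s'"
      with D r show "s = s'" by (auto simp: power2_eq_iff_nonneg)
    qed
    show "?g ` {r<..<y} \<in> sets borel" by (simp add: img)
  qed auto
  also have "\<dots> = (\<integral>\<^sup>+s. ennreal (2 * D powr (1 - a - b)) *
      (ennreal ((y\<^sup>2 - s\<^sup>2) powr (a - 1) * (s\<^sup>2 - r\<^sup>2) powr (b - 1) * s) * indicator {r<..<y} s) \<partial>lborel)"
        (is "integral\<^sup>N _ ?before = integral\<^sup>N _ ?after")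
  proof (intro nn_integral_cong)
    fix s
    show "?before s = ?after s"
    proof (cases "s \<in> {r<..<y}")
      case True
      then have ps: "r\<^sup>2 < s\<^sup>2" "s\<^sup>2 < y\<^sup>2" "0 < s" using r by (auto simp: power_strict_mono)
      have "1 - ?g s = (y\<^sup>2 - s\<^sup>2) / D" using D by (simp add: field_simps) (simp add: D_def)
      then have "?f (?g s) = (s\<^sup>2 - r\<^sup>2) powr (b - 1) / D powr (b - 1) * ((y\<^sup>2 - s\<^sup>2) powr (a - 1) / D powr (a - 1))"
        using ps D by (simp add: powr_divide)
      then have "?f (?g s) * \<bar>2 * s / D\<bar> = 2 * D powr (1 - a - b) * ((y\<^sup>2 - s\<^sup>2) powr (a - 1) * (s\<^sup>2 - r\<^sup>2) powr (b - 1) * s)"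
        using ps D by (simp add: Dp divide_inverse mult_ac)
      then have "ennreal (?f (?g s)) * ennreal \<bar>2 * s / D\<bar> = ennreal (2 * D powr (1 - a - b)) *
         ennreal ((y\<^sup>2 - s\<^sup>2) powr (a - 1) * (s\<^sup>2 - r\<^sup>2) powr (b - 1) * s)"
        using ps by (subst (1 2) ennreal_mult[symmetric]) auto
      then show ?thesis using True by simp
    qed auto
  qed
  also have "\<dots> = ennreal (2 * D powr (1 - a - b)) * (\<integral>\<^sup>+s. 
      ennreal ((y\<^sup>2 - s\<^sup>2) powr (a - 1) * (s\<^sup>2 - r\<^sup>2) powr (b - 1) * s) * indicator {r<..<y} s \<partial>lborel)" (is "_ = _ * ?I")
    by (rule nn_integral_cmult) measurable
  finally have *: "ennreal (Beta b a) = ennreal (2 * D powr (1 - a - b)) * ?I" .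
  have "ennreal (D powr (a + b - 1) / 2) * ennreal (Beta b a)
      = (ennreal (D powr (a + b - 1) / 2) * ennreal (2 * D powr (1 - a - b))) * ?I"
    unfolding * by (simp add: mult.assoc)
  also have "ennreal (D powr (a + b - 1) / 2) * ennreal (2 * D powr (1 - a - b))
      = ennreal (D powr (a + b - 1) * D powr (1 - a - b))"
    by (subst ennreal_mult[symmetric]) simp_all
  also have "D powr (a + b - 1) * D powr (1 - a - b) = D powr 0"
    unfolding powr_add[symmetric] by simp
  also have "\<dots> = 1" using D by simp
  finally have "?I = ennreal (D powr (a + b - 1) / 2) * ennreal (Beta b a)" by simp
  also have "\<dots> = ennreal (D powr (a + b - 1) / 2 * Beta b a)"
    by (rule ennreal_mult[symmetric]) (use a b in \<open>auto simp: Beta_def Gamma_real_pos less_imp_le\<close>)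
  finally show ?thesis by (simp add: Beta_commute[of b a] D_def mult_ac)
qed

section \<open>Fractional integrals and derivatives\<close>

definition frac_kernel :: "real \<Rightarrow> real \<Rightarrow> real \<Rightarrow> real" where
  "frac_kernel \<nu> y s = indicator {0<..<y} s * (2 * pi powr \<nu> / Gamma \<nu> * y * (y\<^sup>2 - s\<^sup>2) powr (\<nu> - 1))"

lemma frac_kernel_nonneg: "0 < \<nu> \<Longrightarrow> 0 \<le> frac_kernel \<nu> y s"
  by (auto simp: frac_kernel_def indicator_def Gamma_real_pos less_imp_le)

lemma frac_kernel_measurable[measurable]:
  assumes [measurable]: "a \<in> borel_measurable M" "b \<in> borel_measurable M"
  shows "(\<lambda>x. frac_kernel \<nu> (a x) (b x)) \<in> borel_measurable M"
proof -
  have "(\<lambda>x. frac_kernel \<nu> (a x) (b x)) = (\<lambda>x. if 0 < b x \<and> b x < a x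
      then 2 * pi powr \<nu> / Gamma \<nu> * a x * ((a x)\<^sup>2 - (b x)\<^sup>2) powr (\<nu> - 1) else 0)"
    by (auto simp: frac_kernel_def indicator_def fun_eq_iff)
  then show ?thesis by simp
qed

lemma frac_int_eq_kernel:
  "\<nu> \<noteq> 0 \<Longrightarrow> frac_int \<nu> g y = (LINT s|lborel. frac_kernel \<nu> y s * g s)"
proof -
  assume "\<nu> \<noteq> 0"
  then have "frac_int \<nu> g y = (LINT s|lborel. 2 * pi powr \<nu> / Gamma \<nu> * y *
      (indicator {0<..<y} s * ((y\<^sup>2 - s\<^sup>2) powr (\<nu> - 1) * g s)))"
    unfolding frac_int_def set_lebesgue_integral_def by (subst integral_mult_right_zero) simp
  also have "\<dots> = (LINT s|lborel. frac_kernel \<nu> y s * g s)"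
    by (intro Bochner_Integration.integral_cong) (auto simp: frac_kernel_def)
  finally show ?thesis .
qed

lemma frac_int_cong:
  assumes "\<And>s. 0 < s \<Longrightarrow> s \<le> y \<Longrightarrow> g s = h s" "0 < y"
  shows "frac_int \<nu> g y = frac_int \<nu> h y"
  using assms by (auto simp: frac_int_eq_kernel frac_kernel_def indicator_def frac_int_def
      intro!: arg_cong2[where f = "(*)"] set_lebesgue_integral_cong)

text \<open>
  The constants \<open>2 * pi powr \<nu> / Gamma \<nu>\<close> are chosen to make this work: the factor
  \<open>Beta \<nu> \<mu> = Gamma \<nu> * Gamma \<mu> / Gamma (\<nu> + \<mu>)\<close> from the inner integral cancels two of the Gamma values and
  supplies the third.
\<close>

lemma nn_integral_frac_kernel_mult:
  assumes "0 < \<nu>" "0 < \<mu>"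
  shows "(\<integral>\<^sup>+s. ennreal (frac_kernel \<nu> y s) * ennreal (frac_kernel \<mu> s r) \<partial>lborel)
       = ennreal (frac_kernel (\<nu> + \<mu>) y r)"
proof (cases "0 < r \<and> r < y")
  case True
  let ?c = "\<lambda>\<nu>. 2 * pi powr \<nu> / Gamma \<nu>"
  have c: "0 < ?c \<nu>" "0 < ?c \<mu>" using assms by (simp_all add: Gamma_real_pos)
  have cy: "0 \<le> ?c \<nu> * ?c \<mu> * y"
    using c True by (intro mult_nonneg_nonneg) (auto simp only: less_imp_le)
  have "(\<integral>\<^sup>+s. ennreal (frac_kernel \<nu> y s) * ennreal (frac_kernel \<mu> s r) \<partial>lborel)
      = (\<integral>\<^sup>+s. ennreal (?c \<nu> * ?c \<mu> * y) * (ennreal ((y\<^sup>2 - s\<^sup>2) powr (\<nu> - 1) * (s\<^sup>2 - r\<^sup>2) powr (\<mu> - 1) * s) * indicator {r<..<y} s) \<partial>lborel)"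
        (is "integral\<^sup>N _ ?before = integral\<^sup>N _ ?after")
  proof (intro nn_integral_cong)
    fix s
    show "?before s = ?after s"
    proof (cases "s \<in> {r<..<y}")
      case s: True
      have "ennreal (frac_kernel \<nu> y s) * ennreal (frac_kernel \<mu> s r) = ennreal (frac_kernel \<nu> y s * frac_kernel \<mu> s r)"
        using assms by (simp add: ennreal_mult frac_kernel_nonneg)
      also have "frac_kernel \<nu> y s * frac_kernel \<mu> s r
          = (?c \<nu> * ?c \<mu> * y) * ((y\<^sup>2 - s\<^sup>2) powr (\<nu> - 1) * (s\<^sup>2 - r\<^sup>2) powr (\<mu> - 1) * s)"
        using True s by (simp add: frac_kernel_def)
      also have "ennreal \<dots> = ennreal (?c \<nu> * ?c \<mu> * y) * ennreal ((y\<^sup>2 - s\<^sup>2) powr (\<nu> - 1) * (s\<^sup>2 - r\<^sup>2) powr (\<mu> - 1) * s)"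
        using True s by (intro ennreal_mult cy) auto
      finally show ?thesis using s by simp
    qed (use True in \<open>auto simp: frac_kernel_def indicator_def\<close>)
  qed
  also have "\<dots> = ennreal (?c \<nu> * ?c \<mu> * y) * (\<integral>\<^sup>+s. ennreal ((y\<^sup>2 - s\<^sup>2) powr (\<nu> - 1) * (s\<^sup>2 - r\<^sup>2) powr (\<mu> - 1) * s) * indicator {r<..<y} s \<partial>lborel)"
    by (rule nn_integral_cmult) measurable
  also have "\<dots> = ennreal (?c \<nu> * ?c \<mu> * y) * ennreal (Beta \<nu> \<mu> / 2 * (y\<^sup>2 - r\<^sup>2) powr (\<nu> + \<mu> - 1))"
    using True assms by (subst nn_integral_powr_Beta) auto
  also have "\<dots> = ennreal ((?c \<nu> * ?c \<mu> * y) * (Beta \<nu> \<mu> / 2 * (y\<^sup>2 - r\<^sup>2) powr (\<nu> + \<mu> - 1)))"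
    using assms by (intro ennreal_mult[symmetric] cy) (auto simp: Beta_def Gamma_real_pos less_imp_le)
  also have "(?c \<nu> * ?c \<mu> * y) * (Beta \<nu> \<mu> / 2 * (y\<^sup>2 - r\<^sup>2) powr (\<nu> + \<mu> - 1)) = frac_kernel (\<nu> + \<mu>) y r"
    using True Gamma_real_pos[OF assms(1), THEN less_imp_neq] Gamma_real_pos[OF assms(2), THEN less_imp_neq]
    by (simp add: frac_kernel_def Beta_def powr_add)
  finally show ?thesis .
next
  case False
  then have "frac_kernel \<nu> y s * frac_kernel \<mu> s r = 0" for s
    by (auto simp: frac_kernel_def indicator_def)
  then have "ennreal (frac_kernel \<nu> y s) * ennreal (frac_kernel \<mu> s r) = 0" for s
    by (metis ennreal_0 mult_eq_0_iff mult_zero_left mult_zero_right)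
  then have "(\<lambda>s. ennreal (frac_kernel \<nu> y s) * ennreal (frac_kernel \<mu> s r)) = (\<lambda>s. 0)" by (intro ext)
  moreover have "frac_kernel (\<nu> + \<mu>) y r = 0" using False by (auto simp: frac_kernel_def)
  ultimately show ?thesis by simp
qed

lemma nn_integral_frac_kernel_compose:
  assumes "0 < \<nu>" "0 < \<mu>" and [measurable]: "h \<in> borel_measurable borel"
  shows "(\<integral>\<^sup>+s. ennreal (frac_kernel \<nu> y s) * (\<integral>\<^sup>+r. ennreal (frac_kernel \<mu> s r) * h r \<partial>lborel) \<partial>lborel)
       = (\<integral>\<^sup>+r. ennreal (frac_kernel (\<nu> + \<mu>) y r) * h r \<partial>lborel)"
proof -
  have "(\<integral>\<^sup>+s. ennreal (frac_kernel \<nu> y s) * (\<integral>\<^sup>+r. ennreal (frac_kernel \<mu> s r) * h r \<partial>lborel) \<partial>lborel)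
      = (\<integral>\<^sup>+s. \<integral>\<^sup>+r. ennreal (frac_kernel \<nu> y s) * (ennreal (frac_kernel \<mu> s r) * h r) \<partial>lborel \<partial>lborel)"
    by (intro nn_integral_cong nn_integral_cmult[symmetric]) measurable
  also have "\<dots> = (\<integral>\<^sup>+r. \<integral>\<^sup>+s. ennreal (frac_kernel \<nu> y s) * (ennreal (frac_kernel \<mu> s r) * h r) \<partial>lborel \<partial>lborel)"
    by (rule lborel_pair.Fubini') measurable
  also have "\<dots> = (\<integral>\<^sup>+r. (\<integral>\<^sup>+s. ennreal (frac_kernel \<nu> y s) * ennreal (frac_kernel \<mu> s r) \<partial>lborel) * h r \<partial>lborel)"
    by (subst nn_integral_multc[symmetric]) (simp_all add: mult.assoc)
  finally show ?thesis using assms by (simp add: nn_integral_frac_kernel_mult)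
qed

text \<open>
  A function that vanishes below \<open>\<delta>\<close> is dominated by a multiple of \<open>s\<close>, and the integral of the
  kernel against \<open>s\<close> is a Beta integral.
\<close>

lemma integrable_frac_kernel:
  fixes F :: "real \<Rightarrow> real"
  assumes \<nu>: "0 < \<nu>" and y: "0 < y" and F: "continuous_on UNIV F"
    and \<delta>: "0 < \<delta>" "\<And>s. s \<le> \<delta> \<Longrightarrow> F s = 0"
  shows "integrable lborel (\<lambda>s. frac_kernel \<nu> y s * F s)"
proof -
  have [measurable]: "F \<in> borel_measurable borel" using F by (rule borel_measurable_continuous_onI)
  have "bounded (F ` {0..y})"
    using F by (intro compact_imp_bounded compact_continuous_image) (auto intro: continuous_on_subset)
  then obtain M where M: "\<And>s. s \<in> {0..y} \<Longrightarrow> \<bar>F s\<bar> \<le> M" by (metis bounded_iff image_eqI real_norm_def)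
  have M0: "0 \<le> M" using M[of 0] y by auto
  have FM: "\<bar>F s\<bar> \<le> M / \<delta> * s" if "s \<in> {0<..<y}" for s
  proof (cases "s \<le> \<delta>")
    case False
    then have "M * 1 \<le> M * (s / \<delta>)" using \<delta> M0 by (intro mult_left_mono) auto
    with M[of s] that show ?thesis by auto
  qed (use that M0 \<delta> in auto)
  have "integrable lborel (\<lambda>s. frac_kernel \<nu> y s * s)"
  proof (rule integrableI_nonneg)
    show "AE s in lborel. 0 \<le> frac_kernel \<nu> y s * s"
      using \<nu> by (auto simp: frac_kernel_def indicator_def Gamma_real_pos less_imp_le)
    have "(\<integral>\<^sup>+s. ennreal (frac_kernel \<nu> y s * s) \<partial>lborel)
        = (\<integral>\<^sup>+s. ennreal (2 * pi powr \<nu> / Gamma \<nu> * y) * (ennreal ((y\<^sup>2 - s\<^sup>2) powr (\<nu> - 1) * (s\<^sup>2 - 0\<^sup>2) powr (1 - 1) * s) * indicator {0<..<y} s) \<partial>lborel)"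
          (is "integral\<^sup>N _ ?before = integral\<^sup>N _ ?after")
    proof (intro nn_integral_cong)
      fix s
      show "?before s = ?after s"
        using \<nu> y by (cases "s \<in> {0<..<y}") 
          (auto simp: frac_kernel_def ennreal_mult[symmetric] Gamma_real_pos less_imp_le mult.assoc)
    qed
    also have "\<dots> < \<infinity>"
      using \<nu> y nn_integral_powr_Beta[of \<nu> 1 0 y]
      by (subst nn_integral_cmult) (auto simp: ennreal_mult_less_top)
    finally show "(\<integral>\<^sup>+s. ennreal (frac_kernel \<nu> y s * s) \<partial>lborel) < \<infinity>" .
  qed measurable
  then have "integrable lborel (\<lambda>s. M / \<delta> * (frac_kernel \<nu> y s * s))" by simp
  then show ?thesis
  proof (rule Bochner_Integration.integrable_bound)
    show "AE s in lborel. norm (frac_kernel \<nu> y s * F s) \<le> norm (M / \<delta> * (frac_kernel \<nu> y s * s))"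
    proof (rule AE_I2)
      fix s
      show "norm (frac_kernel \<nu> y s * F s) \<le> norm (M / \<delta> * (frac_kernel \<nu> y s * s))"
      proof (cases "s \<in> {0<..<y}")
        case True
        have "\<bar>frac_kernel \<nu> y s\<bar> * \<bar>F s\<bar> \<le> \<bar>frac_kernel \<nu> y s\<bar> * \<bar>M / \<delta> * s\<bar>"
          by (intro mult_left_mono order_trans[OF FM[OF True] abs_ge_self]) auto
        then show ?thesis by (simp add: abs_mult mult_ac)
      qed (auto simp: frac_kernel_def)
    qed
  qed measurable
qed

text \<open>
  The semigroup law \<open>I_\<nu> I_\<mu> = I_(\<nu>+\<mu>)\<close>.  The iterated integral is a double integral because
  integrability of the product kernel is transferred from the right-hand side.
\<close>

lemma frac_int_compose:
  fixes F :: "real \<Rightarrow> real"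
  assumes \<nu>: "0 < \<nu>" and \<mu>: "0 < \<mu>" and y: "0 < y" and F: "continuous_on UNIV F"
    and \<delta>: "0 < \<delta>" "\<And>s. s \<le> \<delta> \<Longrightarrow> F s = 0"
  shows "frac_int \<nu> (frac_int \<mu> F) y = frac_int (\<nu> + \<mu>) F y"
proof -
  have [measurable]: "F \<in> borel_measurable borel" using F by (rule borel_measurable_continuous_onI)
  let ?w = "\<lambda>(s, r). frac_kernel \<nu> y s * frac_kernel \<mu> s r"
  have H: "(\<integral>\<^sup>+x. ennreal (?w x) * h (snd x) \<partial>(lborel \<Otimes>\<^sub>M lborel)) = (\<integral>\<^sup>+r. ennreal (frac_kernel (\<nu> + \<mu>) y r) * h r \<partial>lborel)"
    if [measurable]: "h \<in> borel_measurable borel" for h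
  proof -
    have "(\<integral>\<^sup>+x. ennreal (?w x) * h (snd x) \<partial>(lborel \<Otimes>\<^sub>M lborel))
        = (\<integral>\<^sup>+s. \<integral>\<^sup>+r. ennreal (frac_kernel \<nu> y s) * (ennreal (frac_kernel \<mu> s r) * h r) \<partial>lborel \<partial>lborel)"
      using \<nu> \<mu> by (subst lborel.nn_integral_fst[symmetric])
        (auto simp: ennreal_mult frac_kernel_nonneg mult.assoc)
    also have "\<dots> = (\<integral>\<^sup>+s. ennreal (frac_kernel \<nu> y s) * (\<integral>\<^sup>+r. ennreal (frac_kernel \<mu> s r) * h r \<partial>lborel) \<partial>lborel)"
      by (intro nn_integral_cong nn_integral_cmult) measurable
    finally show ?thesis using \<nu> \<mu> by (simp add: nn_integral_frac_kernel_compose)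
  qed
  have w: "?w \<in> borel_measurable (lborel \<Otimes>\<^sub>M lborel)" by measurable
  have w0: "0 \<le> ?w x" for x using \<nu> \<mu> by (auto simp: frac_kernel_nonneg split: prod.split)
  have v0: "0 \<le> frac_kernel (\<nu> + \<mu>) y r" for r using \<nu> \<mu> by (intro frac_kernel_nonneg) simp
  have I: "integrable (lborel \<Otimes>\<^sub>M lborel) (\<lambda>x. ?w x * F (snd x))"
    using integrable_frac_kernel[OF _ y F \<delta>, of "\<nu> + \<mu>"] \<nu> \<mu>
    by (subst integrable_transfer[where N = lborel and \<psi> = "\<lambda>x. x" and v = "frac_kernel (\<nu> + \<mu>) y"]) 
       (auto simp: H w0 v0)
  have "frac_int \<nu> (frac_int \<mu> F) y = (LINT s|lborel. LINT r|lborel. ?w (s, r) * F (snd (s, r)))"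
    using \<nu> \<mu> by (simp add: frac_int_eq_kernel mult.assoc)
  also have "\<dots> = (LINT x|(lborel \<Otimes>\<^sub>M lborel). ?w x * F (snd x))"
    using I by (rule lborel_pair.integral_fst')
  also have "\<dots> = (LINT r|lborel. frac_kernel (\<nu> + \<mu>) y r * F r)"
    by (rule integral_transfer[where \<psi> = "\<lambda>x. x"]) (auto simp: H w0 v0)
  finally show ?thesis using \<nu> \<mu> by (simp add: frac_int_eq_kernel)
qed

lemma frac_int_1:
  fixes F :: "real \<Rightarrow> real"
  assumes y: "0 < y" and F: "continuous_on UNIV F"
  shows "frac_int 1 F y = 2 * pi * y * integral {0..y} F"
proof -
  have "(LINT s:{0<..<y}|lborel. (y\<^sup>2 - s\<^sup>2) powr (1 - 1) * F s) = (LINT s:{0<..<y}|lborel. F s)"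
    by (intro set_lebesgue_integral_cong) (auto simp: power2_eq_iff_nonneg)
  also have "\<dots> = integral {0<..<y} F"
    by (intro set_borel_integral_eq_integral set_integrable_subset[OF borel_integrable_atLeastAtMost'[of 0 y]])
       (auto intro: continuous_on_subset[OF F])
  also have "\<dots> = integral {0..y} F" by (rule integral_open_interval_real[symmetric])
  finally show ?thesis by (simp add: frac_int_def)
qed

lemma has_real_derivative_integral:
  fixes F :: "real \<Rightarrow> real"
  assumes F: "continuous_on UNIV F" and y: "0 < y"
  shows "((\<lambda>y. integral {0..y} F) has_real_derivative F y) (at y)"
proof -
  have "((\<lambda>y. integral {0..y} F) has_real_derivative F y) (at y within {0..y + 1})"
    using y by (intro integral_has_real_derivative continuous_on_subset[OF F]) auto
  then show ?thesis using y by (simp add: at_within_Icc_at)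
qed

lemma D1_frac_int_1:
  fixes F :: "real \<Rightarrow> real"
  assumes F: "continuous_on UNIV F" and H: "\<And>y. 0 < y \<Longrightarrow> H y = frac_int 1 F y" and y: "0 < y"
  shows "D1 H y = F y"
proof -
  have "((\<lambda>y. 2 * pi * integral {0..y} F) has_real_derivative 2 * pi * F y) (at y)"
    by (intro DERIV_cmult has_real_derivative_integral F y)
  then have "((\<lambda>y. H y / y) has_real_derivative 2 * pi * F y) (at y)"
    by (rule has_field_derivative_transform_within_open[where S = "{0<..}"])
       (use y in \<open>auto simp: H frac_int_1[OF _ F]\<close>)
  then show ?thesis by (simp add: D1_def DERIV_imp_deriv)
qed

lemma frac_int_1_vanishes:
  assumes "\<And>s. s \<le> \<delta> \<Longrightarrow> F s = 0" "y \<le> \<delta>"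
  shows "frac_int 1 F y = 0"
proof -
  have "frac_kernel 1 y s * F s = 0" for s
    using assms by (auto simp: frac_kernel_def indicator_def)
  then have "(\<lambda>s. frac_kernel 1 y s * F s) = (\<lambda>s. 0)" by (simp add: fun_eq_iff)
  then show ?thesis by (simp add: frac_int_eq_kernel)
qed

lemma continuous_on_frac_int_1:
  fixes F :: "real \<Rightarrow> real"
  assumes F: "continuous_on UNIV F" and \<delta>: "0 < \<delta>" "\<And>s. s \<le> \<delta> \<Longrightarrow> F s = 0"
  shows "continuous_on UNIV (frac_int 1 F)"
proof (rule continuous_at_imp_continuous_on, rule ballI)
  fix y :: real
  show "isCont (frac_int 1 F) y"
  proof (cases "0 < y")
    case True
    have "isCont (\<lambda>y. 2 * pi * y * integral {0..y} F) y"
      using DERIV_isCont[OF has_real_derivative_integral[OF F True]] by (intro continuous_intros)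
    moreover have "\<forall>\<^sub>F x in nhds y. frac_int 1 F x = 2 * pi * x * integral {0..x} F"
      using True eventually_nhds_in_open[of "{0<..}" y] frac_int_1[OF _ F]
      by (auto elim!: eventually_mono)
    ultimately show ?thesis by (metis isCont_cong)
  next
    case False
    then have "\<forall>\<^sub>F x in nhds y. frac_int 1 F x = 0"
      using \<delta> eventually_nhds_in_open[of "{..<\<delta>}" y] frac_int_1_vanishes[of \<delta> F]
      by (auto elim!: eventually_mono)
    then show ?thesis by (subst isCont_cong) auto
  qed
qed

text \<open>
  Peeling off one derivative: \<open>I_(n+1) F = I_n (I_1 F)\<close>, so \<open>n\<close> derivatives leave \<open>I_1 F\<close>, and one
  more leaves \<open>F\<close>.  The hypothesis constrains \<open>H\<close> only on the positive half-line because \<open>D1\<close> depends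
  on the germ of its argument.
\<close>

lemma D1_funpow_frac_int:
  fixes F :: "real \<Rightarrow> real"
  assumes F: "continuous_on UNIV F" and \<delta>: "0 < \<delta>" "\<And>s. s \<le> \<delta> \<Longrightarrow> F s = 0"
    and H: "\<And>y. 0 < y \<Longrightarrow> H y = frac_int (real n) F y" and y: "0 < y"
  shows "(D1 ^^ n) H y = F y"
  using F \<delta>(2) H y
proof (induction n arbitrary: F y)
  case 0
  then show ?case by (simp add: frac_int_def)
next
  case (Suc n)
  have "(D1 ^^ n) H y = frac_int 1 F y" if "0 < y" for y
  proof (rule Suc.IH)
    fix y :: real assume y: "0 < y"
    show "H y = frac_int (real n) (frac_int 1 F) y"
    proof (cases "n = 0")
      case True
      then show ?thesis using Suc.prems(3)[OF y] by (simp add: frac_int_def[of 0])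
    next
      case False
      then show ?thesis using Suc.prems(3)[OF y] frac_int_compose[OF _ _ y Suc.prems(1) \<delta>(1) Suc.prems(2), of "real n" 1]
        by (simp add: add.commute)
    qed
  next
    show "frac_int 1 F s = 0" if "s \<le> \<delta>" for s
      using Suc.prems(2) that by (rule frac_int_1_vanishes)
  next
    show "continuous_on UNIV (frac_int 1 F)"
      using Suc.prems(1) \<delta>(1) Suc.prems(2) by (rule continuous_on_frac_int_1)
  qed (use that in auto)
  then show ?case using D1_frac_int_1[OF Suc.prems(1) _ Suc.prems(4)] by simp
qed

text \<open>
  With \<open>\<mu> = \<lceil>\<nu>\<rceil> - \<nu>\<close> the semigroup law gives \<open>I_\<mu> I_\<nu> = I_\<lceil>\<nu>\<rceil>\<close>, an integer order that
  \<open>\<lceil>\<nu>\<rceil>\<close> derivatives undo.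
\<close>

theorem frac_deriv_frac_int:
  fixes F :: "real \<Rightarrow> real"
  assumes \<nu>: "0 \<le> \<nu>" and F: "continuous_on UNIV F" and \<delta>: "0 < \<delta>" "\<And>s. s \<le> \<delta> \<Longrightarrow> F s = 0"
    and G: "\<And>y. 0 < y \<Longrightarrow> G y = frac_int \<nu> F y" and y: "0 < y"
  shows "frac_deriv \<nu> G y = F y"
  unfolding frac_deriv_def
proof (rule D1_funpow_frac_int[OF F \<delta> _ y])
  fix y :: real assume y: "0 < y"
  define \<mu> where "\<mu> = of_int \<lceil>\<nu>\<rceil> - \<nu>"
  have n: "real (nat \<lceil>\<nu>\<rceil>) = \<mu> + \<nu>" using \<nu> by (simp add: \<mu>_def)
  show "frac_int (of_int \<lceil>\<nu>\<rceil> - \<nu>) G y = frac_int (real (nat \<lceil>\<nu>\<rceil>)) F y"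
  proof (cases "\<mu> = 0")
    case True
    then show ?thesis using G[OF y] unfolding n \<mu>_def[symmetric] by (simp add: frac_int_def)
  next
    case False
    then have "0 < \<mu>" using le_of_int_ceiling[of \<nu>] unfolding \<mu>_def by linarith
    moreover have "0 < \<nu>" using False \<nu> by (cases "\<nu> = 0") (auto simp: \<mu>_def)
    moreover have "frac_int \<mu> G y = frac_int \<mu> (frac_int \<nu> F) y" using y G by (intro frac_int_cong) auto
    ultimately show ?thesis unfolding n \<mu>_def[symmetric]
      using frac_int_compose[OF _ _ y F \<delta>, of \<mu> \<nu>] by simp
  qed
qed

section \<open>Lebesgue measure on subspaces\<close>

text \<open>
  Lebesgue measure on \<open>span B\<close> in the coordinates given by \<open>B\<close>.  In contrast to
  \<open>subspace_measure\<close> the basis is explicit, which allows induction on \<open>B\<close>.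
\<close>

definition frame_measure :: "'a::euclidean_space set \<Rightarrow> 'a measure" where
  "frame_measure B = distr (\<Pi>\<^sub>M b\<in>B. lborel) borel (\<lambda>u. \<Sum>b\<in>B. u b *\<^sub>R b)"

definition orthonormal :: "'a::euclidean_space set \<Rightarrow> bool" where
  "orthonormal B \<longleftrightarrow> pairwise orthogonal B \<and> (\<forall>b\<in>B. norm b = 1)"

lemma sets_frame_measure[simp, measurable_cong]: "sets (frame_measure B) = sets borel"
  and space_frame_measure[simp]: "space (frame_measure B) = UNIV"
  by (simp_all add: frame_measure_def)

lemma orthonormal_finite: "orthonormal B \<Longrightarrow> finite B"
  unfolding orthonormal_def by (auto intro: pairwise_orthogonal_imp_finite)

lemma orthonormal_subset: "orthonormal B \<Longrightarrow> A \<subseteq> B \<Longrightarrow> orthonormal A"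
  unfolding orthonormal_def by (auto intro: pairwise_subset)

lemma orthonormal_insertD:
  assumes "orthonormal (insert \<omega> B)" "\<omega> \<notin> B"
  shows "orthonormal B" "norm \<omega> = 1" "\<And>u. u \<in> span B \<Longrightarrow> \<omega> \<bullet> u = 0"
proof -
  show "orthonormal B" using assms(1) by (rule orthonormal_subset) auto
  show "norm \<omega> = 1" using assms by (simp add: orthonormal_def)
  fix u assume u: "u \<in> span B"
  have "orthogonal \<omega> b" if "b \<in> B" for b
    using assms that unfolding orthonormal_def pairwise_def by auto
  then have "orthogonal \<omega> u" using u by (metis orthogonal_to_span)
  then show "\<omega> \<bullet> u = 0" by (simp add: orthogonal_def)
qed

lemma frame_sum_measurable[measurable]:
  fixes B :: "'a::euclidean_space set"
  shows
  "(\<lambda>u. \<Sum>b\<in>B. u b *\<^sub>R b) \<in> borel_measurable (\<Pi>\<^sub>M b\<in>B. lborel)"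
proof (intro borel_measurable_sum borel_measurable_scaleR borel_measurable_const)
  show "(\<lambda>u. u b) \<in> borel_measurable (\<Pi>\<^sub>M b\<in>B. lborel)" if "b \<in> B" for b
    using measurable_component_singleton[OF that, of "\<lambda>_. lborel"] by simp
qed

lemma nn_integral_frame_measure_empty:
  assumes [measurable]: "h \<in> borel_measurable borel"
  shows "(\<integral>\<^sup>+x. h x \<partial>frame_measure {}) = h 0"
  unfolding frame_measure_def
  by (subst nn_integral_distr) (auto simp: PiM_empty nn_integral_count_space_finite)

text \<open>
  Tonelli's theorem for the splitting into the line through \<open>\<omega>\<close> and the span of \<open>B\<close>.  The facts on
  these measures below follow from it by induction on the basis.
\<close>

lemma nn_integral_frame_measure_insert:
  assumes B: "finite B" "\<omega> \<notin> B" and [measurable]: "h \<in> borel_measurable borel"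
  shows "(\<integral>\<^sup>+x. h x \<partial>frame_measure (insert \<omega> B)) = (\<integral>\<^sup>+u. \<integral>\<^sup>+a. h (a *\<^sub>R \<omega> + u) \<partial>lborel \<partial>frame_measure B)"
proof -
  interpret product_sigma_finite "\<lambda>_::'a. lborel :: real measure" by standard
  have *: "(\<lambda>u. h (\<Sum>b\<in>insert \<omega> B. u b *\<^sub>R b)) \<in> borel_measurable (\<Pi>\<^sub>M b\<in>insert \<omega> B. lborel)"
    using B by measurable
  have "(\<integral>\<^sup>+x. h x \<partial>frame_measure (insert \<omega> B)) = (\<integral>\<^sup>+u. h (\<Sum>b\<in>insert \<omega> B. u b *\<^sub>R b) \<partial>(\<Pi>\<^sub>M b\<in>insert \<omega> B. lborel))"
    unfolding frame_measure_def using B by (subst nn_integral_distr) auto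
  also have "\<dots> = (\<integral>\<^sup>+u. \<integral>\<^sup>+a. h (\<Sum>b\<in>insert \<omega> B. (u(\<omega> := a)) b *\<^sub>R b) \<partial>lborel \<partial>(\<Pi>\<^sub>M b\<in>B. lborel))"
    by (rule product_nn_integral_insert[OF B *])
  also have "\<dots> = (\<integral>\<^sup>+u. \<integral>\<^sup>+a. h (a *\<^sub>R \<omega> + (\<Sum>b\<in>B. u b *\<^sub>R b)) \<partial>lborel \<partial>(\<Pi>\<^sub>M b\<in>B. lborel))"
  proof (intro nn_integral_cong)
    fix u :: "'a \<Rightarrow> real" and a :: real
    have "(\<Sum>b\<in>B. (u(\<omega> := a)) b *\<^sub>R b) = (\<Sum>b\<in>B. u b *\<^sub>R b)"
      using B by (intro sum.cong) auto
    then show "h (\<Sum>b\<in>insert \<omega> B. (u(\<omega> := a)) b *\<^sub>R b) = h (a *\<^sub>R \<omega> + (\<Sum>b\<in>B. u b *\<^sub>R b))"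
      using B by simp
  qed
  also have "\<dots> = (\<integral>\<^sup>+u. \<integral>\<^sup>+a. h (a *\<^sub>R \<omega> + u) \<partial>lborel \<partial>frame_measure B)"
    unfolding frame_measure_def using B by (subst nn_integral_distr) auto
  finally show ?thesis .
qed

lemma nn_integral_frame_measure_translate:
  assumes B: "finite B" and v: "v \<in> span B" and h: "h \<in> borel_measurable borel"
  shows "(\<integral>\<^sup>+x. h (x + v) \<partial>frame_measure B) = (\<integral>\<^sup>+x. h x \<partial>frame_measure B)"
  using B v h
proof (induction B arbitrary: v h rule: finite_induct)
  case empty
  then show ?case by simp
next
  case (insert \<omega> B)
  note [measurable] = insert.prems(2)
  from insert.prems(1) obtain k where k: "v - k *\<^sub>R \<omega> \<in> span B" by (auto simp: span_insert)
  have "(\<integral>\<^sup>+x. h (x + v) \<partial>frame_measure (insert \<omega> B)) = (\<integral>\<^sup>+u. \<integral>\<^sup>+a. h (a *\<^sub>R \<omega> + u + v) \<partial>lborel \<partial>frame_measure B)"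
    using insert by (subst nn_integral_frame_measure_insert) auto
  also have "\<dots> = (\<integral>\<^sup>+u. \<integral>\<^sup>+a. h ((k + a) *\<^sub>R \<omega> + (u + (v - k *\<^sub>R \<omega>))) \<partial>lborel \<partial>frame_measure B)"
    by (intro nn_integral_cong) (simp add: algebra_simps)
  also have "\<dots> = (\<integral>\<^sup>+u. \<integral>\<^sup>+a. h (a *\<^sub>R \<omega> + (u + (v - k *\<^sub>R \<omega>))) \<partial>lborel \<partial>frame_measure B)"
    (is "integral\<^sup>N _ ?before = integral\<^sup>N _ ?after")
  proof (rule nn_integral_cong)
    fix u
    show "?before u = ?after u"
      using nn_integral_real_affine[of "\<lambda>a. h (a *\<^sub>R \<omega> + (u + (v - k *\<^sub>R \<omega>)))" 1 k] by simp
  qed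
  also have "\<dots> = (\<integral>\<^sup>+u. \<integral>\<^sup>+a. h (a *\<^sub>R \<omega> + u) \<partial>lborel \<partial>frame_measure B)"
    by (rule insert.IH[OF k]) measurable
  also have "\<dots> = (\<integral>\<^sup>+x. h x \<partial>frame_measure (insert \<omega> B))"
    using insert by (subst nn_integral_frame_measure_insert) auto
  finally show ?case .
qed

lemma AE_frame_measure_span: "AE x in frame_measure B. x \<in> span B"
proof -
  have "AE u in \<Pi>\<^sub>M b\<in>B. lborel. (\<Sum>b\<in>B. u b *\<^sub>R b) \<in> span B"
    by (intro AE_I2 span_sum span_scale span_base)
  moreover have "{x \<in> space borel. x \<in> span B} \<in> sets borel"
    by (simp add: borel_closed closed_subspace)
  ultimately show ?thesis
    unfolding frame_measure_def by (subst AE_distr_iff) simp_all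
qed

lemma orthonormal_norm_sq:
  assumes "orthonormal (insert \<omega> B)" "\<omega> \<notin> B" "u \<in> span B"
  shows "(norm (a *\<^sub>R \<omega> + u))\<^sup>2 = a\<^sup>2 + (norm u)\<^sup>2"
proof -
  have "orthogonal (a *\<^sub>R \<omega>) u" using orthonormal_insertD(3)[OF assms] by (simp add: orthogonal_def)
  then show ?thesis using orthonormal_insertD(2)[OF assms(1,2)]
    by (simp add: norm_add_Pythagorean)
qed

lemma nn_integral_frame_measure_radial_insert:
  fixes h :: "real \<Rightarrow> ennreal"
  assumes o: "orthonormal (insert \<omega> B)" "\<omega> \<notin> B" and [measurable]: "h \<in> borel_measurable borel"
  shows "(\<integral>\<^sup>+x. h (norm x) \<partial>frame_measure (insert \<omega> B))
       = (\<integral>\<^sup>+u. \<integral>\<^sup>+a. h (sqrt (a\<^sup>2 + (norm u)\<^sup>2)) \<partial>lborel \<partial>frame_measure B)"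
proof -
  have fB: "finite B" using o by (auto dest: orthonormal_finite)
  have "(\<integral>\<^sup>+x. h (norm x) \<partial>frame_measure (insert \<omega> B)) = (\<integral>\<^sup>+u. \<integral>\<^sup>+a. h (norm (a *\<^sub>R \<omega> + u)) \<partial>lborel \<partial>frame_measure B)"
    by (rule nn_integral_frame_measure_insert[OF fB o(2)]) measurable
  also have "\<dots> = (\<integral>\<^sup>+u. \<integral>\<^sup>+a. h (sqrt (a\<^sup>2 + (norm u)\<^sup>2)) \<partial>lborel \<partial>frame_measure B)"
    using AE_frame_measure_span[of B]
  proof (intro nn_integral_cong_AE, elim eventually_mono)
    fix u assume u: "u \<in> span B"
    have "norm (a *\<^sub>R \<omega> + u) = sqrt (a\<^sup>2 + (norm u)\<^sup>2)" for a
      using orthonormal_norm_sq[OF o u, of a] by (metis norm_ge_zero real_sqrt_unique)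
    then show "(\<integral>\<^sup>+a. h (norm (a *\<^sub>R \<omega> + u)) \<partial>lborel) = (\<integral>\<^sup>+a. h (sqrt (a\<^sup>2 + (norm u)\<^sup>2)) \<partial>lborel)"
      by simp
  qed
  finally show ?thesis .
qed

text \<open>
  For radial integrands the inductive step only uses the norm, so the bases may even span different
  subspaces.
\<close>

lemma nn_integral_frame_measure_radial_cong:
  fixes B B' :: "'a::euclidean_space set" and h :: "real \<Rightarrow> ennreal"
  assumes "orthonormal B" "orthonormal B'" "card B = card B'" "h \<in> borel_measurable borel"
  shows "(\<integral>\<^sup>+x. h (norm x) \<partial>frame_measure B) = (\<integral>\<^sup>+x. h (norm x) \<partial>frame_measure B')"
  using orthonormal_finite[OF assms(1)] assms
proof (induction B arbitrary: B' h rule: finite_induct)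
  case empty
  then have "B' = {}" using orthonormal_finite[of B'] by simp
  then show ?case by simp
next
  case (insert \<omega> B)
  note [measurable] = insert.prems(4)
  have fB': "finite B'" using insert.prems by (simp add: orthonormal_finite)
  obtain \<omega>' C where C: "B' = insert \<omega>' C" "\<omega>' \<notin> C" "card B = card C"
    using insert.prems(3) insert.hyps fB' by (metis card_Suc_eq card_insert_disjoint diff_Suc_1)
  define H where "H r = (\<integral>\<^sup>+a. h (sqrt (a\<^sup>2 + r\<^sup>2)) \<partial>lborel)" for r
  have "(\<integral>\<^sup>+x. H (norm x) \<partial>frame_measure B) = (\<integral>\<^sup>+x. H (norm x) \<partial>frame_measure C)"
  proof (rule insert.IH)
    show "orthonormal B" "orthonormal C"
      using insert.prems(1,2) by (auto intro: orthonormal_subset simp: C)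
    show "H \<in> borel_measurable borel" unfolding H_def by measurable
  qed (rule C)
  then show ?case
    unfolding C(1) using insert C
    by (simp add: nn_integral_frame_measure_radial_insert H_def)
qed

lemma emeasure_frame_measure_cball:
  fixes B :: "'a::euclidean_space set"
  shows "emeasure (frame_measure B) (cball (0::'a) r) = (\<integral>\<^sup>+x. indicator {..r} (norm x) \<partial>frame_measure B)"
proof -
  have "(\<lambda>x. indicator {..r} (norm x)) = (indicator (cball (0::'a) r) :: 'a \<Rightarrow> ennreal)"
    by (auto simp: fun_eq_iff indicator_def)
  then show ?thesis by simp
qed

lemma emeasure_frame_measure_cball_finite:
  fixes B :: "'a::euclidean_space set"
  assumes "orthonormal B"
  shows "emeasure (frame_measure B) (cball (0::'a) r) < \<infinity>"
  using orthonormal_finite[OF assms] assms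
proof (induction B rule: finite_induct)
  case empty
  have "emeasure (frame_measure {}) (cball (0::'a) r) = indicator {..r} (norm (0::'a))"
    unfolding emeasure_frame_measure_cball by (rule nn_integral_frame_measure_empty) simp
  then show ?case by (simp add: indicator_def)
next
  case (insert \<omega> B)
  have "emeasure (frame_measure (insert \<omega> B)) (cball 0 r) = (\<integral>\<^sup>+x. indicator {..r} (norm x) \<partial>frame_measure (insert \<omega> B))"
    by (rule emeasure_frame_measure_cball)
  also have "\<dots> = (\<integral>\<^sup>+u. \<integral>\<^sup>+a. indicator {..r} (sqrt (a\<^sup>2 + (norm u)\<^sup>2)) \<partial>lborel \<partial>frame_measure B)"
    using insert by (subst nn_integral_frame_measure_radial_insert) auto
  also have "\<dots> \<le> (\<integral>\<^sup>+u. \<integral>\<^sup>+a. indicator (cball 0 r) u * indicator {-r..r} a \<partial>lborel \<partial>frame_measure B)"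
  proof (intro nn_integral_mono)
    fix u a
    have "norm u \<le> sqrt (a\<^sup>2 + (norm u)\<^sup>2)" "\<bar>a\<bar> \<le> sqrt (a\<^sup>2 + (norm u)\<^sup>2)" by (auto intro!: real_le_rsqrt)
    then have "norm u \<le> r \<and> \<bar>a\<bar> \<le> r" if "sqrt (a\<^sup>2 + (norm u)\<^sup>2) \<le> r" using that by linarith
    then show "indicator {..r} (sqrt (a\<^sup>2 + (norm u)\<^sup>2)) \<le> (indicator (cball 0 r) u * indicator {-r..r} a :: ennreal)"
      by (cases "sqrt (a\<^sup>2 + (norm u)\<^sup>2) \<le> r") (auto simp: indicator_def abs_le_iff)
  qed
  also have "\<dots> = emeasure (frame_measure B) (cball 0 r) * emeasure lborel {-r..r}"
    by (subst nn_integral_cmult, simp, subst nn_integral_multc) (auto intro!: borel_measurable_indicator)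
  also have "\<dots> < \<infinity>"
    using insert.IH orthonormal_subset[OF insert.prems subset_insertI]
    by (auto simp: ennreal_mult_less_top emeasure_lborel_Icc_eq)
  finally show ?case .
qed

lemma emeasure_frame_measure_cball_pos:
  fixes B :: "'a::euclidean_space set"
  assumes "orthonormal B" "0 < r"
  shows "0 < emeasure (frame_measure B) (cball 0 r)"
  using orthonormal_finite[OF assms(1)] assms
proof (induction B arbitrary: r rule: finite_induct)
  case empty
  have "emeasure (frame_measure {}) (cball (0::'a) r) = indicator {..r} (norm (0::'a))"
    unfolding emeasure_frame_measure_cball by (rule nn_integral_frame_measure_empty) simp
  then show ?case using empty by (simp add: indicator_def)
next
  case (insert \<omega> B)
  have "emeasure (frame_measure (insert \<omega> B)) (cball 0 r) = (\<integral>\<^sup>+x. indicator {..r} (norm x) \<partial>frame_measure (insert \<omega> B))"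
    by (rule emeasure_frame_measure_cball)
  also have "\<dots> = (\<integral>\<^sup>+u. \<integral>\<^sup>+a. indicator {..r} (sqrt (a\<^sup>2 + (norm u)\<^sup>2)) \<partial>lborel \<partial>frame_measure B)"
    using insert by (subst nn_integral_frame_measure_radial_insert) auto
  also have "\<dots> \<ge> (\<integral>\<^sup>+u. \<integral>\<^sup>+a. indicator (cball 0 (r/2)) u * indicator {-r/2..r/2} a \<partial>lborel \<partial>frame_measure B)"
  proof (intro nn_integral_mono)
    fix u a
    have "sqrt (a\<^sup>2 + (norm u)\<^sup>2) \<le> \<bar>a\<bar> + norm u" by (intro real_le_lsqrt) (auto simp: power2_sum)
    then have "sqrt (a\<^sup>2 + (norm u)\<^sup>2) \<le> r" if "norm u \<le> r/2" "\<bar>a\<bar> \<le> r/2" using that by linarith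
    then show "(indicator (cball 0 (r/2)) u * indicator {-r/2..r/2} a :: ennreal) \<le> indicator {..r} (sqrt (a\<^sup>2 + (norm u)\<^sup>2))"
      by (auto simp: indicator_def abs_le_iff)
  qed
  also have "(\<integral>\<^sup>+u. \<integral>\<^sup>+a. indicator (cball 0 (r/2)) u * indicator {-r/2..r/2} a \<partial>lborel \<partial>frame_measure B)
     = emeasure (frame_measure B) (cball 0 (r/2)) * emeasure lborel {-r/2..r/2}"
    by (subst nn_integral_cmult, simp, subst nn_integral_multc) (auto intro!: borel_measurable_indicator)
  finally have "emeasure (frame_measure B) (cball 0 (r/2)) * emeasure lborel {-r/2..r/2} \<le> emeasure (frame_measure (insert \<omega> B)) (cball 0 r)" .
  moreover have "0 < emeasure (frame_measure B) (cball 0 (r/2)) * emeasure lborel {-r/2..r/2}"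
    using insert.IH[of "r/2"] orthonormal_subset[OF insert.prems(1) subset_insertI] insert.prems(2)
    by (auto simp: ennreal_zero_less_mult_iff emeasure_lborel_Icc_eq)
  ultimately show ?case by (rule less_le_trans[rotated])
qed

lemma sigma_finite_frame_measure:
  fixes B :: "'a::euclidean_space set"
  assumes "orthonormal B"
  shows "sigma_finite_measure (frame_measure B)"
proof
  let ?A = "range (\<lambda>n::nat. cball (0::'a) (real n))"
  have "x \<in> \<Union>?A" for x using real_arch_simple[of "norm x"] by auto
  then have "\<Union>?A = space (frame_measure B)" by auto
  moreover have "\<forall>a\<in>?A. emeasure (frame_measure B) a \<noteq> \<infinity>"
    using emeasure_frame_measure_cball_finite[OF assms] by (auto simp: less_top)
  ultimately show "\<exists>A. countable A \<and> A \<subseteq> sets (frame_measure B) \<and> \<Union>A = space (frame_measure B) \<and> (\<forall>a\<in>A. emeasure (frame_measure B) a \<noteq> \<infinity>)"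
    by (intro exI[of _ ?A]) auto
qed

lemma orthonormal_card_eq:
  fixes B B' :: "'a::euclidean_space set"
  assumes o: "orthonormal B" "orthonormal B'" and sp: "span B = span B'"
  shows "card B = card B'"
  using o sp by (metis dim_eq_card indep_card_eq_dim_span independent_explicit orthonormal_def
        pairwise_orthogonal_independent norm_zero zero_neq_one dim_span)

text \<open>
  Uniqueness of Haar measure.  For translation invariant measures \<open>\<mu>\<close> and \<open>\<lambda>\<close> on the same subspace
  and the unit ball \<open>b = - b\<close>, evaluating the double integral of \<open>indicator b y * indicator A (x + y)\<close>
  in both orders gives \<open>\<mu> A * \<lambda> b = \<lambda> A * \<mu> b\<close>.  The balls have equal measure since they are radial.
\<close>

lemma frame_measure_unique:
  fixes B B' :: "'a::euclidean_space set"
  assumes o: "orthonormal B" "orthonormal B'" and sp: "span B = span B'"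
  shows "frame_measure B = frame_measure B'"
proof (rule measure_eqI)
  fix A assume "A \<in> sets (frame_measure B)"
  then have A[measurable]: "A \<in> sets borel" by simp
  interpret M: sigma_finite_measure "frame_measure B" using o by (simp add: sigma_finite_frame_measure)
  interpret L: sigma_finite_measure "frame_measure B'" using o by (simp add: sigma_finite_frame_measure)
  interpret P: pair_sigma_finite "frame_measure B" "frame_measure B'" ..
  have fin: "finite B" "finite B'" using o by (simp_all add: orthonormal_finite)
  let ?b = "cball (0::'a) 1"
  have sets_prod: "sets (frame_measure B \<Otimes>\<^sub>M frame_measure B') = sets (borel :: ('a \<times> 'a) measure)"
    by (simp add: borel_prod[symmetric] cong: sets_pair_measure_cong)
  have meas: "(\<lambda>z. indicator C (\<phi> z) * indicator D (\<psi> z) :: ennreal) \<in> borel_measurable (frame_measure B \<Otimes>\<^sub>M frame_measure B')"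
    if "C \<in> sets borel" "D \<in> sets borel" "continuous_on UNIV \<phi>" "continuous_on UNIV \<psi>"
    for C D :: "'a set" and \<phi> \<psi> :: "'a \<times> 'a \<Rightarrow> 'a"
    unfolding measurable_cong_sets[OF sets_prod refl] using that
    by (intro borel_measurable_times_ennreal measurable_compose[OF borel_measurable_continuous_onI borel_measurable_indicator])
  let ?m = "emeasure (frame_measure B)" and ?l = "emeasure (frame_measure B')"
  have card: "card B = card B'" using o sp by (rule orthonormal_card_eq)
  have ball: "?m ?b = ?l ?b"
  proof -
    show ?thesis using nn_integral_frame_measure_radial_cong[OF o card, of "indicator {..1}"]
      unfolding emeasure_frame_measure_cball by simp
  qed
  have "?m A * ?l ?b = (\<integral>\<^sup>+y. indicator ?b y * (\<integral>\<^sup>+x. indicator A x \<partial>frame_measure B) \<partial>frame_measure B')"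
    by (simp add: nn_integral_cmult_indicator mult.commute[of "indicator _ _"])
  also have "\<dots> = (\<integral>\<^sup>+y. \<integral>\<^sup>+x. indicator ?b y * indicator A (x + y) \<partial>frame_measure B \<partial>frame_measure B')"
    using AE_frame_measure_span[of B']
  proof (intro nn_integral_cong_AE, elim eventually_mono)
    fix y assume "y \<in> span B'"
    then have y: "y \<in> span B" by (simp add: sp)
    have "(\<integral>\<^sup>+x. indicator A x \<partial>frame_measure B) = (\<integral>\<^sup>+x. indicator A (x + y) \<partial>frame_measure B)"
      by (rule nn_integral_frame_measure_translate[OF fin(1) y, symmetric]) simp
    then show "indicator ?b y * (\<integral>\<^sup>+x. indicator A x \<partial>frame_measure B)
        = (\<integral>\<^sup>+x. indicator ?b y * indicator A (x + y) \<partial>frame_measure B)"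
      by (simp add: nn_integral_cmult del: nn_integral_indicator)
  qed
  also have "\<dots> = (\<integral>\<^sup>+x. \<integral>\<^sup>+y. indicator ?b y * indicator A (x + y) \<partial>frame_measure B' \<partial>frame_measure B)"
    using meas[of ?b A snd "\<lambda>z. fst z + snd z"]
    by (intro P.Fubini') (simp add: split_beta' continuous_intros)
  also have "\<dots> = (\<integral>\<^sup>+x. \<integral>\<^sup>+y. indicator ?b (y - x) * indicator A y \<partial>frame_measure B' \<partial>frame_measure B)"
    using AE_frame_measure_span[of B]
  proof (intro nn_integral_cong_AE, elim eventually_mono)
    fix x assume "x \<in> span B"
    then have x: "- x \<in> span B'" by (simp add: sp span_neg)
    have "(\<integral>\<^sup>+y. indicator ?b (y + - x) * indicator A (x + (y + - x)) \<partial>frame_measure B')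
        = (\<integral>\<^sup>+y. indicator ?b y * indicator A (x + y) \<partial>frame_measure B')"
      by (intro nn_integral_frame_measure_translate[OF fin(2) x] borel_measurable_times_ennreal
          measurable_compose[OF borel_measurable_continuous_onI borel_measurable_indicator] continuous_intros) simp_all
    then show "(\<integral>\<^sup>+y. indicator ?b y * indicator A (x + y) \<partial>frame_measure B')
        = (\<integral>\<^sup>+y. indicator ?b (y - x) * indicator A y \<partial>frame_measure B')" by simp
  qed
  also have "\<dots> = (\<integral>\<^sup>+y. \<integral>\<^sup>+x. indicator ?b (y - x) * indicator A y \<partial>frame_measure B \<partial>frame_measure B')"
    using meas[of ?b A "\<lambda>z. snd z - fst z" snd]
    by (intro P.Fubini'[symmetric]) (simp add: split_beta' continuous_intros)
  also have "\<dots> = (\<integral>\<^sup>+y. ?m ?b * indicator A y \<partial>frame_measure B')"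
    using AE_frame_measure_span[of B']
  proof (intro nn_integral_cong_AE, elim eventually_mono)
    fix y assume "y \<in> span B'"
    then have y: "- y \<in> span B" by (simp add: sp span_neg)
    have "(\<integral>\<^sup>+x. indicator ?b (y - x) * indicator A y \<partial>frame_measure B)
        = (\<integral>\<^sup>+x. indicator ?b (x + - y) \<partial>frame_measure B) * indicator A y"
      by (subst nn_integral_multc[symmetric]) (auto intro!: nn_integral_cong simp: indicator_def norm_minus_commute)
    also have "(\<integral>\<^sup>+x. indicator ?b (x + - y) \<partial>frame_measure B) = (\<integral>\<^sup>+x. indicator ?b x \<partial>frame_measure B)"
      by (rule nn_integral_frame_measure_translate[OF fin(1) y]) (auto intro!: borel_measurable_indicator)
    finally show "(\<integral>\<^sup>+x. indicator ?b (y - x) * indicator A y \<partial>frame_measure B) = ?m ?b * indicator A y" by simp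
  qed
  also have "\<dots> = ?l A * ?l ?b" by (simp add: nn_integral_cmult_indicator ball mult.commute[of "?l A"])
  finally have "?m A * ?l ?b = ?l A * ?l ?b" .
  moreover have "0 < ?l ?b" "?l ?b < \<infinity>"
    using emeasure_frame_measure_cball_pos[OF o(2), of 1] emeasure_frame_measure_cball_finite[OF o(2), of 1] by auto
  ultimately show "?m A = ?l A"
    by (auto simp: mult.commute[of _ "?l ?b"] ennreal_mult_cancel_left)
qed simp

lemma subspace_measure_eq:
  assumes "orthonormal B" "span B = V"
  shows "subspace_measure V = frame_measure B"
proof -
  have "orthonormal_basis_of V B"
    using assms span_superset[of B] by (auto simp: orthonormal_basis_of_def orthonormal_def)
  then have "orthonormal_basis_of V (SOME B. orthonormal_basis_of V B)" by (rule someI)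
  then have "orthonormal (SOME B. orthonormal_basis_of V B)" "span (SOME B. orthonormal_basis_of V B) = V"
    by (auto simp: orthonormal_basis_of_def orthonormal_def)
  then have "frame_measure (SOME B. orthonormal_basis_of V B) = frame_measure B"
    using assms by (intro frame_measure_unique) auto
  then show ?thesis by (simp add: subspace_measure_def frame_measure_def Let_def)
qed

section \<open>Integration over half-spheres\<close>

text \<open>
  The area element of the upper half of the sphere of radius \<open>y\<close> at distance \<open>r\<close> from the centre,
  measured in the equatorial plane; the value is \<open>0\<close> for points not below the sphere.
\<close>

definition sphere_density :: "real \<Rightarrow> real \<Rightarrow> real" where
  "sphere_density y r = (if r < y then y / sqrt (y\<^sup>2 - r\<^sup>2) else 0)"

lemma sphere_density_measurable[measurable]:
  assumes [measurable]: "a \<in> borel_measurable M" "b \<in> borel_measurable M"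
  shows "(\<lambda>x. sphere_density (a x) (b x)) \<in> borel_measurable M"
  unfolding sphere_density_def by measurable

lemma sphere_density_nonneg: "0 \<le> r \<Longrightarrow> 0 \<le> sphere_density y r"
  by (auto simp: sphere_density_def power_mono)

lemma nn_integral_even:
  fixes h :: "real \<Rightarrow> ennreal"
  assumes [measurable]: "h \<in> borel_measurable borel"
  shows "(\<integral>\<^sup>+a. h \<bar>a\<bar> \<partial>lborel) = 2 * (\<integral>\<^sup>+a. h a * indicator {0<..} a \<partial>lborel)"
proof -
  have "(\<integral>\<^sup>+a. h \<bar>a\<bar> \<partial>lborel) = (\<integral>\<^sup>+a. h a * indicator {0<..} a + h (- a) * indicator {0<..} (- a) \<partial>lborel)"
    using AE_lborel_singleton[of "0::real"]
    by (intro nn_integral_cong_AE, elim eventually_mono) (auto simp: indicator_def abs_if)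
  also have "\<dots> = (\<integral>\<^sup>+a. h a * indicator {0<..} a \<partial>lborel) + (\<integral>\<^sup>+a. h (- a) * indicator {0<..} (- a) \<partial>lborel)"
    by (rule nn_integral_add) measurable
  also have "(\<integral>\<^sup>+a. h (- a) * indicator {0<..} (- a) \<partial>lborel) = (\<integral>\<^sup>+a. h a * indicator {0<..} a \<partial>lborel)"
    using nn_integral_real_affine[of "\<lambda>a. h a * indicator {0<..} a" "-1" 0] by simp
  finally show ?thesis by (simp add: mult_2)
qed

lemma frac_kernel_half: "frac_kernel (1/2) y s = indicator {0<..<y} s * (2 * y / sqrt (y\<^sup>2 - s\<^sup>2))"
proof (cases "s \<in> {0<..<y}")
  case True
  then have "0 < y\<^sup>2 - s\<^sup>2" by (simp add: power_strict_mono)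
  then have "(y\<^sup>2 - s\<^sup>2) powr (1/2 - 1) = 1 / sqrt (y\<^sup>2 - s\<^sup>2)"
    using powr_minus_divide[of "y\<^sup>2 - s\<^sup>2" "1/2"] by (simp add: powr_half_sqrt)
  then show ?thesis using True by (simp add: frac_kernel_def Gamma_one_half_real powr_half_sqrt)
qed (simp add: frac_kernel_def)

lemma nn_integral_sphere_density_1:
  fixes h :: "real \<Rightarrow> ennreal"
  assumes [measurable]: "h \<in> borel_measurable borel" and y: "0 < y"
  shows "(\<integral>\<^sup>+a. ennreal (sphere_density y \<bar>a\<bar>) * h (sqrt (y\<^sup>2 - a\<^sup>2)) \<partial>lborel)
       = (\<integral>\<^sup>+s. ennreal (frac_kernel (1/2) y s) * h s \<partial>lborel)"
proof -
  have "(\<integral>\<^sup>+a. ennreal (sphere_density y \<bar>a\<bar>) * h (sqrt (y\<^sup>2 - a\<^sup>2)) \<partial>lborel)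
      = 2 * (\<integral>\<^sup>+a. ennreal (sphere_density y a) * h (sqrt (y\<^sup>2 - a\<^sup>2)) * indicator {0<..} a \<partial>lborel)"
    using nn_integral_even[of "\<lambda>a. ennreal (sphere_density y a) * h (sqrt (y\<^sup>2 - a\<^sup>2))"] by simp
  also have "(\<integral>\<^sup>+a. ennreal (sphere_density y a) * h (sqrt (y\<^sup>2 - a\<^sup>2)) * indicator {0<..} a \<partial>lborel)
      = (\<integral>\<^sup>+a. ennreal y * h (sqrt (y\<^sup>2 - a\<^sup>2)) * ennreal (1 / sqrt (y\<^sup>2 - a\<^sup>2)) * indicator {0<..<y} a \<partial>lborel)"
        (is "integral\<^sup>N _ ?before = integral\<^sup>N _ ?after")
  proof (intro nn_integral_cong)
    fix a
    have "ennreal (y / sqrt (y\<^sup>2 - a\<^sup>2)) = ennreal y * ennreal (1 / sqrt (y\<^sup>2 - a\<^sup>2))" if "0 < a" "a < y"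
      using that y by (subst ennreal_mult[symmetric]) (auto simp: power_mono)
    then show "?before a = ?after a"
      by (auto simp: sphere_density_def indicator_def mult_ac)
  qed
  also have "\<dots> = (\<integral>\<^sup>+s. ennreal y * h s * ennreal (1 / sqrt (y\<^sup>2 - s\<^sup>2)) * indicator {0<..<y} s \<partial>lborel)"
    by (rule nn_integral_half_circle[where \<Phi> = "\<lambda>a s. ennreal y * h s"]) measurable
  also have "2 * \<dots> = (\<integral>\<^sup>+s. 2 * (ennreal y * h s * ennreal (1 / sqrt (y\<^sup>2 - s\<^sup>2)) * indicator {0<..<y} s) \<partial>lborel)"
    by (rule nn_integral_cmult[symmetric]) measurable
  also have "\<dots> = (\<integral>\<^sup>+s. ennreal (frac_kernel (1/2) y s) * h s \<partial>lborel)"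
    (is "integral\<^sup>N _ ?before = integral\<^sup>N _ ?after")
  proof (intro nn_integral_cong)
    fix s
    have "ennreal (2 * y / sqrt (y\<^sup>2 - s\<^sup>2)) = 2 * (ennreal y * ennreal (1 / sqrt (y\<^sup>2 - s\<^sup>2)))" if "0 < s" "s < y"
    proof -
      have "ennreal (2 * (y * (1 / sqrt (y\<^sup>2 - s\<^sup>2)))) = ennreal 2 * (ennreal y * ennreal (1 / sqrt (y\<^sup>2 - s\<^sup>2)))"
        using that y by (subst ennreal_mult, simp, simp add: power_mono, subst ennreal_mult) (auto simp: power_mono)
      then show ?thesis by simp
    qed
    then show "?before s = ?after s"
      unfolding frac_kernel_half by (auto simp: indicator_def mult_ac)
  qed
  finally show ?thesis .
qed

text \<open>
  Cutting a sphere at the coordinate \<open>a\<close> leaves a sphere of radius \<open>q = sqrt (y\<^sup>2 - a\<^sup>2)\<close>; its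
  density contains the factor \<open>q\<close> that the slicing of the larger sphere has in the denominator.
\<close>

lemma sphere_density_slice:
  assumes y: "0 < y" and a: "\<bar>a\<bar> < y" and r: "0 \<le> r"
  shows "sphere_density y (sqrt (a\<^sup>2 + r\<^sup>2)) = sphere_density y \<bar>a\<bar> * sphere_density (sqrt (y\<^sup>2 - a\<^sup>2)) r"
proof -
  let ?q = "sqrt (y\<^sup>2 - a\<^sup>2)"
  have "a\<^sup>2 < y\<^sup>2" using a y by (metis abs_of_pos abs_square_eq_1 power2_abs power_strict_mono abs_ge_zero zero_less_numeral)
  then have q: "0 < ?q" "?q\<^sup>2 = y\<^sup>2 - a\<^sup>2" by auto
  have "sqrt (a\<^sup>2 + r\<^sup>2) < y \<longleftrightarrow> a\<^sup>2 + r\<^sup>2 < y\<^sup>2"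
    using y real_sqrt_less_iff[of "a\<^sup>2 + r\<^sup>2" "y\<^sup>2"] by simp
  also have "\<dots> \<longleftrightarrow> r < ?q"
    using r real_sqrt_less_iff[of "r\<^sup>2" "y\<^sup>2 - a\<^sup>2"] by (simp add: less_diff_eq add.commute)
  finally show ?thesis
    using a q by (auto simp: sphere_density_def add_nonneg_nonneg diff_diff_eq)
qed

text \<open>
  Induction on the dimension: slicing along \<open>\<omega>\<close> writes the integral as \<open>I_(1/2)\<close> of the lower
  dimensional one, and \<open>I_(1/2) I_(m/2) = I_((m+1)/2)\<close>.  In dimension \<open>0\<close> the half-sphere is the
  single point at height \<open>y\<close>, which is why the empty basis is treated separately.
\<close>

lemma nn_integral_sphere_density:
  fixes B :: "'a::euclidean_space set" and h :: "real \<Rightarrow> ennreal"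
  assumes "orthonormal B" "0 < y" "h \<in> borel_measurable borel"
  shows "(\<integral>\<^sup>+v. ennreal (sphere_density y (norm v)) * h (sqrt (y\<^sup>2 - (norm v)\<^sup>2)) \<partial>frame_measure B)
       = (if B = {} then h y else (\<integral>\<^sup>+s. ennreal (frac_kernel (real (card B) / 2) y s) * h s \<partial>lborel))"
  using orthonormal_finite[OF assms(1)] assms
proof (induction B arbitrary: y rule: finite_induct)
  case empty
  note [measurable] = empty(3)
  show ?case using empty by (subst nn_integral_frame_measure_empty) (auto simp: sphere_density_def)
next
  case (insert \<omega> B)
  note [measurable] = insert.prems(3) and y = insert.prems(2)
  have oB: "orthonormal B" using insert.prems(1) by (rule orthonormal_subset) auto
  interpret M: sigma_finite_measure "frame_measure B" by (rule sigma_finite_frame_measure[OF oB])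
  interpret P: pair_sigma_finite "frame_measure B" "lborel :: real measure" ..
  define \<Phi> where "\<Phi> q = (if B = {} then h q else (\<integral>\<^sup>+s. ennreal (frac_kernel (real (card B) / 2) q s) * h s \<partial>lborel))" for q
  have [measurable]: "\<Phi> \<in> borel_measurable borel" unfolding \<Phi>_def by (cases "B = {}") simp_all
  have "(\<integral>\<^sup>+v. ennreal (sphere_density y (norm v)) * h (sqrt (y\<^sup>2 - (norm v)\<^sup>2)) \<partial>frame_measure (insert \<omega> B))
      = (\<integral>\<^sup>+u. \<integral>\<^sup>+a. ennreal (sphere_density y (sqrt (a\<^sup>2 + (norm u)\<^sup>2))) * h (sqrt (y\<^sup>2 - (sqrt (a\<^sup>2 + (norm u)\<^sup>2))\<^sup>2)) \<partial>lborel \<partial>frame_measure B)"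
    by (rule nn_integral_frame_measure_radial_insert[OF insert.prems(1) insert.hyps(2)]) measurable
  also have "\<dots> = (\<integral>\<^sup>+a. \<integral>\<^sup>+u. ennreal (sphere_density y (sqrt (a\<^sup>2 + (norm u)\<^sup>2))) * h (sqrt (y\<^sup>2 - (sqrt (a\<^sup>2 + (norm u)\<^sup>2))\<^sup>2)) \<partial>frame_measure B \<partial>lborel)"
    by (rule P.Fubini'[symmetric]) measurable
  also have "\<dots> = (\<integral>\<^sup>+a. ennreal (sphere_density y \<bar>a\<bar>) * \<Phi> (sqrt (y\<^sup>2 - a\<^sup>2)) \<partial>lborel)"
    (is "integral\<^sup>N _ ?before = integral\<^sup>N _ ?after")
  proof (intro nn_integral_cong)
    fix a :: real
    let ?q = "sqrt (y\<^sup>2 - a\<^sup>2)"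
    show "?before a = ?after a"
    proof (cases "\<bar>a\<bar> < y")
      case True
      then have "a\<^sup>2 < y\<^sup>2" using y by (metis abs_of_pos abs_le_square_iff linorder_not_less)
      then have q: "0 < ?q" "?q\<^sup>2 = y\<^sup>2 - a\<^sup>2" by auto
      have "(\<integral>\<^sup>+u. ennreal (sphere_density y (sqrt (a\<^sup>2 + (norm u)\<^sup>2))) * h (sqrt (y\<^sup>2 - (sqrt (a\<^sup>2 + (norm u)\<^sup>2))\<^sup>2)) \<partial>frame_measure B)
          = (\<integral>\<^sup>+u. ennreal (sphere_density y \<bar>a\<bar>) * (ennreal (sphere_density ?q (norm u)) * h (sqrt (?q\<^sup>2 - (norm u)\<^sup>2))) \<partial>frame_measure B)"
        using q(2) by (intro nn_integral_cong)
          (simp add: sphere_density_slice[OF y True] ennreal_mult sphere_density_nonneg mult.assoc diff_diff_eq add_nonneg_nonneg)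
      also have "\<dots> = ennreal (sphere_density y \<bar>a\<bar>) * \<Phi> ?q"
        unfolding \<Phi>_def insert.IH[OF oB q(1) insert.prems(3), symmetric]
        by (rule nn_integral_cmult) measurable
      finally show ?thesis .
    next
      case False
      then have "\<not> sqrt (a\<^sup>2 + (norm u)\<^sup>2) < y" for u :: 'a
        using real_sqrt_ge_abs1[of a "norm u"] by linarith
      then show ?thesis using False by (simp add: sphere_density_def)
    qed
  qed
  also have "\<dots> = (\<integral>\<^sup>+s. ennreal (frac_kernel (1/2) y s) * \<Phi> s \<partial>lborel)"
    by (rule nn_integral_sphere_density_1[OF _ y]) measurable
  also have "\<dots> = (\<integral>\<^sup>+s. ennreal (frac_kernel (real (card (insert \<omega> B)) / 2) y s) * h s \<partial>lborel)"
  proof (cases "B = {}")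
    case True
    then show ?thesis by (simp add: \<Phi>_def)
  next
    case False
    then have "0 < card B" using insert.hyps by (simp add: card_gt_0_iff)
    then show ?thesis using False insert.hyps nn_integral_frac_kernel_compose[of "1/2" "real (card B) / 2" h y]
      by (simp add: \<Phi>_def add_divide_distrib)
  qed
  finally show ?case by simp
qed

lemma integral_frame_measure_empty:
  fixes g :: "'a::euclidean_space \<Rightarrow> real"
  assumes [measurable]: "g \<in> borel_measurable borel"
  shows "(LINT x|frame_measure {}. g x) = g 0"
  unfolding frame_measure_def
  by (subst integral_distr) (auto simp: PiM_empty lebesgue_integral_count_space_finite)

lemma integral_sphere_density:
  fixes B :: "'a::euclidean_space set" and F :: "real \<Rightarrow> real"
  assumes o: "orthonormal B" and y: "0 < y" and [measurable]: "F \<in> borel_measurable borel"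
  shows "(LINT v|frame_measure B. sphere_density y (norm v) * F (sqrt (y\<^sup>2 - (norm v)\<^sup>2))) = frac_int (real (card B) / 2) F y"
proof (cases "B = {}")
  case True
  then show ?thesis using y
    by (subst True, subst integral_frame_measure_empty) (simp_all add: frac_int_def sphere_density_def)
next
  case False
  then have c: "0 < card B" using orthonormal_finite[OF o] by (simp add: card_gt_0_iff)
  have "(LINT v|frame_measure B. sphere_density y (norm v) * F (sqrt (y\<^sup>2 - (norm v)\<^sup>2))) = (LINT s|lborel. frac_kernel (real (card B) / 2) y s * F s)"
  proof (rule integral_transfer[where \<psi> = "\<lambda>s. s"])
    show "(\<integral>\<^sup>+v. ennreal (sphere_density y (norm v)) * h (sqrt (y\<^sup>2 - (norm v)\<^sup>2)) \<partial>frame_measure B) = (\<integral>\<^sup>+s. ennreal (frac_kernel (real (card B) / 2) y s) * h s \<partial>lborel)"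
      if "h \<in> borel_measurable borel" for h
      using nn_integral_sphere_density[OF o y that] False by simp
  qed (use c in \<open>auto simp: sphere_density_nonneg frac_kernel_nonneg\<close>)
  then show ?thesis using c by (simp add: frac_int_eq_kernel)
qed

lemma integral_frame_measure_translate:
  fixes g :: "'a::euclidean_space \<Rightarrow> real"
  assumes "orthonormal B" "v \<in> span B" and [measurable]: "g \<in> borel_measurable borel"
  shows "(LINT u|frame_measure B. g (u + v)) = (LINT u|frame_measure B. g u)"
proof -
  have "(LINT u|frame_measure B. 1 * g (u + v)) = (LINT u|frame_measure B. 1 * g u)"
    by (rule integral_transfer[where \<phi> = "\<lambda>u. u + v" and \<psi> = "\<lambda>u. u"])
       (use assms in \<open>auto simp: nn_integral_frame_measure_translate orthonormal_finite\<close>)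
  then show ?thesis by simp
qed

text \<open>
  Bounded measurable functions that vanish outside a set of finite measure: in this form the
  compact support of \<open>f\<close> enters all later applications of Fubini's theorem.
\<close>

lemma integrable_bounded_support:
  fixes g :: "'m \<Rightarrow> real"
  assumes [measurable]: "g \<in> borel_measurable M" "A \<in> sets M" and "emeasure M A < \<infinity>"
    and "\<And>x. x \<in> space M \<Longrightarrow> \<bar>g x\<bar> \<le> C" "\<And>x. x \<in> space M \<Longrightarrow> x \<notin> A \<Longrightarrow> g x = 0"
  shows "integrable M g"
proof -
  have "integrable M (\<lambda>x. C * indicator A x :: real)"
    using assms by (intro integrable_mult_right) (simp add: integrable_indicator_iff)
  then show ?thesis
  proof (rule Bochner_Integration.integrable_bound)
    show "AE x in M. norm (g x) \<le> norm (C * indicator A x :: real)"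
      using assms(4,5) by (intro AE_I2) (auto simp: indicator_def intro: order_trans[OF _ abs_ge_self])
  qed measurable
qed

lemma (in pair_sigma_finite) integrable_bounded_support_pair:
  fixes g :: "'a \<times> 'b \<Rightarrow> real"
  assumes "g \<in> borel_measurable (M1 \<Otimes>\<^sub>M M2)" "A \<in> sets M1" "B \<in> sets M2"
    and "emeasure M1 A < \<infinity>" "emeasure M2 B < \<infinity>"
    and "\<And>x y. \<bar>g (x, y)\<bar> \<le> C" "\<And>x y. g (x, y) \<noteq> 0 \<Longrightarrow> x \<in> A \<and> y \<in> B"
  shows "integrable (M1 \<Otimes>\<^sub>M M2) g"
proof (rule integrable_bounded_support[where A = "A \<times> B" and C = C])
  show "emeasure (M1 \<Otimes>\<^sub>M M2) (A \<times> B) < \<infinity>"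
    using assms by (simp add: M2.emeasure_pair_measure_Times ennreal_mult_less_top)
  show "\<bar>g x\<bar> \<le> C" for x using assms(6) by (cases x) auto
  show "g x = 0" if "x \<notin> A \<times> B" for x using assms(7) that by (cases x) auto
qed (use assms in auto)

lemma integral_frame_measure_insert:
  fixes g :: "'a::euclidean_space \<Rightarrow> real"
  assumes o: "orthonormal (insert \<omega> B)" "\<omega> \<notin> B" and g[measurable]: "g \<in> borel_measurable borel"
    and C: "\<And>x. \<bar>g x\<bar> \<le> C" and r: "\<And>x. g x \<noteq> 0 \<Longrightarrow> norm x \<le> r"
  shows "(LINT t|frame_measure (insert \<omega> B). g t) = (LINT v|frame_measure B. LINT a|lborel. g (a *\<^sub>R \<omega> + v))"
proof -
  have fB: "finite B" using o by (auto dest: orthonormal_finite)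
  have oB: "orthonormal B" using o(1) by (rule orthonormal_subset) auto
  interpret M: sigma_finite_measure "frame_measure B" by (rule sigma_finite_frame_measure[OF oB])
  interpret P: pair_sigma_finite "frame_measure B" "lborel :: real measure" ..
  let ?\<psi> = "\<lambda>(v, a). a *\<^sub>R \<omega> + v"
  have H: "(\<integral>\<^sup>+t. h t \<partial>frame_measure (insert \<omega> B)) = (\<integral>\<^sup>+x. h (?\<psi> x) \<partial>(frame_measure B \<Otimes>\<^sub>M lborel))"
    if [measurable]: "h \<in> borel_measurable borel" for h
    by (subst lborel.nn_integral_fst[symmetric]) (simp_all add: nn_integral_frame_measure_insert[OF fB o(2)])
  have "integrable (frame_measure (insert \<omega> B)) (\<lambda>t. 1 * g t)"
    using r emeasure_frame_measure_cball_finite[OF o(1)]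
    by (intro integrable_bounded_support[where A = "cball 0 r" and C = C]) (auto simp: C)
  then have "integrable (frame_measure B \<Otimes>\<^sub>M lborel) (\<lambda>x. 1 * g (?\<psi> x))"
    by (subst (asm) integrable_transfer[where N = "frame_measure B \<Otimes>\<^sub>M lborel" and \<psi> = ?\<psi> and v = "\<lambda>_. 1"]) (auto simp: H)
  then have "(LINT v|frame_measure B. LINT a|lborel. 1 * g (?\<psi> (v, a))) = (LINT x|(frame_measure B \<Otimes>\<^sub>M lborel). 1 * g (?\<psi> x))"
    by (rule P.integral_fst')
  also have "\<dots> = (LINT t|frame_measure (insert \<omega> B). 1 * g t)"
    by (rule integral_transfer[symmetric]) (auto simp: H)
  finally show ?thesis by simp
qed

section \<open>Averages over subspaces and horizontal planes\<close>

text \<open>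
  A continuous function with compact support in the open half-space: \<open>M\<close> is a bound, \<open>R\<close> the radius
  of a ball that contains the support, and \<open>\<delta>\<close> a lower bound for the height of its points.
\<close>

locale half_space_function =
  fixes e :: "'a::euclidean_space" and f :: "'a \<Rightarrow> real" and M R \<delta> :: real
  assumes e: "e \<in> Basis" and cont: "continuous_on UNIV f"
    and bound: "\<And>z. \<bar>f z\<bar> \<le> M" and supp_norm: "\<And>z. f z \<noteq> 0 \<Longrightarrow> norm z \<le> R"
    and supp_height: "\<And>z. f z \<noteq> 0 \<Longrightarrow> \<delta> \<le> z \<bullet> e" and \<delta>: "0 < \<delta>" and R: "0 < R"
begin

lemma f_measurable[measurable]: "f \<in> borel_measurable borel"
  using cont by (rule borel_measurable_continuous_onI)

lemma norm_e: "norm e = 1" "e \<bullet> e = 1" using e by simp_all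

lemma supp_height_le: "z \<bullet> e < \<delta> \<Longrightarrow> f z = 0"
  using supp_height[of z] by linarith

lemma M_nonneg: "0 \<le> M" using bound[of 0] by linarith

definition subspace_average :: "'a set \<Rightarrow> 'a \<Rightarrow> real" where
  "subspace_average B z = (LINT u|frame_measure B. f (z + u))"

lemma continuous_subspace_average:
  assumes o: "orthonormal B"
  shows "continuous_on UNIV (subspace_average B)"
proof (rule continuous_at_imp_continuous_on, rule ballI, rule continuous_at_sequentiallyI)
  fix z and w :: "nat \<Rightarrow> 'a" assume w: "w \<longlonglongrightarrow> z"
  then have "bounded (range w)" by (simp add: convergent_imp_bounded)
  then obtain b where b: "\<And>n. norm (w n) \<le> b" by (auto simp: bounded_iff)
  show "(\<lambda>n. subspace_average B (w n)) \<longlonglongrightarrow> subspace_average B z" unfolding subspace_average_def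
  proof (rule integral_dominated_convergence[where w = "\<lambda>u. M * indicator (cball 0 (R + b)) u"])
    show "integrable (frame_measure B) (\<lambda>u. M * indicator (cball 0 (R + b)) u)"
      using emeasure_frame_measure_cball_finite[OF o, of "R + b"]
      by (intro integrable_mult_right) (simp add: integrable_indicator_iff)
    show "AE u in frame_measure B. (\<lambda>n. f (w n + u)) \<longlonglongrightarrow> f (z + u)"
    proof (rule AE_I2)
      fix u
      have "isCont f (z + u)" using cont by (simp add: continuous_on_eq_continuous_at)
      then show "(\<lambda>n. f (w n + u)) \<longlonglongrightarrow> f (z + u)"
        by (rule isCont_tendsto_compose) (intro tendsto_intros w)
    qed
    show "AE u in frame_measure B. norm (f (w n + u)) \<le> M * indicator (cball 0 (R + b)) u" for n
    proof (rule AE_I2)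
      fix u
      show "norm (f (w n + u)) \<le> M * indicator (cball 0 (R + b)) u"
      proof (cases "f (w n + u) = 0")
        case False
        then have "norm (w n + u) \<le> R" by (rule supp_norm)
        then have "norm u \<le> R + b" using b[of n] norm_triangle_ineq4[of "w n + u" "w n"] by simp
        then show ?thesis using bound by simp
      qed (use M_nonneg in \<open>simp add: indicator_def\<close>)
    qed
  qed (simp_all)
qed

lemma subspace_average_measurable[measurable]:
  "orthonormal B \<Longrightarrow> subspace_average B \<in> borel_measurable borel"
  by (intro borel_measurable_continuous_onI continuous_subspace_average)

lemma subspace_average_translate:
  assumes "orthonormal B" "v \<in> span B"
  shows "subspace_average B (z + v) = subspace_average B z"
  using integral_frame_measure_translate[OF assms, of "\<lambda>u. f (z + u)"]
  by (simp add: subspace_average_def add_ac)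

lemma subspace_average_eq_0:
  assumes B: "span B \<subseteq> centerset e" and z: "z \<bullet> e < \<delta>"
  shows "subspace_average B z = 0"
proof -
  have "AE u in frame_measure B. f (z + u) = 0"
    using AE_frame_measure_span[of B]
  proof (rule eventually_mono)
    fix u assume "u \<in> span B"
    then have "u \<bullet> e = 0" using B by (auto simp: centerset_def)
    then show "f (z + u) = 0" using z by (intro supp_height_le) (simp add: inner_add_left)
  qed
  then show ?thesis unfolding subspace_average_def by (intro integral_eq_zero_AE)
qed

lemma sonar_eq:
  assumes C: "orthonormal C" "span C = centerset e" and y: "z \<bullet> e = y"
  shows "sonar e f z = (LINT t|frame_measure C.
    sphere_density y (norm t) * f (z - y *\<^sub>R e + t + sqrt (y\<^sup>2 - (norm t)\<^sup>2) *\<^sub>R e))"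
  unfolding sonar_def Let_def y set_lebesgue_integral_def subspace_measure_eq[OF C]
  by (intro Bochner_Integration.integral_cong) (auto simp: sphere_density_def indicator_def)

text \<open>
  The area element is unbounded at the equator.  On points of height less than \<open>\<delta>\<close>, where the
  integrands vanish, it may be replaced by \<open>0\<close>; the result is bounded by \<open>y / \<delta>\<close> and makes Fubini's
  theorem applicable.
\<close>

definition clipped_density :: "real \<Rightarrow> real \<Rightarrow> real" where
  "clipped_density y r = (if \<delta> \<le> sqrt (y\<^sup>2 - r\<^sup>2) then sphere_density y r else 0)"

lemma clipped_density_measurable[measurable]:
  assumes [measurable]: "b \<in> borel_measurable M'"
  shows "(\<lambda>x. clipped_density y (b x)) \<in> borel_measurable M'"
  unfolding clipped_density_def by measurable

lemma clipped_density_bound: "0 < y \<Longrightarrow> \<bar>clipped_density y r\<bar> \<le> y / \<delta>"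
proof (cases "r < y \<and> \<delta> \<le> sqrt (y\<^sup>2 - r\<^sup>2)")
  case True
  moreover assume "0 < y"
  ultimately show ?thesis
    using \<delta> by (auto simp: clipped_density_def sphere_density_def intro!: divide_left_mono mult_pos_pos)
qed (use \<delta> in \<open>auto simp: clipped_density_def sphere_density_def\<close>)

lemma clipped_density_support: "clipped_density y r \<noteq> 0 \<Longrightarrow> r < y"
  by (auto simp: clipped_density_def sphere_density_def split: if_splits)

lemma clipped_density_eq:
  assumes g: "\<And>z. z \<bullet> e < \<delta> \<Longrightarrow> g z = 0" and w: "w \<bullet> e = 0" and t: "t \<bullet> e = 0"
  shows "sphere_density y (norm t) * g (w + t + sqrt (y\<^sup>2 - (norm t)\<^sup>2) *\<^sub>R e)
      = clipped_density y (norm t) * g (w + t + sqrt (y\<^sup>2 - (norm t)\<^sup>2) *\<^sub>R e)"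
proof -
  have "(w + t + sqrt (y\<^sup>2 - (norm t)\<^sup>2) *\<^sub>R e) \<bullet> e = sqrt (y\<^sup>2 - (norm t)\<^sup>2)"
    using w t norm_e by (simp add: inner_add_left)
  then show ?thesis
    using g[of "w + t + sqrt (y\<^sup>2 - (norm t)\<^sup>2) *\<^sub>R e"] by (auto simp: clipped_density_def)
qed

lemma AE_clipped_density:
  assumes C: "span C = centerset e" and g: "\<And>z. z \<bullet> e < \<delta> \<Longrightarrow> g z = 0" and w: "w \<bullet> e = 0"
  shows "AE t in frame_measure C. sphere_density y (norm t) * g (w + t + sqrt (y\<^sup>2 - (norm t)\<^sup>2) *\<^sub>R e)
      = clipped_density y (norm t) * g (w + t + sqrt (y\<^sup>2 - (norm t)\<^sup>2) *\<^sub>R e)"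
  using AE_frame_measure_span[of C]
proof (rule eventually_mono)
  fix t assume "t \<in> span C"
  then have "t \<bullet> e = 0" using C by (auto simp: centerset_def)
  with g w show "sphere_density y (norm t) * g (w + t + sqrt (y\<^sup>2 - (norm t)\<^sup>2) *\<^sub>R e)
      = clipped_density y (norm t) * g (w + t + sqrt (y\<^sup>2 - (norm t)\<^sup>2) *\<^sub>R e)"
    by (rule clipped_density_eq)
qed

text \<open>
  Averaging over centres commutes with integration over the sphere.  The left-hand side is
  \<open>R_h S f\<close> if \<open>B\<close> spans the centerset, and the centerset Radon transform of \<open>S f\<close> if \<open>B\<close> spans the
  vectors of the centerset orthogonal to \<open>\<omega>\<close>.
\<close>

lemma integral_sonar_subspace:
  assumes B: "orthonormal B" "span B \<subseteq> centerset e" and C: "orthonormal C" "span C = centerset e"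
    and z: "z \<bullet> e = y" and y: "0 < y"
  shows "(LINT u|frame_measure B. sonar e f (z + u)) = (LINT t|frame_measure C.
     sphere_density y (norm t) * subspace_average B (z - y *\<^sub>R e + t + sqrt (y\<^sup>2 - (norm t)\<^sup>2) *\<^sub>R e))"
proof -
  interpret MB: sigma_finite_measure "frame_measure B" by (rule sigma_finite_frame_measure[OF B(1)])
  interpret MC: sigma_finite_measure "frame_measure C" by (rule sigma_finite_frame_measure[OF C(1)])
  interpret P: pair_sigma_finite "frame_measure B" "frame_measure C" ..
  let ?h = "\<lambda>t. sqrt (y\<^sup>2 - (norm t)\<^sup>2) *\<^sub>R e"
  let ?x = "z - y *\<^sub>R e"
  have x: "?x \<bullet> e = 0" using z norm_e by (simp add: inner_diff_left)
  let ?g = "\<lambda>(u, t). clipped_density y (norm t) * f (?x + u + t + ?h t)"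
  have sets_prod: "sets (frame_measure B \<Otimes>\<^sub>M frame_measure C) = sets (borel \<Otimes>\<^sub>M borel)"
    by (intro sets_pair_measure_cong) simp_all
  have I: "integrable (frame_measure B \<Otimes>\<^sub>M frame_measure C) ?g"
  proof (rule P.integrable_bounded_support_pair)
    show "?g \<in> borel_measurable (frame_measure B \<Otimes>\<^sub>M frame_measure C)"
      unfolding measurable_cong_sets[OF sets_prod refl] by measurable
    show "emeasure (frame_measure B) (cball 0 (R + norm ?x + 2 * y)) < \<infinity>" "emeasure (frame_measure C) (cball 0 y) < \<infinity>"
      using B C by (simp_all add: emeasure_frame_measure_cball_finite[unfolded infinity_ennreal_def])
    show "\<bar>?g (u, t)\<bar> \<le> y / \<delta> * M" for u t
      unfolding split_conv abs_mult using clipped_density_bound[OF y] bound y \<delta>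
      by (intro mult_mono) auto
    show "u \<in> cball 0 (R + norm ?x + 2 * y) \<and> t \<in> cball 0 y" if "?g (u, t) \<noteq> 0" for u t
    proof -
      have t: "norm t < y" using that clipped_density_support[of y "norm t"] by auto
      have "sqrt (y\<^sup>2 - (norm t)\<^sup>2) \<le> y" using y by (intro real_le_lsqrt) auto
      then have "norm (?h t) \<le> y" using norm_e t y by (simp add: power_mono)
      moreover have "norm (?x + u + t + ?h t) \<le> R" using that by (intro supp_norm) auto
      moreover have "u = (?x + u + t + ?h t) - ?x - t - ?h t" by simp
      then have "norm u \<le> norm (?x + u + t + ?h t) + norm ?x + norm t + norm (?h t)"
        by (metis (no_types, lifting) add_mono norm_triangle_ineq4 norm_triangle_le_diff order_refl)
      ultimately show ?thesis using t by simp
    qed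
  qed simp_all
  have "(LINT u|frame_measure B. sonar e f (z + u)) = (LINT u|frame_measure B. LINT t|frame_measure C. ?g (u, t))"
  proof (rule integral_cong_AE)
    have S: "AE u in frame_measure B. sonar e f (z + u) = (LINT t|frame_measure C. ?g (u, t))"
      using AE_frame_measure_span[of B]
    proof (rule eventually_mono)
      fix u assume "u \<in> span B"
      then have u: "u \<bullet> e = 0" using B by (auto simp: centerset_def)
      then have "sonar e f (z + u) = (LINT t|frame_measure C.
          sphere_density y (norm t) * f ((?x + u) + t + ?h t))"
        using z by (subst sonar_eq[OF C, of _ y]) (simp_all add: inner_add_left algebra_simps)
      also have "\<dots> = (LINT t|frame_measure C. clipped_density y (norm t) * f ((?x + u) + t + ?h t))"
        using u x supp_height_le
        by (intro integral_cong_AE AE_clipped_density[OF C(2)]) (simp_all add: inner_add_left)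
      finally show "sonar e f (z + u) = (LINT t|frame_measure C. ?g (u, t))" by simp
    qed
    then show "AE u in frame_measure B. sonar e f (z + u) = (LINT t|frame_measure C. ?g (u, t))" .
    show "(\<lambda>u. LINT t|frame_measure C. ?g (u, t)) \<in> borel_measurable (frame_measure B)"
      using I by (intro MC.borel_measurable_lebesgue_integral) auto
    have "(\<lambda>u. sonar e f (z + u)) \<in> borel_measurable borel"
    proof -
      define s where "s u = (LINT t|frame_measure C. sphere_density ((z + u) \<bullet> e) (norm t) *
         f ((z + u) - ((z + u) \<bullet> e) *\<^sub>R e + t + sqrt (((z + u) \<bullet> e)\<^sup>2 - (norm t)\<^sup>2) *\<^sub>R e))" for u
      have "s \<in> borel_measurable borel" unfolding s_def by measurable
      moreover have "s = (\<lambda>u. sonar e f (z + u))" unfolding s_def using sonar_eq[OF C refl] by simp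
      ultimately show ?thesis by simp
    qed
    then show "(\<lambda>u. sonar e f (z + u)) \<in> borel_measurable (frame_measure B)" by simp
  qed
  also have "\<dots> = (LINT t|frame_measure C. LINT u|frame_measure B. ?g (u, t))"
    using P.Fubini_integral[of "\<lambda>u t. ?g (u, t)"] I by simp
  also have "\<dots> = (LINT t|frame_measure C. clipped_density y (norm t) * subspace_average B (?x + t + ?h t))"
    by (simp add: subspace_average_def add_ac)
  also have "\<dots> = (LINT t|frame_measure C. sphere_density y (norm t) * subspace_average B (?x + t + ?h t))"
  proof (rule integral_cong_AE)
    note [measurable] = subspace_average_measurable[OF B(1)]
    show "AE t in frame_measure C. clipped_density y (norm t) * subspace_average B (?x + t + ?h t)
       = sphere_density y (norm t) * subspace_average B (?x + t + ?h t)"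
    proof (rule eventually_mono)
      show "AE t in frame_measure C. sphere_density y (norm t) * subspace_average B (?x + t + ?h t)
         = clipped_density y (norm t) * subspace_average B (?x + t + ?h t)"
        by (intro AE_clipped_density C(2) subspace_average_eq_0[OF B(2)] x)
    qed (rule sym)
  qed (use B in measurable)
  finally show ?thesis .
qed

lemma horizontal_frame:
  "orthonormal (Basis - {e})" "span (Basis - {e}) = centerset e" "card (Basis - {e}) = DIM('a) - 1"
proof -
  show "orthonormal (Basis - {e})"
    by (auto simp: orthonormal_def pairwise_def orthogonal_def inner_Basis)
  show "card (Basis - {e}) = DIM('a) - 1" using e by (simp add: card_Diff_singleton)
  show "span (Basis - {e}) = centerset e"
  proof (intro equalityI subsetI)
    fix x assume x: "x \<in> span (Basis - {e})"
    have "orthogonal e x"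
      by (rule orthogonal_to_span[OF x]) (use e in \<open>auto simp: orthogonal_def inner_Basis\<close>)
    then show "x \<in> centerset e" by (simp add: centerset_def orthogonal_def inner_commute)
  next
    fix x assume x: "x \<in> centerset e"
    have "x = (\<Sum>b\<in>Basis. (x \<bullet> b) *\<^sub>R b)" by (simp add: euclidean_representation)
    also have "\<dots> = (\<Sum>b\<in>Basis - {e}. (x \<bullet> b) *\<^sub>R b)"
      using x e by (subst sum.remove[OF _ e]) (auto simp: centerset_def)
    also have "\<dots> \<in> span (Basis - {e})" by (intro span_sum span_scale span_base)
    finally show "x \<in> span (Basis - {e})" .
  qed
qed

text \<open>
  The average \<open>F\<close> over horizontal planes depends on the height only, so the integral of \<open>F\<close> over
  the sphere is \<open>I_((n-1)/2) F\<close>.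
\<close>

theorem radon_h_eq:
  assumes y: "0 < y"
  shows "radon_h e f y = frac_deriv ((real DIM('a) - 1) / 2) (radon_h e (sonar e f)) y"
proof -
  let ?B = "Basis - {e}"
  note o = horizontal_frame(1,2)
  define F where "F h = subspace_average ?B (h *\<^sub>R e)" for h
  have F: "continuous_on UNIV F" unfolding F_def
    using continuous_subspace_average[OF o(1)] by (rule continuous_on_compose2) (auto intro!: continuous_intros)
  then have [measurable]: "F \<in> borel_measurable borel" by (rule borel_measurable_continuous_onI)
  have F0: "F h = 0" if "h \<le> \<delta> / 2" for h
    unfolding F_def using that norm_e \<delta> by (intro subspace_average_eq_0) (auto simp: o)
  have rad: "radon_h e g y = (LINT u|frame_measure ?B. g (y *\<^sub>R e + u))" for g y
    by (simp add: radon_h_def subspace_measure_eq[OF o] add.commute)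
  have "radon_h e f y = F y" by (simp add: rad F_def subspace_average_def)
  also have "\<dots> = frac_deriv ((real DIM('a) - 1) / 2) (radon_h e (sonar e f)) y"
  proof (rule frac_deriv_frac_int[OF _ F _ F0 _ y, symmetric])
    show "0 \<le> (real DIM('a) - 1) / 2" using DIM_positive[where 'a='a] by simp
    \<comment> \<open>\<open>F\<close> vanishes for heights strictly below \<open>\<delta>\<close>; halving makes the bound weak.\<close>
    show "0 < \<delta> / 2" using \<delta> by simp
    fix y :: real assume y: "0 < y"
    have "radon_h e (sonar e f) y = (LINT t|frame_measure ?B.
        sphere_density y (norm t) * subspace_average ?B (t + sqrt (y\<^sup>2 - (norm t)\<^sup>2) *\<^sub>R e))"
      unfolding rad using norm_e o by (subst integral_sonar_subspace[OF o(1) _ o _ y]) auto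
    also have "\<dots> = (LINT t|frame_measure ?B. sphere_density y (norm t) * F (sqrt (y\<^sup>2 - (norm t)\<^sup>2)))"
    proof (rule integral_cong_AE)
      note [measurable] = subspace_average_measurable[OF o(1)]
      show "(\<lambda>t. sphere_density y (norm t) * subspace_average ?B (t + sqrt (y\<^sup>2 - (norm t)\<^sup>2) *\<^sub>R e)) \<in> borel_measurable (frame_measure ?B)"
        by measurable
      show "(\<lambda>t. sphere_density y (norm t) * F (sqrt (y\<^sup>2 - (norm t)\<^sup>2))) \<in> borel_measurable (frame_measure ?B)"
        by measurable
      show "AE t in frame_measure ?B. sphere_density y (norm t) * subspace_average ?B (t + sqrt (y\<^sup>2 - (norm t)\<^sup>2) *\<^sub>R e)
          = sphere_density y (norm t) * F (sqrt (y\<^sup>2 - (norm t)\<^sup>2))" (is "AE t in _. ?AE' t")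
        using AE_frame_measure_span[of ?B]
      proof (rule eventually_mono)
        fix t assume "t \<in> span ?B"
        from subspace_average_translate[OF o(1) this]
        show "?AE' t"
          by (simp add: F_def add.commute[of t])
      qed
    qed
    also have "\<dots> = frac_int (real (card ?B) / 2) F y"
      by (rule integral_sphere_density[OF o(1) y]) measurable
    also have "real (card ?B) = real DIM('a) - 1"
      using horizontal_frame(3) DIM_positive[where 'a='a] by simp
    finally show "radon_h e (sonar e f) y = frac_int ((real DIM('a) - 1) / 2) F y" .
  qed
  finally show ?thesis .
qed

end

section \<open>Circles touching a ray\<close>

lemma ennreal_mult_swap: "a * b = c \<Longrightarrow> a * x * b = c * (x :: ennreal)"
  by (metis mult.assoc mult.commute)

text \<open>
  The parametrisation of the half-circle of radius \<open>q\<close> by the angle from the vertical, compared with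
  the one by the abscissa.
\<close>

lemma nn_integral_arc:
  fixes \<Phi> :: "real \<times> real \<Rightarrow> ennreal"
  assumes [measurable]: "\<Phi> \<in> borel_measurable (borel \<Otimes>\<^sub>M borel)" and q: "0 < q"
  shows "(\<integral>\<^sup>+\<phi>. \<Phi> (q * sin \<phi>, q * cos \<phi>) * indicator {-pi/2<..<pi/2} \<phi> \<partial>lborel)
       = (\<integral>\<^sup>+a. (if \<bar>a\<bar> < q then ennreal (1 / sqrt (q\<^sup>2 - a\<^sup>2)) * \<Phi> (a, sqrt (q\<^sup>2 - a\<^sup>2)) else 0) \<partial>lborel)"
proof -
  let ?S = "{-pi/2<..<pi/2}" and ?g = "\<lambda>\<phi>. q * sin \<phi>"
  let ?f = "\<lambda>a. ennreal (1 / sqrt (q\<^sup>2 - a\<^sup>2)) * \<Phi> (a, sqrt (q\<^sup>2 - a\<^sup>2))"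
  have img: "?g ` ?S = {-q<..<q}"
  proof (intro equalityI subsetI)
    fix a assume "a \<in> ?g ` ?S"
    then obtain \<phi> where \<phi>: "\<phi> \<in> ?S" "a = q * sin \<phi>" by auto
    have "-1 < sin \<phi>" "sin \<phi> < 1"
      using \<phi>(1) sin_monotone_2pi[of "-pi/2" \<phi>] sin_monotone_2pi[of \<phi> "pi/2"] by auto
    then have "q * -1 < q * sin \<phi>" "q * sin \<phi> < q * 1" using q by (intro mult_strict_left_mono; simp)+
    then show "a \<in> {-q<..<q}" using \<phi> by simp
  next
    fix a assume "a \<in> {-q<..<q}"
    then have "-1 < a / q" "a / q < 1" using q by (auto simp: field_simps)
    then have "arcsin (a / q) \<in> ?S" "sin (arcsin (a / q)) = a / q"
      using arcsin_lt_bounded[of "a / q"] by auto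
    then show "a \<in> ?g ` ?S" using q by (intro image_eqI[of _ _ "arcsin (a / q)"]) auto
  qed
  have "(\<integral>\<^sup>+a. ?f a * indicator (?g ` ?S) a \<partial>lborel) = (\<integral>\<^sup>+\<phi>. ?f (?g \<phi>) * ennreal \<bar>q * cos \<phi>\<bar> * indicator ?S \<phi> \<partial>lborel)"
  proof (rule nn_integral_inj_substitution)
    show "(?g has_real_derivative q * cos x) (at x within ?S)" for x
      by (auto intro!: derivative_eq_intros)
    show "inj_on ?g ?S"
      using q sin_inj_pi by (intro inj_onI) auto
    show "?g ` ?S \<in> sets borel" unfolding img by simp
  qed measurable
  also have "\<dots> = (\<integral>\<^sup>+\<phi>. \<Phi> (q * sin \<phi>, q * cos \<phi>) * indicator ?S \<phi> \<partial>lborel)"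
    (is "integral\<^sup>N _ ?before = integral\<^sup>N _ ?after")
  proof (intro nn_integral_cong)
    fix \<phi>
    show "?before \<phi> = ?after \<phi>"
    proof (cases "\<phi> \<in> ?S")
      case True
      then have c: "0 < q * cos \<phi>" using q by (intro mult_pos_pos cos_gt_zero_pi) auto
      have "q\<^sup>2 - (q * sin \<phi>)\<^sup>2 = (q * cos \<phi>)\<^sup>2" by (simp add: power_mult_distrib cos_squared_eq algebra_simps)
      then have s: "sqrt (q\<^sup>2 - (q * sin \<phi>)\<^sup>2) = q * cos \<phi>" using c by (simp only: real_sqrt_abs)
      have "ennreal (1 / (q * cos \<phi>)) * ennreal (q * cos \<phi>) = 1"
        using c by (subst ennreal_mult[symmetric]) auto
      then have "ennreal (1 / (q * cos \<phi>)) * \<Phi> (q * sin \<phi>, q * cos \<phi>) * ennreal (q * cos \<phi>) = 1 * \<Phi> (q * sin \<phi>, q * cos \<phi>)"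
        by (rule ennreal_mult_swap)
      then show ?thesis using True c unfolding s by simp
    qed simp
  qed
  finally have "(\<integral>\<^sup>+\<phi>. \<Phi> (q * sin \<phi>, q * cos \<phi>) * indicator ?S \<phi> \<partial>lborel) = (\<integral>\<^sup>+a. ?f a * indicator {-q<..<q} a \<partial>lborel)"
    unfolding img by (rule sym)
  also have "\<dots> = (\<integral>\<^sup>+a. (if \<bar>a\<bar> < q then ?f a else 0) \<partial>lborel)"
    by (intro nn_integral_cong) (auto simp: indicator_def)
  finally show ?thesis .
qed

text \<open>
  For a circle with centre \<open>(s, 0)\<close> and radius \<open>s * sin \<theta>\<close>, and a point at horizontal distance \<open>a\<close> from
  the centre, the height \<open>y\<close> of the circle satisfies \<open>y * dy = s\<^sup>2 * sin \<theta> * cos \<theta> * d\<theta>\<close>.  Moreover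
  \<open>(s * sin \<beta>)\<^sup>2 - y\<^sup>2 - a\<^sup>2 = s\<^sup>2 * ((sin \<beta>)\<^sup>2 - (sin \<theta>)\<^sup>2)\<close>.
\<close>

lemma nn_integral_angle_to_height:
  fixes \<Phi> :: "real \<Rightarrow> ennreal"
  assumes [measurable]: "\<Phi> \<in> borel_measurable borel" and s: "0 < s" and \<beta>: "0 < \<beta>" "\<beta> < pi/2"
  shows "(\<integral>\<^sup>+\<theta>. (if 0 < \<theta> \<and> \<theta> < \<beta> \<and> \<bar>a\<bar> < s * sin \<theta> then
          ennreal (cos \<theta> * sin \<theta> / sqrt ((sin \<beta>)\<^sup>2 - (sin \<theta>)\<^sup>2) / sqrt ((s * sin \<theta>)\<^sup>2 - a\<^sup>2)) * \<Phi> (sqrt ((s * sin \<theta>)\<^sup>2 - a\<^sup>2)) else 0) \<partial>lborel)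
       = (\<integral>\<^sup>+y. (if 0 < y \<and> y\<^sup>2 + a\<^sup>2 < (s * sin \<beta>)\<^sup>2 then
          ennreal (1 / (s * sqrt ((s * sin \<beta>)\<^sup>2 - y\<^sup>2 - a\<^sup>2))) * \<Phi> y else 0) \<partial>lborel)"
proof -
  let ?S = "{\<theta>. 0 < \<theta> \<and> \<theta> < \<beta> \<and> \<bar>a\<bar> < s * sin \<theta>}"
  let ?T = "{y. 0 < y \<and> y\<^sup>2 + a\<^sup>2 < (s * sin \<beta>)\<^sup>2}"
  let ?g = "\<lambda>\<theta>. sqrt ((s * sin \<theta>)\<^sup>2 - a\<^sup>2)"
  let ?g' = "\<lambda>\<theta>. s\<^sup>2 * sin \<theta> * cos \<theta> / ?g \<theta>"
  let ?f = "\<lambda>y. ennreal (1 / (s * sqrt ((s * sin \<beta>)\<^sup>2 - y\<^sup>2 - a\<^sup>2))) * \<Phi> y"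
  have sb: "0 < sin \<beta>" using \<beta> by (intro sin_gt_zero) auto
  have S: "0 < sin \<theta>" "0 < cos \<theta>" "sin \<theta> < sin \<beta>" "0 < (s * sin \<theta>)\<^sup>2 - a\<^sup>2" "(sin \<theta>)\<^sup>2 < (sin \<beta>)\<^sup>2" if "\<theta> \<in> ?S" for \<theta>
  proof -
    show 1: "0 < sin \<theta>" "0 < cos \<theta>" using that \<beta> by (auto intro!: sin_gt_zero cos_gt_zero)
    show 2: "sin \<theta> < sin \<beta>" using that \<beta> by (intro sin_monotone_2pi) auto
    show "(sin \<theta>)\<^sup>2 < (sin \<beta>)\<^sup>2" using 1 2 by (intro power_strict_mono) auto
    have "\<bar>a\<bar>\<^sup>2 < (s * sin \<theta>)\<^sup>2" using that by (intro power_strict_mono) auto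
    then show "0 < (s * sin \<theta>)\<^sup>2 - a\<^sup>2" by simp
  qed
  have img: "?g ` ?S = ?T"
  proof (intro equalityI subsetI)
    fix y assume "y \<in> ?g ` ?S"
    then obtain \<theta> where \<theta>: "\<theta> \<in> ?S" "y = ?g \<theta>" by auto
    have "(s * sin \<theta>)\<^sup>2 < (s * sin \<beta>)\<^sup>2" using S(5)[OF \<theta>(1)] s by (simp add: power_mult_distrib)
    then show "y \<in> ?T" using S(4)[OF \<theta>(1)] \<theta>(2) by simp
  next
    fix y assume y: "y \<in> ?T"
    define r where "r = sqrt (y\<^sup>2 + a\<^sup>2)"
    have r2: "r\<^sup>2 = y\<^sup>2 + a\<^sup>2" by (simp add: r_def)
    have r: "0 < r" "\<bar>a\<bar> < r" "r < s * sin \<beta>" "r / s < sin \<beta>"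
    proof -
      show "0 < r" using y by (auto simp: r_def intro!: add_pos_nonneg)
      show "\<bar>a\<bar> < r" unfolding r_def using y by (intro real_less_rsqrt) auto
      show 3: "r < s * sin \<beta>" unfolding r_def using y s sb by (intro real_less_lsqrt) auto
      then show "r / s < sin \<beta>" using s by (simp add: pos_divide_less_eq mult.commute)
    qed
    have r1: "r / s < 1" using r(4) sin_le_one[of \<beta>] by linarith
    let ?\<theta> = "arcsin (r / s)"
    have "0 \<le> r / s" using r s by simp
    then have b: "- 1 \<le> r / s" "r / s \<le> 1" using r1 by linarith+
    have sn: "sin ?\<theta> = r / s" using b by simp
    have "arcsin 0 < ?\<theta>" using r s b by (subst arcsin_less_mono) auto
    moreover have "?\<theta> < arcsin (sin \<beta>)" using r b s by (subst arcsin_less_mono) auto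
    moreover have "arcsin (sin \<beta>) = \<beta>" using \<beta> by (intro arcsin_sin) auto
    ultimately have "?\<theta> \<in> ?S" using sn r s by auto
    moreover have "?g ?\<theta> = y" using sn s r2 y by simp
    ultimately show "y \<in> ?g ` ?S" by (metis (no_types, lifting) image_eqI)
  qed
  have "(\<integral>\<^sup>+y. ?f y * indicator (?g ` ?S) y \<partial>lborel) = (\<integral>\<^sup>+\<theta>. ?f (?g \<theta>) * ennreal \<bar>?g' \<theta>\<bar> * indicator ?S \<theta> \<partial>lborel)"
  proof (rule nn_integral_inj_substitution)
    show "(?g has_real_derivative ?g' \<theta>) (at \<theta> within ?S)" if "\<theta> \<in> ?S" for \<theta>
    proof -
      have "((\<lambda>\<theta>. (s * sin \<theta>)\<^sup>2 - a\<^sup>2) has_real_derivative 2 * (s\<^sup>2 * sin \<theta> * cos \<theta>)) (at \<theta>)"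
        by (auto intro!: derivative_eq_intros simp: power2_eq_square)
      then have "((\<lambda>\<theta>. (s * sin \<theta>)\<^sup>2 - a\<^sup>2) has_real_derivative 2 * (s\<^sup>2 * sin \<theta> * cos \<theta>)) (at \<theta> within ?S)"
        by (rule has_field_derivative_at_within)
      from DERIV_chain2[OF DERIV_real_sqrt[OF S(4)[OF that]] this]
      have "(?g has_real_derivative inverse (?g \<theta>) / 2 * (2 * (s\<^sup>2 * sin \<theta> * cos \<theta>))) (at \<theta> within ?S)" .
      moreover have "inverse G / 2 * (2 * K) = K / G" for G K :: real by (cases "G = 0") (auto simp: field_simps)
      ultimately show ?thesis by (simp only:)
    qed
    show "inj_on ?g ?S"
    proof (rule inj_onI)
      fix \<theta> \<theta>' assume t: "\<theta> \<in> ?S" "\<theta>' \<in> ?S" "?g \<theta> = ?g \<theta>'"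
      then have "(s * sin \<theta>)\<^sup>2 = (s * sin \<theta>')\<^sup>2" by simp
      then have "sin \<theta> = sin \<theta>'" using s S(1)[OF t(1)] S(1)[OF t(2)] by (simp add: power2_eq_iff_nonneg)
      then show "\<theta> = \<theta>'" using t \<beta> by (auto intro: sin_inj_pi)
    qed
    show "?S \<in> sets borel" by measurable
    show "?g ` ?S \<in> sets borel" unfolding img by measurable
  qed measurable
  also have "\<dots> = (\<integral>\<^sup>+\<theta>. (if 0 < \<theta> \<and> \<theta> < \<beta> \<and> \<bar>a\<bar> < s * sin \<theta> then
          ennreal (cos \<theta> * sin \<theta> / sqrt ((sin \<beta>)\<^sup>2 - (sin \<theta>)\<^sup>2) / ?g \<theta>) * \<Phi> (?g \<theta>) else 0) \<partial>lborel)"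
            (is "integral\<^sup>N _ ?before = integral\<^sup>N _ ?after")
  proof (intro nn_integral_cong)
    fix \<theta>
    show "?before \<theta> = ?after \<theta>"
    proof (cases "\<theta> \<in> ?S")
      case True
      note T = S[OF True]
      have "(s * sin \<beta>)\<^sup>2 - (?g \<theta>)\<^sup>2 - a\<^sup>2 = s\<^sup>2 * ((sin \<beta>)\<^sup>2 - (sin \<theta>)\<^sup>2)"
        using T(4) by (simp add: power_mult_distrib algebra_simps)
      then have q: "sqrt ((s * sin \<beta>)\<^sup>2 - (?g \<theta>)\<^sup>2 - a\<^sup>2) = s * sqrt ((sin \<beta>)\<^sup>2 - (sin \<theta>)\<^sup>2)"
        using s by (simp add: real_sqrt_mult)
      have g: "0 < ?g \<theta>" "0 < sqrt ((sin \<beta>)\<^sup>2 - (sin \<theta>)\<^sup>2)" using T by simp_all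
      have "ennreal (1 / (s * (s * sqrt ((sin \<beta>)\<^sup>2 - (sin \<theta>)\<^sup>2)))) * ennreal \<bar>?g' \<theta>\<bar>
          = ennreal (1 / (s * (s * sqrt ((sin \<beta>)\<^sup>2 - (sin \<theta>)\<^sup>2))) * ?g' \<theta>)"
        using T g s by (subst ennreal_mult) auto
      also have "1 / (s * (s * sqrt ((sin \<beta>)\<^sup>2 - (sin \<theta>)\<^sup>2))) * ?g' \<theta> = cos \<theta> * sin \<theta> / sqrt ((sin \<beta>)\<^sup>2 - (sin \<theta>)\<^sup>2) / ?g \<theta>"
        using g s by (simp add: power2_eq_square)
      finally have "?f (?g \<theta>) * ennreal \<bar>?g' \<theta>\<bar>
          = ennreal (cos \<theta> * sin \<theta> / sqrt ((sin \<beta>)\<^sup>2 - (sin \<theta>)\<^sup>2) / ?g \<theta>) * \<Phi> (?g \<theta>)"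
        unfolding q by (rule ennreal_mult_swap)
      then show ?thesis using True by (simp only: indicator_simps) simp
    qed auto
  qed
  finally have "(\<integral>\<^sup>+y. ?f y * indicator ?T y \<partial>lborel) = \<dots>" unfolding img .
  moreover have "(\<integral>\<^sup>+y. ?f y * indicator ?T y \<partial>lborel) = (\<integral>\<^sup>+y. (if 0 < y \<and> y\<^sup>2 + a\<^sup>2 < (s * sin \<beta>)\<^sup>2 then ?f y else 0) \<partial>lborel)"
    by (intro nn_integral_cong) (auto simp: indicator_def)
  ultimately show ?thesis by simp
qed

text \<open>
  The integral over all circles with centre on the axis that touch the ray of angle \<open>\<beta>\<close> and enclose
  the point \<open>(x, y)\<close>.  In terms of \<open>u = 1 / s\<close> the
  radicand is \<open>s\<^sup>2\<close> times a quadratic polynomial in \<open>u\<close> with leading coefficient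
  \<open>- (x\<^sup>2 + y\<^sup>2)\<close>, so this is an arcsine integral; its value does not depend on \<open>\<beta>\<close> as long as the
  polynomial takes positive values, that is, as long as \<open>(x, y)\<close> lies inside the wedge.
\<close>

lemma nn_integral_tangent_circles:
  assumes \<beta>: "0 < \<beta>" "\<beta> < pi/2" and y: "0 < y"
  shows "(\<integral>\<^sup>+s. (if 0 < s \<and> y\<^sup>2 + (x - s)\<^sup>2 < (s * sin \<beta>)\<^sup>2 then
          ennreal (1 / (s * sqrt ((s * sin \<beta>)\<^sup>2 - y\<^sup>2 - (x - s)\<^sup>2))) else 0) \<partial>lborel)
       = (if y * cos \<beta> < x * sin \<beta> then ennreal (pi / sqrt (x\<^sup>2 + y\<^sup>2)) else 0)"
  (is "_ = ?rhs")
proof -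
  let ?c = "cos \<beta>"
  define r where "r = sqrt (x\<^sup>2 + y\<^sup>2)"
  let ?T = "{s. 0 < s \<and> y\<^sup>2 + (x - s)\<^sup>2 < (s * sin \<beta>)\<^sup>2}"
  have c: "0 < ?c" "0 < sin \<beta>" using \<beta> by (auto intro!: sin_gt_zero cos_gt_zero)
  have r: "0 < r" "r\<^sup>2 = x\<^sup>2 + y\<^sup>2" unfolding r_def using y by (auto intro!: add_nonneg_pos)
  have sc: "(sin \<beta>)\<^sup>2 = 1 - ?c\<^sup>2" by (simp add: sin_squared_eq)
  define D where "D = x\<^sup>2 - r\<^sup>2 * ?c\<^sup>2"
  have D: "D = (x * sin \<beta>)\<^sup>2 - (y * ?c)\<^sup>2" unfolding D_def r(2) power_mult_distrib sc by (simp add: algebra_simps)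
  have quad: "(s * sin \<beta>)\<^sup>2 - y\<^sup>2 - (x - s)\<^sup>2 = 2 * x * s - r\<^sup>2 - s\<^sup>2 * ?c\<^sup>2" for s
    unfolding r(2) power_mult_distrib sc by (simp add: algebra_simps power2_eq_square)
  show ?thesis
  proof (cases "y * cos \<beta> < x * sin \<beta>")
    case False
    have "s \<notin> ?T" for s
    proof
      assume "s \<in> ?T"
      then have s: "0 < s" "0 < 2 * x * s - r\<^sup>2 - s\<^sup>2 * ?c\<^sup>2" using quad[of s] by auto
      have "0 \<le> (r - s * ?c)\<^sup>2" by simp
      then have "2 * s * (r * ?c) < 2 * s * x" using s(2) by (simp add: power2_eq_square algebra_simps)
      then have x: "r * ?c < x" using s(1) by simp
      have "0 \<le> r * ?c" using r c by simp
      then have "(r * ?c)\<^sup>2 < x\<^sup>2" using x by (intro power_strict_mono) auto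
      then have "(y * ?c)\<^sup>2 < (x * sin \<beta>)\<^sup>2" using D by (simp add: D_def power_mult_distrib)
      moreover have "0 \<le> x" using x \<open>0 \<le> r * ?c\<close> by linarith
      then have "0 \<le> x * sin \<beta>" using c by simp
      ultimately have "y * ?c < x * sin \<beta>" by (rule power_less_imp_less_base)
      with False show False ..
    qed
    then have "\<not> (0 < s \<and> y\<^sup>2 + (x - s)\<^sup>2 < (s * sin \<beta>)\<^sup>2)" for s by simp
    then show ?thesis using False by (simp only: if_False) simp
  next
    case True
    have x: "0 < x"
    proof -
      have "0 < y * cos \<beta>" using c y by simp
      then have "0 < x * sin \<beta>" using True by simp
      then show ?thesis using c by (simp add: zero_less_mult_iff)
    qed
    have "(y * ?c)\<^sup>2 < (x * sin \<beta>)\<^sup>2" using True y c by (intro power_strict_mono) auto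
    then have D0: "0 < D" by (simp add: D)
    have "0 < r\<^sup>2 * ?c\<^sup>2" using r(1) c by simp
    then have Dx: "D < x\<^sup>2" by (simp add: D_def)
    \<comment> \<open>The centre and half-length of the interval of admissible \<open>1 / s\<close>.\<close>
    define u A where "u = x / r\<^sup>2" and "A = sqrt D / r\<^sup>2"
    have A: "0 < A" using D0 r(1) by (simp add: A_def)
    have Au: "A < u" unfolding A_def u_def using Dx x r(1) by (intro divide_strict_right_mono real_less_lsqrt) auto
    have quad2: "(s * sin \<beta>)\<^sup>2 - y\<^sup>2 - (x - s)\<^sup>2 = s\<^sup>2 * r\<^sup>2 * (A\<^sup>2 - (1 / s - u)\<^sup>2)" if "0 < s" for s
    proof -
      have "s\<^sup>2 * \<rho> * (A\<^sup>2 - w\<^sup>2) = s\<^sup>2 * \<rho> * A\<^sup>2 - \<rho> * (s * w)\<^sup>2" for w \<rho>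
        by (simp add: power_mult_distrib algebra_simps)
      then have "s\<^sup>2 * r\<^sup>2 * (A\<^sup>2 - (1 / s - u)\<^sup>2) = s\<^sup>2 * r\<^sup>2 * A\<^sup>2 - r\<^sup>2 * (s * (1 / s - u))\<^sup>2" .
      also have "s\<^sup>2 * r\<^sup>2 * A\<^sup>2 = s\<^sup>2 * D / r\<^sup>2"
        using r(1) D0 by (simp add: A_def power_divide field_simps power2_eq_square)
      also have "s * (1 / s - u) = 1 - s * x / r\<^sup>2" using that by (simp add: u_def algebra_simps)
      also have "s\<^sup>2 * D / r\<^sup>2 - r\<^sup>2 * (1 - s * x / r\<^sup>2)\<^sup>2 = 2 * x * s - r\<^sup>2 - s\<^sup>2 * ?c\<^sup>2"
        using r(1) unfolding D_def by (simp add: field_simps power2_eq_square)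
      finally show ?thesis using quad[of s] by simp
    qed
    let ?S = "{-pi/2<..<pi/2}" and ?g = "\<lambda>\<phi>. 1 / (u + A * sin \<phi>)"
    let ?g' = "\<lambda>\<phi>. - (A * cos \<phi>) / (u + A * sin \<phi>)\<^sup>2"
    let ?f = "\<lambda>s. ennreal (1 / (s * sqrt ((s * sin \<beta>)\<^sup>2 - y\<^sup>2 - (x - s)\<^sup>2)))"
    have pos: "0 < u + A * sin \<phi>" for \<phi>
    proof -
      have "A * - 1 \<le> A * sin \<phi>" using A by (intro mult_left_mono) auto
      then show ?thesis using Au by simp
    qed
    have onS: "(?g \<phi> * sin \<beta>)\<^sup>2 - y\<^sup>2 - (x - ?g \<phi>)\<^sup>2 = (?g \<phi> * r * (A * cos \<phi>))\<^sup>2" for \<phi>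
    proof -
      have "(?g \<phi> * sin \<beta>)\<^sup>2 - y\<^sup>2 - (x - ?g \<phi>)\<^sup>2 = (?g \<phi>)\<^sup>2 * r\<^sup>2 * (A\<^sup>2 - (1 / ?g \<phi> - u)\<^sup>2)"
        using pos by (intro quad2) simp
      also have "1 / ?g \<phi> - u = A * sin \<phi>" using pos[of \<phi>] by simp
      also have "A\<^sup>2 - (A * sin \<phi>)\<^sup>2 = (A * cos \<phi>)\<^sup>2" by (simp add: power_mult_distrib cos_squared_eq algebra_simps)
      finally show ?thesis by (simp only: power_mult_distrib mult_ac)
    qed
    have cosS: "0 < cos \<phi>" if "\<phi> \<in> ?S" for \<phi> using that by (intro cos_gt_zero_pi) auto
    have img: "?g ` ?S = ?T"
    proof (intro equalityI subsetI)
      fix s assume "s \<in> ?g ` ?S"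
      then obtain \<phi> where \<phi>: "\<phi> \<in> ?S" "s = ?g \<phi>" by auto
      have "0 < (?g \<phi> * r * (A * cos \<phi>))\<^sup>2"
        using pos[of \<phi>] r(1) A cosS[OF \<phi>(1)] by (simp add: less_le)
      then have "0 < (s * sin \<beta>)\<^sup>2 - y\<^sup>2 - (x - s)\<^sup>2" unfolding \<phi>(2) onS .
      moreover have "0 < s" using pos[of \<phi>] \<phi>(2) by simp
      ultimately show "s \<in> ?T" by simp
    next
      fix s assume s: "s \<in> ?T"
      then have "0 < s\<^sup>2 * r\<^sup>2 * (A\<^sup>2 - (1 / s - u)\<^sup>2)" using quad2[of s] by simp
      moreover have "0 < s\<^sup>2 * r\<^sup>2" using s r(1) by simp
      ultimately have "0 < A\<^sup>2 - (1 / s - u)\<^sup>2" by (rule zero_less_mult_pos)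
      then have "(1 / s - u)\<^sup>2 < A\<^sup>2" by simp
      then have "\<bar>1 / s - u\<bar> < A" using A by (intro power2_less_imp_less[of "\<bar>1 / s - u\<bar>" A]) auto
      then have b: "- 1 < (1 / s - u) / A" "(1 / s - u) / A < 1" using A by (auto simp: field_simps)
      then have "arcsin ((1 / s - u) / A) \<in> ?S" "sin (arcsin ((1 / s - u) / A)) = (1 / s - u) / A"
        using arcsin_lt_bounded[OF b] by auto
      then show "s \<in> ?g ` ?S" using s A by (intro image_eqI[of _ _ "arcsin ((1 / s - u) / A)"]) auto
    qed
    have "(\<integral>\<^sup>+s. ?f s * indicator (?g ` ?S) s \<partial>lborel) = (\<integral>\<^sup>+\<phi>. ?f (?g \<phi>) * ennreal \<bar>?g' \<phi>\<bar> * indicator ?S \<phi> \<partial>lborel)"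
    proof (rule nn_integral_inj_substitution)
      show "(?g has_real_derivative ?g' \<phi>) (at \<phi> within ?S)" for \<phi>
        using pos[of \<phi>] by (auto intro!: derivative_eq_intros simp: power2_eq_square)
      show "inj_on ?g ?S"
      proof (rule inj_onI)
        fix \<phi> \<psi> assume t: "\<phi> \<in> ?S" "\<psi> \<in> ?S" "?g \<phi> = ?g \<psi>"
        then have "sin \<phi> = sin \<psi>" using pos[of \<phi>] pos[of \<psi>] A by simp
        then show "\<phi> = \<psi>" using t by (auto intro: sin_inj_pi)
      qed
      show "?g ` ?S \<in> sets borel" unfolding img by measurable
    qed measurable
    also have "\<dots> = (\<integral>\<^sup>+\<phi>. ennreal (1 / r) * indicator ?S \<phi> \<partial>lborel)"
      (is "integral\<^sup>N _ ?before = integral\<^sup>N _ ?after")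
    proof (intro nn_integral_cong)
      fix \<phi>
      show "?before \<phi> = ?after \<phi>"
      proof (cases "\<phi> \<in> ?S")
        case True
        define G where "G = u + A * sin \<phi>"
        have G: "0 < G" using pos by (simp add: G_def)
        have k: "0 < A * cos \<phi>" using A cosS[OF True] by simp
        have "sqrt ((?g \<phi> * sin \<beta>)\<^sup>2 - y\<^sup>2 - (x - ?g \<phi>)\<^sup>2) = \<bar>?g \<phi> * r * (A * cos \<phi>)\<bar>"
          unfolding onS real_sqrt_abs ..
        also have "\<dots> = 1 / G * r * (A * cos \<phi>)"
          unfolding G_def[symmetric] using G r(1) k by (intro abs_of_nonneg) simp
        finally have "sqrt ((?g \<phi> * sin \<beta>)\<^sup>2 - y\<^sup>2 - (x - ?g \<phi>)\<^sup>2) = 1 / G * r * (A * cos \<phi>)" .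
        then have "?f (?g \<phi>) * ennreal \<bar>?g' \<phi>\<bar> = ennreal (1 / (1 / G * (1 / G * r * (A * cos \<phi>)))) * ennreal ((A * cos \<phi>) / G\<^sup>2)"
          unfolding G_def[symmetric] using k G by simp
        also have "\<dots> = ennreal (1 / (1 / G * (1 / G * r * (A * cos \<phi>))) * ((A * cos \<phi>) / G\<^sup>2))"
          using k G r(1) by (intro ennreal_mult[symmetric]) auto
        also have "1 / (1 / G * (1 / G * r * (A * cos \<phi>))) * ((A * cos \<phi>) / G\<^sup>2) = 1 / r"
        proof -
          have "A \<noteq> 0" "cos \<phi> \<noteq> 0" using k by auto
          then show ?thesis using G r(1) by (simp add: power2_eq_square)
        qed
        finally show ?thesis by simp
      qed simp
    qed
    also have "\<dots> = ennreal (1 / r) * ennreal pi"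
      by (simp add: nn_integral_cmult_indicator)
    also have "\<dots> = ennreal (pi / r)" using r(1) by (subst ennreal_mult[symmetric]) auto
    finally have "(\<integral>\<^sup>+s. ?f s * indicator ?T s \<partial>lborel) = ennreal (pi / r)" unfolding img .
    moreover have "(\<integral>\<^sup>+s. (if 0 < s \<and> y\<^sup>2 + (x - s)\<^sup>2 < (s * sin \<beta>)\<^sup>2 then ?f s else 0) \<partial>lborel) = (\<integral>\<^sup>+s. ?f s * indicator ?T s \<partial>lborel)"
      by (intro nn_integral_cong) (auto simp: indicator_def)
    ultimately show ?thesis using True by (simp add: r_def)
  qed
qed

text \<open>
  Along the horizontal line at height \<open>y\<close> the angle satisfies \<open>x = y * cot \<alpha>\<close> and
  \<open>dx / sqrt (x\<^sup>2 + y\<^sup>2) = d\<alpha> / sin \<alpha>\<close> up to sign.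
\<close>

lemma nn_integral_sector_slice:
  fixes \<Phi> :: "real \<Rightarrow> ennreal"
  assumes [measurable]: "\<Phi> \<in> borel_measurable borel" and y: "0 < y" and \<beta>: "0 < \<beta>" "\<beta> < pi/2"
  shows "(\<integral>\<^sup>+\<alpha>. (if 0 < \<alpha> \<and> \<alpha> < \<beta> then ennreal (1 / sin \<alpha>) * \<Phi> (y * cos \<alpha> / sin \<alpha>) else 0) \<partial>lborel)
       = (\<integral>\<^sup>+x. (if y * cos \<beta> < x * sin \<beta> then ennreal (1 / sqrt (x\<^sup>2 + y\<^sup>2)) * \<Phi> x else 0) \<partial>lborel)"
proof -
  let ?S = "{0<..<\<beta>}" and ?T = "{x. y * cos \<beta> < x * sin \<beta>}"
  let ?g = "\<lambda>\<alpha>. y * cos \<alpha> / sin \<alpha>"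
  let ?g' = "\<lambda>\<alpha>. - y / (sin \<alpha>)\<^sup>2"
  let ?f = "\<lambda>x. ennreal (1 / sqrt (x\<^sup>2 + y\<^sup>2)) * \<Phi> x"
  have S: "0 < sin \<alpha>" "0 < cos \<alpha>" if "\<alpha> \<in> ?S" for \<alpha>
    using that \<beta> by (auto intro!: sin_gt_zero cos_gt_zero)
  have B: "0 < sin \<beta>" "0 < cos \<beta>" using \<beta> by (auto intro!: sin_gt_zero cos_gt_zero)
  have hyp: "sqrt ((?g \<alpha>)\<^sup>2 + y\<^sup>2) = y / sin \<alpha>" if "\<alpha> \<in> ?S" for \<alpha>
  proof -
    have "(?g \<alpha>)\<^sup>2 + y\<^sup>2 = (y / sin \<alpha>)\<^sup>2"
      using S[OF that] by (simp add: power_divide power_mult_distrib cos_squared_eq field_simps)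
    then show ?thesis using S[OF that] y by simp
  qed
  have img: "?g ` ?S = ?T"
  proof (intro equalityI subsetI)
    fix x assume "x \<in> ?g ` ?S"
    then obtain \<alpha> where \<alpha>: "\<alpha> \<in> ?S" "x = ?g \<alpha>" by auto
    have "0 < sin (\<beta> - \<alpha>)" using \<alpha> \<beta> by (intro sin_gt_zero) auto
    then have "y * (cos \<beta> * sin \<alpha>) < y * (cos \<alpha> * sin \<beta>)" using y by (simp add: sin_diff mult.commute)
    then show "x \<in> ?T" using S[OF \<alpha>(1)] unfolding \<alpha>(2) by (simp add: field_simps)
  next
    fix x assume x: "x \<in> ?T"
    then have x0: "0 < x" 
    proof -
      have "0 < y * cos \<beta>" using B y by simp
      then have "0 < x * sin \<beta>" using x by simp
      then show ?thesis using B by (simp add: zero_less_mult_iff)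
    qed
    define \<alpha> where "\<alpha> = arctan (y / x)"
    have \<alpha>: "0 < \<alpha>" "\<alpha> < pi / 2" using x0 y arctan_ubound by (auto simp: \<alpha>_def)
    have sa: "0 < sin \<alpha>" "0 < cos \<alpha>" using \<alpha> by (auto intro!: sin_gt_zero cos_gt_zero)
    have "tan \<alpha> = y / x" by (simp add: \<alpha>_def tan_arctan)
    then have t: "sin \<alpha> * x = y * cos \<alpha>" using sa x0 by (simp add: tan_def field_simps)
    have "y * cos \<beta> < x * sin \<beta>" using x by simp
    then have "sin \<alpha> * (y * cos \<beta>) < sin \<alpha> * (x * sin \<beta>)" using sa(1) by (rule mult_strict_left_mono)
    then have "y * (sin \<alpha> * cos \<beta>) < y * (cos \<alpha> * sin \<beta>)" 
    proof -
      have 1: "y * (cos \<alpha> * sin \<beta>) = sin \<alpha> * (x * sin \<beta>)" using t by (metis mult.assoc)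
      have 2: "y * (sin \<alpha> * cos \<beta>) = sin \<alpha> * (y * cos \<beta>)" by simp
      show ?thesis unfolding 1 2 by fact
    qed
    then have "0 < sin (\<beta> - \<alpha>)" using y by (simp add: sin_diff mult.commute)
    have "\<alpha> < \<beta>"
    proof (rule ccontr)
      assume "\<not> \<alpha> < \<beta>"
      then have "0 \<le> sin (\<alpha> - \<beta>)" using \<alpha> \<beta> by (intro sin_ge_zero) auto
      with \<open>0 < sin (\<beta> - \<alpha>)\<close> show False using sin_minus[of "\<alpha> - \<beta>"] by simp
    qed
    then show "x \<in> ?g ` ?S" using \<alpha> t sa by (intro image_eqI[of _ _ \<alpha>]) (auto simp: field_simps)
  qed
  have "(\<integral>\<^sup>+x. ?f x * indicator (?g ` ?S) x \<partial>lborel) = (\<integral>\<^sup>+\<alpha>. ?f (?g \<alpha>) * ennreal \<bar>?g' \<alpha>\<bar> * indicator ?S \<alpha> \<partial>lborel)"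
  proof (rule nn_integral_inj_substitution)
    show "(?g has_real_derivative ?g' \<alpha>) (at \<alpha> within ?S)" if "\<alpha> \<in> ?S" for \<alpha>
    proof -
      have "((\<lambda>\<alpha>. y * (cos \<alpha> / sin \<alpha>)) has_real_derivative y * ((- sin \<alpha> * sin \<alpha> - cos \<alpha> * cos \<alpha>) / (sin \<alpha> * sin \<alpha>))) (at \<alpha> within ?S)"
        using S[OF that] by (intro DERIV_cmult DERIV_divide DERIV_cos DERIV_sin DERIV_cos[THEN DERIV_subset] DERIV_sin[THEN DERIV_subset] subset_UNIV) auto
      moreover have "- sin \<alpha> * sin \<alpha> - cos \<alpha> * cos \<alpha> = -1"
        using sin_cos_squared_add[of \<alpha>] by (simp add: power2_eq_square)
      ultimately show ?thesis by (simp add: power2_eq_square)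
    qed
    show "inj_on ?g ?S"
    proof (rule inj_onI)
      fix \<alpha> \<alpha>' assume t: "\<alpha> \<in> ?S" "\<alpha>' \<in> ?S" "?g \<alpha> = ?g \<alpha>'"
      then have "cos \<alpha> * sin \<alpha>' = cos \<alpha>' * sin \<alpha>" using S[OF t(1)] S[OF t(2)] y by (simp add: field_simps)
      then have "sin (\<alpha> - \<alpha>') = 0" by (simp add: sin_diff)
      moreover have "0 < sin (\<alpha> - \<alpha>')" if "\<alpha>' < \<alpha>" using that t \<beta> by (intro sin_gt_zero) auto
      moreover have "0 < sin (\<alpha>' - \<alpha>)" if "\<alpha> < \<alpha>'" using that t \<beta> by (intro sin_gt_zero) auto
      moreover have "sin (\<alpha>' - \<alpha>) = - sin (\<alpha> - \<alpha>')" by (simp flip: sin_minus)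
      ultimately show "\<alpha> = \<alpha>'" by (cases \<alpha> \<alpha>' rule: linorder_cases) auto
    qed
    show "?g ` ?S \<in> sets borel" unfolding img by measurable
  qed measurable
  also have "\<dots> = (\<integral>\<^sup>+\<alpha>. (if 0 < \<alpha> \<and> \<alpha> < \<beta> then ennreal (1 / sin \<alpha>) * \<Phi> (?g \<alpha>) else 0) \<partial>lborel)"
    (is "integral\<^sup>N _ ?before = integral\<^sup>N _ ?after")
  proof (intro nn_integral_cong)
    fix \<alpha>
    show "?before \<alpha> = ?after \<alpha>"
    proof (cases "\<alpha> \<in> ?S")
      case True
      have "ennreal (1 / (y / sin \<alpha>)) * ennreal \<bar>?g' \<alpha>\<bar> = ennreal (1 / (y / sin \<alpha>) * (y / (sin \<alpha>)\<^sup>2))"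
        using S[OF True] y by (subst ennreal_mult) auto
      also have "1 / (y / sin \<alpha>) * (y / (sin \<alpha>)\<^sup>2) = 1 / sin \<alpha>"
        using S[OF True] y by (simp add: power2_eq_square)
      finally have "?f (?g \<alpha>) * ennreal \<bar>?g' \<alpha>\<bar> = ennreal (1 / sin \<alpha>) * \<Phi> (?g \<alpha>)"
        unfolding hyp[OF True] by (rule ennreal_mult_swap)
      then show ?thesis using True by (simp only: indicator_simps) simp
    qed auto
  qed
  finally have "(\<integral>\<^sup>+x. ?f x * indicator ?T x \<partial>lborel) = \<dots>" unfolding img .
  moreover have "(\<integral>\<^sup>+x. ?f x * indicator ?T x \<partial>lborel) = (\<integral>\<^sup>+x. (if y * cos \<beta> < x * sin \<beta> then ?f x else 0) \<partial>lborel)"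
    by (intro nn_integral_cong) (auto simp: indicator_def)
  ultimately show ?thesis by simp
qed

text \<open>
  The planar identity behind slanted planes.  The left-hand side is the integral that \<open>W\<close>
  differentiates, applied to the \<open>1/s\<close>-weighted integrals of \<open>h\<close> over the half-circles with centre
  \<open>(s, 0)\<close> and radius \<open>s * sin \<theta>\<close>.  Both sides equal the integral of \<open>pi * h (x, y) / sqrt (x\<^sup>2 + y\<^sup>2)\<close>
  over the wedge of angle \<open>\<beta>\<close>.
\<close>

lemma nn_integral_wedge:
  fixes h :: "real \<times> real \<Rightarrow> ennreal"
  assumes [measurable]: "h \<in> borel_measurable (borel \<Otimes>\<^sub>M borel)" and \<beta>: "0 < \<beta>" "\<beta> < pi/2"
  shows "(\<integral>\<^sup>+\<theta>. \<integral>\<^sup>+s. \<integral>\<^sup>+\<phi>. (if 0 < \<theta> \<and> \<theta> < \<beta> \<and> 0 < s \<and> - pi/2 < \<phi> \<and> \<phi> < pi/2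
           then ennreal (cos \<theta> * sin \<theta> / sqrt ((sin \<beta>)\<^sup>2 - (sin \<theta>)\<^sup>2)) * h (s + s * sin \<theta> * sin \<phi>, s * sin \<theta> * cos \<phi>) else 0)
           \<partial>lborel \<partial>lborel \<partial>lborel)
       = (\<integral>\<^sup>+\<alpha>. \<integral>\<^sup>+r. (if 0 < \<alpha> \<and> \<alpha> < \<beta> \<and> 0 < r then ennreal pi * h (r * cos \<alpha>, r * sin \<alpha>) else 0) \<partial>lborel \<partial>lborel)"
    (is "?lhs = ?rhs")
proof -
  let ?k = "\<lambda>\<theta>. cos \<theta> * sin \<theta> / sqrt ((sin \<beta>)\<^sup>2 - (sin \<theta>)\<^sup>2)"
  let ?q = "\<lambda>\<theta> s x. sqrt ((s * sin \<theta>)\<^sup>2 - (x - s)\<^sup>2)"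
  let ?T = "\<lambda>\<theta> s x. if 0 < \<theta> \<and> \<theta> < \<beta> \<and> 0 < s \<and> \<bar>x - s\<bar> < s * sin \<theta>
      then ennreal (?k \<theta> / ?q \<theta> s x) * h (x, ?q \<theta> s x) else 0"
  let ?U = "\<lambda>s x y. if 0 < s \<and> 0 < y \<and> y\<^sup>2 + (x - s)\<^sup>2 < (s * sin \<beta>)\<^sup>2
      then ennreal (1 / (s * sqrt ((s * sin \<beta>)\<^sup>2 - y\<^sup>2 - (x - s)\<^sup>2))) * h (x, y) else 0"
  let ?V = "\<lambda>x y. if 0 < y \<and> y * cos \<beta> < x * sin \<beta> then ennreal (pi / sqrt (x\<^sup>2 + y\<^sup>2)) * h (x, y) else 0"
  have sin_pos: "0 < sin \<theta>" "0 \<le> ?k \<theta>" if "0 < \<theta>" "\<theta> < \<beta>" for \<theta>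
  proof -
    have "0 < cos \<theta>" "sin \<theta> \<le> sin \<beta>" using that \<beta> by (auto intro!: cos_gt_zero sin_monotone_2pi_le)
    moreover show "0 < sin \<theta>" using that \<beta> by (intro sin_gt_zero) auto
    ultimately show "0 \<le> ?k \<theta>" by (simp add: power_mono)
  qed
  have "?lhs = (\<integral>\<^sup>+\<theta>. \<integral>\<^sup>+s. \<integral>\<^sup>+x. ?T \<theta> s x \<partial>lborel \<partial>lborel \<partial>lborel)"
  proof (rule nn_integral_cong, rule nn_integral_cong)
    fix \<theta> s :: real
    show "(\<integral>\<^sup>+\<phi>. (if 0 < \<theta> \<and> \<theta> < \<beta> \<and> 0 < s \<and> - pi/2 < \<phi> \<and> \<phi> < pi/2
           then ennreal (?k \<theta>) * h (s + s * sin \<theta> * sin \<phi>, s * sin \<theta> * cos \<phi>) else 0) \<partial>lborel)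
      = (\<integral>\<^sup>+x. ?T \<theta> s x \<partial>lborel)"
    proof (cases "0 < \<theta> \<and> \<theta> < \<beta> \<and> 0 < s")
      case True
      define q where "q = s * sin \<theta>"
      have q: "0 < q" using True sin_pos by (simp add: q_def)
      have "(\<integral>\<^sup>+\<phi>. (if 0 < \<theta> \<and> \<theta> < \<beta> \<and> 0 < s \<and> - pi/2 < \<phi> \<and> \<phi> < pi/2
           then ennreal (?k \<theta>) * h (s + s * sin \<theta> * sin \<phi>, s * sin \<theta> * cos \<phi>) else 0) \<partial>lborel)
         = (\<integral>\<^sup>+\<phi>. ennreal (?k \<theta>) * (h (s + q * sin \<phi>, q * cos \<phi>) * indicator {-pi/2<..<pi/2} \<phi>) \<partial>lborel)"
        using True by (intro nn_integral_cong) (auto simp: q_def)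
      also have "\<dots> = ennreal (?k \<theta>) * (\<integral>\<^sup>+\<phi>. h (s + q * sin \<phi>, q * cos \<phi>) * indicator {-pi/2<..<pi/2} \<phi> \<partial>lborel)"
        by (rule nn_integral_cmult) measurable
      also have "(\<integral>\<^sup>+\<phi>. h (s + q * sin \<phi>, q * cos \<phi>) * indicator {-pi/2<..<pi/2} \<phi> \<partial>lborel)
          = (\<integral>\<^sup>+a. (if \<bar>a\<bar> < q then ennreal (1 / sqrt (q\<^sup>2 - a\<^sup>2)) * h (s + a, sqrt (q\<^sup>2 - a\<^sup>2)) else 0) \<partial>lborel)"
        by (rule nn_integral_arc[OF _ q, of "\<lambda>x. h (s + fst x, snd x)", unfolded fst_conv snd_conv]) measurable
      also have "ennreal (?k \<theta>) * \<dots> = (\<integral>\<^sup>+a. ennreal (?k \<theta>) * (if \<bar>a\<bar> < q then ennreal (1 / sqrt (q\<^sup>2 - a\<^sup>2)) * h (s + a, sqrt (q\<^sup>2 - a\<^sup>2)) else 0) \<partial>lborel)"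
        by (rule nn_integral_cmult[symmetric]) measurable
      also have "\<dots> = (\<integral>\<^sup>+a. ?T \<theta> s (s + a) \<partial>lborel)"
        (is "integral\<^sup>N _ ?before' = integral\<^sup>N _ ?after'")
      proof (rule nn_integral_cong)
        fix a
        have "ennreal (?k \<theta>) * (ennreal (1 / sqrt (q\<^sup>2 - a\<^sup>2)) * X) = ennreal (?k \<theta> / sqrt (q\<^sup>2 - a\<^sup>2)) * X"
          if "\<bar>a\<bar> < q" for X
        proof -
          have "\<bar>a\<bar>\<^sup>2 \<le> q\<^sup>2" using that by (intro power_mono) auto
          then have "ennreal (?k \<theta>) * ennreal (1 / sqrt (q\<^sup>2 - a\<^sup>2)) = ennreal (?k \<theta> * (1 / sqrt (q\<^sup>2 - a\<^sup>2)))"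
            using True sin_pos by (intro ennreal_mult[symmetric]) auto
          then show ?thesis by (simp add: mult.assoc[symmetric])
        qed
        then show "?before' a = ?after' a"
          using True by (simp add: q_def)
      qed
      also have "\<dots> = (\<integral>\<^sup>+x. ?T \<theta> s x \<partial>lborel)"
      proof -
        have "(\<integral>\<^sup>+x. ?T \<theta> s x \<partial>lborel) = ennreal \<bar>1\<bar> * (\<integral>\<^sup>+a. ?T \<theta> s (s + 1 * a) \<partial>lborel)"
        proof (rule nn_integral_real_affine)
          show "?T \<theta> s \<in> borel_measurable borel" by measurable
        qed simp
        then show ?thesis by (simp only: mult_1 abs_one ennreal_1)
      qed
      finally show ?thesis .
    next
      case False
      then have "\<not> (0 < \<theta> \<and> \<theta> < \<beta> \<and> 0 < s \<and> P)" for P by blast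
      then show ?thesis by (simp only: if_False)
    qed
  qed
  also have "\<dots> = (\<integral>\<^sup>+s. \<integral>\<^sup>+\<theta>. \<integral>\<^sup>+x. ?T \<theta> s x \<partial>lborel \<partial>lborel \<partial>lborel)"
    by (rule lborel_pair.Fubini') measurable
  also have "\<dots> = (\<integral>\<^sup>+s. \<integral>\<^sup>+x. \<integral>\<^sup>+\<theta>. ?T \<theta> s x \<partial>lborel \<partial>lborel \<partial>lborel)"
    by (rule nn_integral_cong, rule lborel_pair.Fubini') measurable
  also have "\<dots> = (\<integral>\<^sup>+s. \<integral>\<^sup>+x. \<integral>\<^sup>+y. ?U s x y \<partial>lborel \<partial>lborel \<partial>lborel)"
  proof (rule nn_integral_cong, rule nn_integral_cong)
    fix s x :: real
    show "(\<integral>\<^sup>+\<theta>. ?T \<theta> s x \<partial>lborel) = (\<integral>\<^sup>+y. ?U s x y \<partial>lborel)"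
    proof (cases "0 < s")
      case True
      then show ?thesis using nn_integral_angle_to_height[OF _ True \<beta>, of "\<lambda>y. h (x, y)" "x - s"] by simp
    qed simp
  qed
  also have "\<dots> = (\<integral>\<^sup>+x. \<integral>\<^sup>+s. \<integral>\<^sup>+y. ?U s x y \<partial>lborel \<partial>lborel \<partial>lborel)"
    by (rule lborel_pair.Fubini') measurable
  also have "\<dots> = (\<integral>\<^sup>+x. \<integral>\<^sup>+y. \<integral>\<^sup>+s. ?U s x y \<partial>lborel \<partial>lborel \<partial>lborel)"
    by (rule nn_integral_cong, rule lborel_pair.Fubini') measurable
  also have "\<dots> = (\<integral>\<^sup>+x. \<integral>\<^sup>+y. ?V x y \<partial>lborel \<partial>lborel)"
  proof (rule nn_integral_cong, rule nn_integral_cong)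
    fix x y :: real
    show "(\<integral>\<^sup>+s. ?U s x y \<partial>lborel) = ?V x y"
    proof (cases "0 < y")
      case True
      have "(\<integral>\<^sup>+s. ?U s x y \<partial>lborel) = (\<integral>\<^sup>+s. (if 0 < s \<and> y\<^sup>2 + (x - s)\<^sup>2 < (s * sin \<beta>)\<^sup>2 then
          ennreal (1 / (s * sqrt ((s * sin \<beta>)\<^sup>2 - y\<^sup>2 - (x - s)\<^sup>2))) else 0) * h (x, y) \<partial>lborel)"
        using True by (intro nn_integral_cong) auto
      also have "\<dots> = (\<integral>\<^sup>+s. (if 0 < s \<and> y\<^sup>2 + (x - s)\<^sup>2 < (s * sin \<beta>)\<^sup>2 then
          ennreal (1 / (s * sqrt ((s * sin \<beta>)\<^sup>2 - y\<^sup>2 - (x - s)\<^sup>2))) else 0) \<partial>lborel) * h (x, y)"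
        by (rule nn_integral_multc) measurable
      finally show ?thesis unfolding nn_integral_tangent_circles[OF \<beta> True] using True by simp
    qed simp
  qed
  also have "\<dots> = (\<integral>\<^sup>+y. \<integral>\<^sup>+x. ?V x y \<partial>lborel \<partial>lborel)"
    by (rule lborel_pair.Fubini') measurable
  also have "\<dots> = (\<integral>\<^sup>+y. \<integral>\<^sup>+\<alpha>. (if 0 < \<alpha> \<and> \<alpha> < \<beta> \<and> 0 < y then ennreal (pi / sin \<alpha>) * h (y * cos \<alpha> / sin \<alpha>, y) else 0) \<partial>lborel \<partial>lborel)"
    (is "integral\<^sup>N _ ?before = integral\<^sup>N _ ?after")
  proof (rule nn_integral_cong)
    fix y :: real
    show "?before y = ?after y"
    proof (cases "0 < y")
      case True
      have pi_mult: "ennreal (1 / c) * (ennreal pi * X) = ennreal (pi / c) * X" if "0 \<le> c" for c X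
      proof -
        have "ennreal (1 / c) * ennreal pi = ennreal (pi / c)" using that by (subst ennreal_mult[symmetric]) auto
        then show ?thesis by (simp add: mult.assoc[symmetric])
      qed
      have "(\<integral>\<^sup>+x. ?V x y \<partial>lborel) = (\<integral>\<^sup>+x. (if y * cos \<beta> < x * sin \<beta> then ennreal (1 / sqrt (x\<^sup>2 + y\<^sup>2)) * (ennreal pi * h (x, y)) else 0) \<partial>lborel)"
        using True by (intro nn_integral_cong) (simp add: pi_mult)
      also have "\<dots> = (\<integral>\<^sup>+\<alpha>. (if 0 < \<alpha> \<and> \<alpha> < \<beta> then ennreal (1 / sin \<alpha>) * (ennreal pi * h (y * cos \<alpha> / sin \<alpha>, y)) else 0) \<partial>lborel)"
        by (rule nn_integral_sector_slice[OF _ True \<beta>, symmetric]) measurable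
      also have "\<dots> = (\<integral>\<^sup>+\<alpha>. (if 0 < \<alpha> \<and> \<alpha> < \<beta> \<and> 0 < y then ennreal (pi / sin \<alpha>) * h (y * cos \<alpha> / sin \<alpha>, y) else 0) \<partial>lborel)"
        using True sin_pos(1) by (intro nn_integral_cong) (simp add: pi_mult less_imp_le)
      finally show ?thesis .
    qed simp
  qed
  also have "\<dots> = (\<integral>\<^sup>+\<alpha>. \<integral>\<^sup>+y. (if 0 < \<alpha> \<and> \<alpha> < \<beta> \<and> 0 < y then ennreal (pi / sin \<alpha>) * h (y * cos \<alpha> / sin \<alpha>, y) else 0) \<partial>lborel \<partial>lborel)"
    by (rule lborel_pair.Fubini') measurable
  also have "\<dots> = ?rhs" (is "integral\<^sup>N _ ?before = integral\<^sup>N _ ?after")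
  proof (rule nn_integral_cong)
    fix \<alpha> :: real
    let ?r = "\<lambda>r. if 0 < \<alpha> \<and> \<alpha> < \<beta> \<and> 0 < r then ennreal pi * h (r * cos \<alpha>, r * sin \<alpha>) else 0"
    show "?before \<alpha> = ?after \<alpha>"
    proof (cases "0 < \<alpha> \<and> \<alpha> < \<beta>")
      case True
      then have sa: "0 < sin \<alpha>" using sin_pos by blast
      have "(\<integral>\<^sup>+r. ?r r \<partial>lborel) = ennreal \<bar>1 / sin \<alpha>\<bar> * (\<integral>\<^sup>+y. ?r (0 + 1 / sin \<alpha> * y) \<partial>lborel)"
        using sa by (intro nn_integral_real_affine) auto
      also have "\<dots> = (\<integral>\<^sup>+y. ennreal \<bar>1 / sin \<alpha>\<bar> * ?r (0 + 1 / sin \<alpha> * y) \<partial>lborel)"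
        by (rule nn_integral_cmult[symmetric]) measurable
      also have "\<dots> = (\<integral>\<^sup>+y. (if 0 < \<alpha> \<and> \<alpha> < \<beta> \<and> 0 < y then ennreal (pi / sin \<alpha>) * h (y * cos \<alpha> / sin \<alpha>, y) else 0) \<partial>lborel)"
        (is "integral\<^sup>N _ ?before' = integral\<^sup>N _ ?after'")
      proof (rule nn_integral_cong)
        fix y
        have "ennreal \<bar>1 / sin \<alpha>\<bar> * ennreal pi = ennreal (pi / sin \<alpha>)" using sa by (subst ennreal_mult[symmetric]) auto
        then have "ennreal \<bar>1 / sin \<alpha>\<bar> * (ennreal pi * X) = ennreal (pi / sin \<alpha>) * X" for X
          by (simp only: mult.assoc[symmetric])
        moreover have "0 < 0 + 1 / sin \<alpha> * y \<longleftrightarrow> 0 < y" using sa by (simp add: zero_less_divide_iff)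
        moreover have "(0 + 1 / sin \<alpha> * y) * cos \<alpha> = y * cos \<alpha> / sin \<alpha>" "(0 + 1 / sin \<alpha> * y) * sin \<alpha> = y" using sa by simp_all
        ultimately show "?before' y = ?after' y"
          using True by (cases "0 < y") (simp_all only: if_True if_False simp_thms mult_zero_right)
      qed
      finally show ?thesis ..
    next
      case False
      then have "\<not> (0 < \<alpha> \<and> \<alpha> < \<beta> \<and> P)" for P by blast
      then show ?thesis by (simp only: if_False)
    qed
  qed
  finally show ?thesis .
qed

section \<open>Inversion of half-circle integrals in the plane\<close>

text \<open>
  The two-dimensional sonar transform: the integral of \<open>g\<close> with respect to arc length over the upper
  half-circle with centre \<open>(x, 0)\<close> and radius \<open>y\<close>.  Written in terms of the angle it is visibly
  continuous in \<open>y\<close>.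
\<close>

definition arc_integral :: "(real \<times> real \<Rightarrow> real) \<Rightarrow> real \<Rightarrow> real \<Rightarrow> real" where
  "arc_integral g x y = y * (LINT \<phi>:{-pi/2<..<pi/2}|lborel. g (x + y * sin \<phi>, y * cos \<phi>))"

lemma integral_arc:
  fixes g :: "real \<times> real \<Rightarrow> real"
  assumes [measurable]: "g \<in> borel_measurable borel" and q: "0 < q"
  shows "(LINT a|lborel. sphere_density q \<bar>a\<bar> * g (x + a, sqrt (q\<^sup>2 - a\<^sup>2))) = arc_integral g x q"
proof -
  let ?S = "{-pi/2<..<pi/2}"
  have H: "(\<integral>\<^sup>+a. ennreal (sphere_density q \<bar>a\<bar>) * h (a, sqrt (q\<^sup>2 - a\<^sup>2)) \<partial>lborel)
      = (\<integral>\<^sup>+\<phi>. ennreal (q * indicator ?S \<phi>) * h (q * sin \<phi>, q * cos \<phi>) \<partial>lborel)"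
    if h: "h \<in> borel_measurable borel" for h
  proof -
    have [measurable]: "h \<in> borel_measurable (borel \<Otimes>\<^sub>M borel)" using h by (simp add: borel_prod)
    have "(\<integral>\<^sup>+a. ennreal (sphere_density q \<bar>a\<bar>) * h (a, sqrt (q\<^sup>2 - a\<^sup>2)) \<partial>lborel)
      = (\<integral>\<^sup>+a. ennreal q * (if \<bar>a\<bar> < q then ennreal (1 / sqrt (q\<^sup>2 - a\<^sup>2)) * h (a, sqrt (q\<^sup>2 - a\<^sup>2)) else 0) \<partial>lborel)"
        (is "integral\<^sup>N _ ?before = integral\<^sup>N _ ?after")
    proof (rule nn_integral_cong)
      fix a
      have "ennreal (q / sqrt (q\<^sup>2 - a\<^sup>2)) = ennreal q * ennreal (1 / sqrt (q\<^sup>2 - a\<^sup>2))" if "\<bar>a\<bar> < q"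
      proof -
        have "\<bar>a\<bar>\<^sup>2 \<le> q\<^sup>2" using that by (intro power_mono) auto
        then show ?thesis using q by (subst ennreal_mult[symmetric]) auto
      qed
      then show "?before a = ?after a"
        by (simp add: sphere_density_def mult.assoc)
    qed
    also have "\<dots> = ennreal q * (\<integral>\<^sup>+a. (if \<bar>a\<bar> < q then ennreal (1 / sqrt (q\<^sup>2 - a\<^sup>2)) * h (a, sqrt (q\<^sup>2 - a\<^sup>2)) else 0) \<partial>lborel)"
      by (rule nn_integral_cmult) measurable
    also have "\<dots> = ennreal q * (\<integral>\<^sup>+\<phi>. h (q * sin \<phi>, q * cos \<phi>) * indicator ?S \<phi> \<partial>lborel)"
      by (subst nn_integral_arc[OF _ q]) simp_all
    also have "\<dots> = (\<integral>\<^sup>+\<phi>. ennreal q * (h (q * sin \<phi>, q * cos \<phi>) * indicator ?S \<phi>) \<partial>lborel)"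
      by (rule nn_integral_cmult[symmetric]) measurable
    also have "\<dots> = (\<integral>\<^sup>+\<phi>. ennreal (q * indicator ?S \<phi>) * h (q * sin \<phi>, q * cos \<phi>) \<partial>lborel)"
      by (intro nn_integral_cong) (auto simp: indicator_def)
    finally show ?thesis .
  qed
  have [measurable]: "(\<lambda>y. g (x + fst y, snd y)) \<in> borel_measurable borel"
    using assms(1) by (intro measurable_compose[OF borel_measurable_continuous_onI assms(1)] continuous_intros)
  have "(LINT a|lborel. sphere_density q \<bar>a\<bar> * g (x + fst (a, sqrt (q\<^sup>2 - a\<^sup>2)), snd (a, sqrt (q\<^sup>2 - a\<^sup>2))))
      = (LINT \<phi>|lborel. (q * indicator ?S \<phi>) * g (x + fst (q * sin \<phi>, q * cos \<phi>), snd (q * sin \<phi>, q * cos \<phi>)))"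
    by (rule integral_transfer[where g = "\<lambda>y. g (x + fst y, snd y)"])
       (use q in \<open>auto simp: H sphere_density_nonneg intro!: borel_measurable_Pair\<close>)
  also have "\<dots> = arc_integral g x q"
    by (simp add: arc_integral_def set_lebesgue_integral_def mult.assoc)
  finally show ?thesis by simp
qed

lemma set_integral_open_interval:
  fixes F :: "real \<Rightarrow> real"
  assumes F: "continuous_on {a..b} F"
  shows "(LINT x:{a<..<b}|lborel. F x) = integral {a..b} F"
proof -
  have "(LINT x:{a<..<b}|lborel. F x) = integral {a<..<b} F"
    by (intro set_borel_integral_eq_integral set_integrable_subset[OF borel_integrable_atLeastAtMost'[OF F]]) auto
  then show ?thesis by (simp add: integral_open_interval_real)
qed

lemma continuous_arc_integral:
  assumes g: "continuous_on UNIV g"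
  shows "continuous_on UNIV (arc_integral g x)"
proof -
  have c: "continuous_on (UNIV \<times> cbox (-pi/2) (pi/2)) (\<lambda>(y, \<phi>). g (x + y * sin \<phi>, y * cos \<phi>))"
    unfolding split_beta' by (intro continuous_on_compose2[OF g] continuous_intros) auto
  have "arc_integral g x = (\<lambda>y. y * integral (cbox (-pi/2) (pi/2)) (\<lambda>\<phi>. g (x + y * sin \<phi>, y * cos \<phi>)))"
    unfolding arc_integral_def fun_eq_iff cbox_interval
    by (intro allI arg_cong2[where f = "(*)"] refl set_integral_open_interval continuous_on_compose2[OF g] continuous_intros) auto
  moreover have "continuous_on UNIV (\<lambda>y. y * integral (cbox (-pi/2) (pi/2)) (\<lambda>\<phi>. g (x + y * sin \<phi>, y * cos \<phi>)))"
    by (intro continuous_intros integral_continuous_on_param c)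
  ultimately show ?thesis by simp
qed

lemma arc_integral_eq_0:
  assumes "\<And>x y. y < \<delta> \<Longrightarrow> g (x, y) = 0" "0 < \<delta>" "q < \<delta>"
  shows "arc_integral g x q = 0"
proof (cases "0 < q")
  case True
  have "q * cos \<phi> < \<delta>" for \<phi>
  proof -
    have "q * cos \<phi> \<le> q * 1" using True by (intro mult_left_mono) auto
    then show ?thesis using assms(3) by simp
  qed
  then show ?thesis by (simp add: arc_integral_def assms(1))
next
  case False
  have "(LINT \<phi>:{-pi/2<..<pi/2}|lborel. g (x + q * sin \<phi>, q * cos \<phi>)) = (LINT \<phi>:{-pi/2<..<pi/2}|lborel. 0)"
  proof (intro set_lebesgue_integral_cong ballI allI impI)
    fix \<phi> assume "\<phi> \<in> {-pi/2<..<pi/2}"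
    then have "0 < cos \<phi>" by (intro cos_gt_zero_pi) auto
    then have "q * cos \<phi> \<le> 0" using False by (simp add: mult_nonpos_nonneg)
    then show "g (x + q * sin \<phi>, q * cos \<phi>) = 0" using assms by simp
  qed simp
  then show ?thesis by (simp add: arc_integral_def set_lebesgue_integral_def)
qed

text \<open>
  On the side of the rays the integrand is bounded with bounded support, so it is integrable; this
  is transferred to the singular kernel on the other side, where Fubini's theorem is needed.
\<close>

lemma integral_wedge:
  fixes g :: "real \<times> real \<Rightarrow> real"
  assumes [measurable]: "g \<in> borel_measurable borel" and \<beta>: "0 < \<beta>" "\<beta> < pi/2"
    and C: "\<And>z. \<bar>g z\<bar> \<le> C" and R: "\<And>x y. g (x, y) \<noteq> 0 \<Longrightarrow> \<bar>x\<bar> \<le> R \<and> \<bar>y\<bar> \<le> R"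
  shows "(LINT \<theta>:{0<..<\<beta>}|lborel. cos \<theta> / sqrt ((sin \<beta>)\<^sup>2 - (sin \<theta>)\<^sup>2) *
            (LINT s:{0<..}|lborel. arc_integral g s (s * sin \<theta>) * (1 / s)))
       = pi * (LINT \<alpha>:{0<..<\<beta>}|lborel. LINT r:{0<..}|lborel. g (r * cos \<alpha>, r * sin \<alpha>))"
proof -
  have [measurable]: "g \<in> borel_measurable (borel \<Otimes>\<^sub>M borel)" by (simp add: borel_prod)
  let ?k = "\<lambda>\<theta>. cos \<theta> * sin \<theta> / sqrt ((sin \<beta>)\<^sup>2 - (sin \<theta>)\<^sup>2)"
  let ?w = "\<lambda>(\<theta>, s, \<phi>). if 0 < \<theta> \<and> \<theta> < \<beta> \<and> 0 < s \<and> - pi/2 < \<phi> \<and> \<phi> < pi/2 then ?k \<theta> else 0"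
  let ?\<phi> = "\<lambda>(\<theta>, s, \<phi>). (s + s * sin \<theta> * sin \<phi>, s * sin \<theta> * cos \<phi>)"
  let ?v = "\<lambda>(\<alpha>, r). if 0 < \<alpha> \<and> \<alpha> < \<beta> \<and> 0 < r then pi else 0"
  let ?\<psi> = "\<lambda>(\<alpha>, r). (r * cos \<alpha>, r * sin \<alpha>)"
  let ?M = "(lborel :: real measure) \<Otimes>\<^sub>M ((lborel :: real measure) \<Otimes>\<^sub>M (lborel :: real measure))"
  let ?N = "(lborel :: real measure) \<Otimes>\<^sub>M (lborel :: real measure)"
  interpret P: pair_sigma_finite "lborel :: real measure" "(lborel :: real measure) \<Otimes>\<^sub>M (lborel :: real measure)"
    by (simp add: lborel_prod pair_sigma_finite.intro sigma_finite_lborel)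
  have sf: "sigma_finite_measure ?N" by (simp add: lborel_prod sigma_finite_lborel)
  have k: "0 \<le> ?k \<theta>" if "0 < \<theta>" "\<theta> < \<beta>" for \<theta>
  proof -
    have "0 < cos \<theta>" "0 < sin \<theta>" "sin \<theta> \<le> sin \<beta>" using that \<beta> by (auto intro!: cos_gt_zero sin_gt_zero sin_monotone_2pi_le)
    then show ?thesis by (simp add: power_mono)
  qed
  have meas: "?w \<in> borel_measurable ?M" "?v \<in> borel_measurable ?N" by measurable
  have meas2: "?\<phi> \<in> ?M \<rightarrow>\<^sub>M borel" "?\<psi> \<in> ?N \<rightarrow>\<^sub>M borel"
    unfolding split_beta' by (intro borel_measurable_Pair; measurable)+
  have pos: "0 \<le> ?w x" "0 \<le> ?v y" for x y using k by (auto split: prod.split)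
  have H: "(\<integral>\<^sup>+x. ennreal (?w x) * h (?\<phi> x) \<partial>?M) = (\<integral>\<^sup>+x. ennreal (?v x) * h (?\<psi> x) \<partial>?N)"
    if h: "h \<in> borel_measurable borel" for h
  proof -
    have h'[measurable]: "h \<in> borel_measurable (borel \<Otimes>\<^sub>M borel)" using h by (simp add: borel_prod)
    have Z: "(\<lambda>x. ennreal (?w x) * h (?\<phi> x)) \<in> borel_measurable ?M" by measurable
    have "(\<integral>\<^sup>+x. ennreal (?w x) * h (?\<phi> x) \<partial>?M) = (\<integral>\<^sup>+\<theta>. \<integral>\<^sup>+x. ennreal (?w (\<theta>, x)) * h (?\<phi> (\<theta>, x)) \<partial>?N \<partial>lborel)"
      by (rule sigma_finite_measure.nn_integral_fst[OF sf Z, symmetric])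
    also have "\<dots> = (\<integral>\<^sup>+\<theta>. \<integral>\<^sup>+s. \<integral>\<^sup>+\<phi>. ennreal (?w (\<theta>, s, \<phi>)) * h (?\<phi> (\<theta>, s, \<phi>)) \<partial>lborel \<partial>lborel \<partial>lborel)"
      by (rule nn_integral_cong, rule lborel.nn_integral_fst[symmetric], rule measurable_Pair2[OF Z]) simp
    also have "\<dots> = (\<integral>\<^sup>+\<theta>. \<integral>\<^sup>+s. \<integral>\<^sup>+\<phi>. (if 0 < \<theta> \<and> \<theta> < \<beta> \<and> 0 < s \<and> - pi/2 < \<phi> \<and> \<phi> < pi/2
           then ennreal (?k \<theta>) * h (s + s * sin \<theta> * sin \<phi>, s * sin \<theta> * cos \<phi>) else 0) \<partial>lborel \<partial>lborel \<partial>lborel)"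
      by (intro nn_integral_cong) auto
    also have "\<dots> = (\<integral>\<^sup>+\<alpha>. \<integral>\<^sup>+r. (if 0 < \<alpha> \<and> \<alpha> < \<beta> \<and> 0 < r then ennreal pi * h (r * cos \<alpha>, r * sin \<alpha>) else 0) \<partial>lborel \<partial>lborel)"
      by (rule nn_integral_wedge[OF h' \<beta>])
    also have "\<dots> = (\<integral>\<^sup>+\<alpha>. \<integral>\<^sup>+r. ennreal (?v (\<alpha>, r)) * h (?\<psi> (\<alpha>, r)) \<partial>lborel \<partial>lborel)"
      by (intro nn_integral_cong) auto
    also have "\<dots> = (\<integral>\<^sup>+x. ennreal (?v x) * h (?\<psi> x) \<partial>?N)"
      by (rule lborel.nn_integral_fst) measurable
    finally show ?thesis .
  qed
  have IN: "integrable ?N (\<lambda>x. ?v x * g (?\<psi> x))"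
  proof (rule lborel_pair.integrable_bounded_support_pair)
    show "(\<lambda>x. ?v x * g (?\<psi> x)) \<in> borel_measurable ?N" by measurable
    show "emeasure lborel {0..\<beta>} < \<infinity>" "emeasure lborel {0..2 * R} < \<infinity>" by (auto simp: emeasure_lborel_Icc_eq)
    have "0 \<le> C" using C[of undefined] by linarith
    then show "\<bar>?v (\<alpha>, r) * g (?\<psi> (\<alpha>, r))\<bar> \<le> pi * C" for \<alpha> r using C by (auto simp: abs_mult)
    show "\<alpha> \<in> {0..\<beta>} \<and> r \<in> {0..2 * R}" if "?v (\<alpha>, r) * g (?\<psi> (\<alpha>, r)) \<noteq> 0" for \<alpha> r
    proof -
      have a: "0 < \<alpha>" "\<alpha> < \<beta>" "0 < r" "g (r * cos \<alpha>, r * sin \<alpha>) \<noteq> 0" using that by (auto split: if_splits)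
      have cs: "0 < cos \<alpha>" "0 < sin \<alpha>" using a \<beta> by (auto intro!: cos_gt_zero sin_gt_zero)
      \<comment> \<open>The radius is at most the sum of the two coordinates.\<close>
      have "r * 1 \<le> r * (cos \<alpha> + sin \<alpha>)"
      proof (intro mult_left_mono)
        have "1 \<le> (cos \<alpha> + sin \<alpha>)\<^sup>2" using cs sin_cos_squared_add[of \<alpha>] by (simp add: power2_sum)
        then show "1 \<le> cos \<alpha> + sin \<alpha>" using cs by (auto intro: power2_le_imp_le)
      qed (use a in simp)
      also have "\<dots> \<le> 2 * R" using R[OF a(4)] by (simp add: distrib_left abs_le_iff)
      finally show ?thesis using a by simp
    qed
  qed simp_all
  have IM: "integrable ?M (\<lambda>x. ?w x * g (?\<phi> x))"
    using integrable_transfer[OF meas(1) meas2(1) meas(2) meas2(2) assms(1) pos H] IN by blast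
  have "(LINT \<theta>:{0<..<\<beta>}|lborel. cos \<theta> / sqrt ((sin \<beta>)\<^sup>2 - (sin \<theta>)\<^sup>2) *
            (LINT s:{0<..}|lborel. arc_integral g s (s * sin \<theta>) * (1 / s)))
      = (LINT \<theta>|lborel. LINT s|lborel. LINT \<phi>|lborel. ?w (\<theta>, s, \<phi>) * g (?\<phi> (\<theta>, s, \<phi>)))"
    unfolding set_lebesgue_integral_def[of _ "{0<..<\<beta>}"]
  proof (rule Bochner_Integration.integral_cong[OF refl])
    fix \<theta> :: real
    show "indicator {0<..<\<beta>} \<theta> *\<^sub>R (cos \<theta> / sqrt ((sin \<beta>)\<^sup>2 - (sin \<theta>)\<^sup>2) *
            (LINT s:{0<..}|lborel. arc_integral g s (s * sin \<theta>) * (1 / s)))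
      = (LINT s|lborel. LINT \<phi>|lborel. ?w (\<theta>, s, \<phi>) * g (?\<phi> (\<theta>, s, \<phi>)))"
    proof (cases "0 < \<theta> \<and> \<theta> < \<beta>")
      case True
      have "(LINT \<phi>|lborel. ?w (\<theta>, s, \<phi>) * g (?\<phi> (\<theta>, s, \<phi>)))
        = cos \<theta> / sqrt ((sin \<beta>)\<^sup>2 - (sin \<theta>)\<^sup>2) * (indicator {0<..} s *\<^sub>R (arc_integral g s (s * sin \<theta>) * (1 / s)))" for s
      proof (cases "0 < s")
        case s: True
        have "(LINT \<phi>|lborel. ?w (\<theta>, s, \<phi>) * g (?\<phi> (\<theta>, s, \<phi>)))
          = (LINT \<phi>|lborel. ?k \<theta> * (indicator {-pi/2<..<pi/2} \<phi> *\<^sub>R g (s + s * sin \<theta> * sin \<phi>, s * sin \<theta> * cos \<phi>)))"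
          using True s by (intro Bochner_Integration.integral_cong) auto
        also have "\<dots> = ?k \<theta> * (LINT \<phi>:{-pi/2<..<pi/2}|lborel. g (s + s * sin \<theta> * sin \<phi>, s * sin \<theta> * cos \<phi>))"
          unfolding set_lebesgue_integral_def by (rule integral_mult_right_zero)
        finally show ?thesis using s by (simp add: arc_integral_def)
      qed simp
      then have "(LINT s|lborel. LINT \<phi>|lborel. ?w (\<theta>, s, \<phi>) * g (?\<phi> (\<theta>, s, \<phi>)))
        = cos \<theta> / sqrt ((sin \<beta>)\<^sup>2 - (sin \<theta>)\<^sup>2) * (LINT s:{0<..}|lborel. arc_integral g s (s * sin \<theta>) * (1 / s))"
        unfolding set_lebesgue_integral_def by (simp only: integral_mult_right_zero)
      then show ?thesis using True by simp
    next
      case False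
      then show ?thesis by (cases "0 < \<theta>") simp_all
    qed
  qed
  also have "\<dots> = (LINT \<theta>|lborel. LINT x|?N. ?w (\<theta>, x) * g (?\<phi> (\<theta>, x)))"
  proof (rule integral_cong_AE)
    show "AE \<theta> in lborel. (LINT s|lborel. LINT \<phi>|lborel. ?w (\<theta>, s, \<phi>) * g (?\<phi> (\<theta>, s, \<phi>))) = (LINT x|?N. ?w (\<theta>, x) * g (?\<phi> (\<theta>, x)))"
      (is "AE \<theta> in _. ?AE \<theta>")
      using P.AE_integrable_fst'[OF IM]
    proof (rule eventually_mono)
      fix \<theta> assume "integrable ?N (\<lambda>x. ?w (\<theta>, x) * g (?\<phi> (\<theta>, x)))"
      then show "?AE \<theta>"
        by (rule lborel_pair.integral_fst')
    qed
  qed measurable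
  also have "\<dots> = (LINT x|?M. ?w x * g (?\<phi> x))" using IM by (rule P.integral_fst')
  also have "\<dots> = (LINT x|?N. ?v x * g (?\<psi> x))"
    by (rule integral_transfer[OF meas(1) meas2(1) meas(2) meas2(2) assms(1) pos H])
  also have "\<dots> = (LINT \<alpha>|lborel. LINT r|lborel. ?v (\<alpha>, r) * g (?\<psi> (\<alpha>, r)))"
    using IN by (rule lborel_pair.integral_fst'[symmetric])
  also have "\<dots> = (LINT \<alpha>|lborel. pi * (indicator {0<..<\<beta>} \<alpha> *\<^sub>R (LINT r:{0<..}|lborel. g (r * cos \<alpha>, r * sin \<alpha>))))"
    (is "integral\<^sup>L _ ?before = integral\<^sup>L _ ?after")
  proof (rule Bochner_Integration.integral_cong[OF refl])
    fix \<alpha> :: real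
    have "(LINT r|lborel. ?v (\<alpha>, r) * g (?\<psi> (\<alpha>, r))) = (LINT r|lborel. (pi * indicator {0<..<\<beta>} \<alpha>) * (indicator {0<..} r *\<^sub>R g (r * cos \<alpha>, r * sin \<alpha>)))"
      by (intro Bochner_Integration.integral_cong) (auto simp: indicator_def)
    also have "\<dots> = (pi * indicator {0<..<\<beta>} \<alpha>) * (LINT r:{0<..}|lborel. g (r * cos \<alpha>, r * sin \<alpha>))"
      unfolding set_lebesgue_integral_def by (rule integral_mult_right_zero)
    finally show "?before \<alpha> = ?after \<alpha>"
      by simp
  qed
  also have "\<dots> = pi * (LINT \<alpha>:{0<..<\<beta>}|lborel. LINT r:{0<..}|lborel. g (r * cos \<alpha>, r * sin \<alpha>))"
    unfolding set_lebesgue_integral_def[of _ "{0<..<\<beta>}"] by (rule integral_mult_right_zero)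
  finally show ?thesis .
qed

text \<open>
  By the preceding identity \<open>W\<close> differentiates the integral from \<open>0\<close> to \<open>\<beta>\<close> of the continuous
  function \<open>G\<close> of ray integrals.
\<close>

lemma W_op_wedge:
  fixes g :: "real \<times> real \<Rightarrow> real"
  assumes g: "continuous_on UNIV g" and \<beta>: "\<beta> \<in> {0<..<pi/2}"
    and C: "\<And>z. \<bar>g z\<bar> \<le> C" and R: "\<And>x y. g (x, y) \<noteq> 0 \<Longrightarrow> \<bar>x\<bar> \<le> R \<and> \<bar>y\<bar> \<le> R"
    and H: "\<And>\<theta>. \<theta> \<in> {0<..<pi/2} \<Longrightarrow> H \<theta> = (LINT s:{0<..}|lborel. arc_integral g s (s * sin \<theta>) * (1 / s))"
  shows "W_op H \<beta> = (LINT r:{0<..}|lborel. g (r * cos \<beta>, r * sin \<beta>))"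
proof -
  have [measurable]: "g \<in> borel_measurable borel" using g by (rule borel_measurable_continuous_onI)
  define G where "G \<alpha> = integral (cbox 0 (2 * R)) (\<lambda>r. g (r * cos \<alpha>, r * sin \<alpha>))" for \<alpha>
  have "continuous_on (UNIV \<times> cbox 0 (2 * R)) (\<lambda>(\<alpha>, r). g (r * cos \<alpha>, r * sin \<alpha>))"
    unfolding split_beta' by (intro continuous_on_compose2[OF g] continuous_intros) auto
  then have G: "continuous_on UNIV G" unfolding G_def by (rule integral_continuous_on_param)
  have ray: "(LINT r:{0<..}|lborel. g (r * cos \<alpha>, r * sin \<alpha>)) = G \<alpha>" for \<alpha>
  proof -
    have "(LINT r:{0<..}|lborel. g (r * cos \<alpha>, r * sin \<alpha>)) = (LINT r:{0<..<2 * R}|lborel. g (r * cos \<alpha>, r * sin \<alpha>))"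
      unfolding set_lebesgue_integral_def
    proof (rule integral_cong_AE)
      show "AE r in lborel. indicator {0<..} r *\<^sub>R g (r * cos \<alpha>, r * sin \<alpha>) = indicator {0<..<2 * R} r *\<^sub>R g (r * cos \<alpha>, r * sin \<alpha>)"
        (is "AE r in _. ?AE' r")
        using AE_lborel_singleton[of "2 * R"]
      proof (rule eventually_mono)
        fix r assume r: "r \<noteq> 2 * R"
        have "g (r * cos \<alpha>, r * sin \<alpha>) = 0" if "2 * R < r" "0 < r"
        proof (rule ccontr)
          assume "g (r * cos \<alpha>, r * sin \<alpha>) \<noteq> 0"
          then have "\<bar>r * cos \<alpha>\<bar> + \<bar>r * sin \<alpha>\<bar> \<le> 2 * R" using R[of "r * cos \<alpha>" "r * sin \<alpha>"] by simp
          moreover have "r * 1 \<le> r * (\<bar>cos \<alpha>\<bar> + \<bar>sin \<alpha>\<bar>)"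
          proof (rule mult_left_mono)
            have "\<bar>cos \<alpha>\<bar> * \<bar>cos \<alpha>\<bar> \<le> \<bar>cos \<alpha>\<bar> * 1" "\<bar>sin \<alpha>\<bar> * \<bar>sin \<alpha>\<bar> \<le> \<bar>sin \<alpha>\<bar> * 1"
              by (intro mult_left_mono; simp)+
            then show "1 \<le> \<bar>cos \<alpha>\<bar> + \<bar>sin \<alpha>\<bar>" using sin_cos_squared_add[of \<alpha>] by (simp add: power2_eq_square)
          qed (use that in simp)
          ultimately show False using that by (simp add: abs_mult distrib_left)
        qed
        then show "?AE' r"
          using r by (auto simp: indicator_def)
      qed
    qed (auto intro!: borel_measurable_scaleR measurable_compose[OF borel_measurable_Pair \<open>g \<in> borel_measurable borel\<close>])
    also have "\<dots> = integral {0..2 * R} (\<lambda>r. g (r * cos \<alpha>, r * sin \<alpha>))"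
      by (intro set_integral_open_interval continuous_on_compose2[OF g] continuous_intros) auto
    finally show ?thesis by (simp add: G_def)
  qed
  define E where "E = (\<lambda>\<beta>. LINT \<theta>:{0<..<\<beta>}|lborel. cos \<theta> / sqrt ((sin \<beta>)\<^sup>2 - (sin \<theta>)\<^sup>2) * H \<theta>)"
  have E: "E b = pi * integral {0..b} G" if "b \<in> {0<..<pi/2}" for b
  proof -
    have "E b = (LINT \<theta>:{0<..<b}|lborel. cos \<theta> / sqrt ((sin b)\<^sup>2 - (sin \<theta>)\<^sup>2) *
            (LINT s:{0<..}|lborel. arc_integral g s (s * sin \<theta>) * (1 / s)))"
      unfolding E_def using that by (intro set_lebesgue_integral_cong) (auto simp: H)
    also have "\<dots> = pi * (LINT \<alpha>:{0<..<b}|lborel. LINT r:{0<..}|lborel. g (r * cos \<alpha>, r * sin \<alpha>))"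
      using that by (intro integral_wedge[where C = C and R = R] C R) auto
    also have "\<dots> = pi * integral {0..b} G"
      unfolding ray using G by (subst set_integral_open_interval) (auto intro: continuous_on_subset)
    finally show ?thesis .
  qed
  have "((\<lambda>b. pi * integral {0..b} G) has_real_derivative pi * G \<beta>) (at \<beta>)"
    using \<beta> by (intro DERIV_cmult has_real_derivative_integral G) auto
  then have "(E has_real_derivative pi * G \<beta>) (at \<beta>)"
    by (rule has_field_derivative_transform_within_open[where S = "{0<..<pi/2}"]) (use \<beta> in \<open>auto simp: E\<close>)
  then have "deriv E \<beta> = pi * G \<beta>" by (rule DERIV_imp_deriv)
  moreover have "W_op H \<beta> = 1 / pi * deriv E \<beta>" unfolding W_op_def E_def ..
  ultimately show ?thesis by (simp add: ray)
qed

section \<open>Vertical and slanted planes\<close>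

text \<open>
  The left quarter of a circle, first as a graph over the horizontal and then as a graph over the
  vertical axis.
\<close>

lemma integral_left_arc:
  fixes \<Phi> :: "real \<times> real \<Rightarrow> real"
  assumes [measurable]: "\<Phi> \<in> borel_measurable borel" and q: "0 < q"
  shows "(LINT a|lborel. (if - q < a \<and> a < 0 then q / sqrt (q\<^sup>2 - a\<^sup>2) else 0) * \<Phi> (a, sqrt (q\<^sup>2 - a\<^sup>2)))
       = (LINT h|lborel. (if 0 < h \<and> h < q then q / sqrt (q\<^sup>2 - h\<^sup>2) else 0) * \<Phi> (- sqrt (q\<^sup>2 - h\<^sup>2), h))"
proof (rule integral_transfer[where g = \<Phi> and \<phi> = "\<lambda>a. (a, sqrt (q\<^sup>2 - a\<^sup>2))" and \<psi> = "\<lambda>h. (- sqrt (q\<^sup>2 - h\<^sup>2), h)"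
      and w = "\<lambda>a. if - q < a \<and> a < 0 then q / sqrt (q\<^sup>2 - a\<^sup>2) else 0" and v = "\<lambda>h. if 0 < h \<and> h < q then q / sqrt (q\<^sup>2 - h\<^sup>2) else 0"])
  show "0 \<le> (if - q < a \<and> a < 0 then q / sqrt (q\<^sup>2 - a\<^sup>2) else 0)" for a
  proof (cases "- q < a \<and> a < 0")
    case True
    then have "\<bar>a\<bar>\<^sup>2 \<le> q\<^sup>2" by (intro power_mono) auto
    then show ?thesis using q by simp
  qed (simp only: if_False order_refl)
  show "0 \<le> (if 0 < h \<and> h < q then q / sqrt (q\<^sup>2 - h\<^sup>2) else 0)" for h
    using q by (auto simp: power_mono)
  fix H :: "real \<times> real \<Rightarrow> ennreal" assume H: "H \<in> borel_measurable borel"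
  have [measurable]: "H \<in> borel_measurable (borel \<Otimes>\<^sub>M borel)" using H by (simp add: borel_prod)
  have split: "ennreal (q / sqrt (q\<^sup>2 - a\<^sup>2)) * X = ennreal q * X * ennreal (1 / sqrt (q\<^sup>2 - a\<^sup>2))"
    if "0 < a" "a < q" for a X
  proof -
    have "ennreal q * ennreal (1 / sqrt (q\<^sup>2 - a\<^sup>2)) = ennreal (q / sqrt (q\<^sup>2 - a\<^sup>2))"
      using that by (subst ennreal_mult[symmetric]) (auto simp: power_mono)
    then show ?thesis by (simp add: ennreal_mult_swap)
  qed
  let ?F = "\<lambda>a. ennreal (if - q < a \<and> a < 0 then q / sqrt (q\<^sup>2 - a\<^sup>2) else 0) * H (a, sqrt (q\<^sup>2 - a\<^sup>2))"
  have "(\<integral>\<^sup>+a. ?F a \<partial>lborel) = ennreal \<bar>- 1\<bar> * (\<integral>\<^sup>+a. ?F (0 + (- 1) * a) \<partial>lborel)"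
  proof (rule nn_integral_real_affine)
    show "?F \<in> borel_measurable borel" by measurable
  qed simp
  also have "\<dots> = (\<integral>\<^sup>+a. ?F (- a) \<partial>lborel)"
  proof -
    have "0 + (- 1) * a = - a" for a :: real by simp
    then show ?thesis by (simp only: abs_minus_cancel abs_one ennreal_1 mult_1)
  qed
  also have "\<dots> = (\<integral>\<^sup>+a. ennreal q * H (- a, sqrt (q\<^sup>2 - a\<^sup>2)) * ennreal (1 / sqrt (q\<^sup>2 - a\<^sup>2)) * indicator {0<..<q} a \<partial>lborel)"
    (is "integral\<^sup>N _ ?before = integral\<^sup>N _ ?after")
  proof (rule nn_integral_cong)
    fix a
    show "?before a = ?after a"
      using split[of a "H (- a, sqrt (q\<^sup>2 - a\<^sup>2))"] by (cases "0 < a \<and> a < q") auto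
  qed
  also have "\<dots> = (\<integral>\<^sup>+h. ennreal q * H (- sqrt (q\<^sup>2 - h\<^sup>2), h) * ennreal (1 / sqrt (q\<^sup>2 - h\<^sup>2)) * indicator {0<..<q} h \<partial>lborel)"
    by (rule nn_integral_half_circle[where \<Phi> = "\<lambda>a h. ennreal q * H (- a, h)"]) measurable
  also have "\<dots> = (\<integral>\<^sup>+h. ennreal (if 0 < h \<and> h < q then q / sqrt (q\<^sup>2 - h\<^sup>2) else 0) * H (- sqrt (q\<^sup>2 - h\<^sup>2), h) \<partial>lborel)"
    (is "integral\<^sup>N _ ?before = integral\<^sup>N _ ?after")
  proof (rule nn_integral_cong)
    fix h
    show "?before h = ?after h"
      using split[of h "H (- sqrt (q\<^sup>2 - h\<^sup>2), h)"] by (cases "0 < h \<and> h < q") auto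
  qed
  finally show "(\<integral>\<^sup>+a. ?F a \<partial>lborel) = \<dots>" .
qed (auto intro!: borel_measurable_Pair)

text \<open>
  The leftmost part of a circle with centre \<open>s\<close> and radius \<open>s - p\<close>, at squared distance \<open>c\<close> from
  the axis through its centre: the abscissa tends to \<open>p\<close>, and the ratio of the arc length element to
  the element of height tends to \<open>1\<close>.
\<close>

lemma tendsto_tangent_plane:
  fixes p c :: real
  assumes c: "0 \<le> c"
  shows "((\<lambda>s. s - sqrt ((s - p)\<^sup>2 - c)) \<longlongrightarrow> p) at_top"
    and "((\<lambda>s. (s - p) / sqrt ((s - p)\<^sup>2 - c)) \<longlongrightarrow> 1) at_top"
proof -
  have y: "filterlim (\<lambda>s. s - p) at_top at_top"
    using filterlim_tendsto_add_at_top[OF tendsto_const[of "- p"] filterlim_ident] by simp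
  have ev: "\<forall>\<^sub>F s in at_top. 1 + c < s - p" using filterlim_at_top_dense[THEN iffD1, OF y] by blast
  have big: "c < y\<^sup>2" "0 < y" if "1 + c < y" for y :: real
  proof -
    show "0 < y" using that c by simp
    have "c * 1 < y * y" using that c by (intro mult_strict_mono) auto
    then show "c < y\<^sup>2" by (simp add: power2_eq_square)
  qed
  have "filterlim (\<lambda>s. (s - p) + sqrt ((s - p)\<^sup>2 - c)) at_top at_top"
  proof (rule filterlim_at_top_mono[OF y])
    show "\<forall>\<^sub>F s in at_top. s - p \<le> (s - p) + sqrt ((s - p)\<^sup>2 - c)"
      using ev by (rule eventually_mono) (use big in \<open>auto simp: less_imp_le\<close>)
  qed
  then have "((\<lambda>s. c / ((s - p) + sqrt ((s - p)\<^sup>2 - c))) \<longlongrightarrow> 0) at_top"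
    by (intro tendsto_divide_0[OF tendsto_const] filterlim_at_top_imp_at_infinity)
  from tendsto_add[OF tendsto_const[of p] this]
  have "((\<lambda>s. p + c / ((s - p) + sqrt ((s - p)\<^sup>2 - c))) \<longlongrightarrow> p) at_top" by simp
  moreover have "\<forall>\<^sub>F s in at_top. p + c / ((s - p) + sqrt ((s - p)\<^sup>2 - c)) = s - sqrt ((s - p)\<^sup>2 - c)"
    using ev
  proof (rule eventually_mono)
    fix s assume "1 + c < s - p"
    note b = big[OF this]
    let ?r = "sqrt ((s - p)\<^sup>2 - c)"
    have "?r * ?r = (s - p) * (s - p) - c" using b by (simp add: power2_eq_square)
    then have "c = ((s - p) - ?r) * ((s - p) + ?r)" by (simp add: algebra_simps)
    moreover have "0 < (s - p) + ?r" using b by (intro add_pos_nonneg) auto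
    ultimately have "c / ((s - p) + ?r) = (s - p) - ?r" by (metis less_irrefl nonzero_mult_div_cancel_right)
    then show "p + c / ((s - p) + ?r) = s - ?r" by simp
  qed
  ultimately show "((\<lambda>s. s - sqrt ((s - p)\<^sup>2 - c)) \<longlongrightarrow> p) at_top"
    by (rule Lim_transform_eventually)
  have "filterlim (\<lambda>s. (s - p)\<^sup>2) at_top at_top" using y by (intro filterlim_pow_at_top) auto
  then have "((\<lambda>s. c / (s - p)\<^sup>2) \<longlongrightarrow> 0) at_top"
    by (intro tendsto_divide_0[OF tendsto_const] filterlim_at_top_imp_at_infinity)
  then have "((\<lambda>s. 1 / sqrt (1 - c / (s - p)\<^sup>2)) \<longlongrightarrow> 1 / sqrt (1 - 0)) at_top"
    by (intro tendsto_intros) auto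
  then have "((\<lambda>s. 1 / sqrt (1 - c / (s - p)\<^sup>2)) \<longlongrightarrow> 1) at_top" by simp
  moreover have "\<forall>\<^sub>F s in at_top. 1 / sqrt (1 - c / (s - p)\<^sup>2) = (s - p) / sqrt ((s - p)\<^sup>2 - c)"
    using ev
  proof (rule eventually_mono)
    fix s assume "1 + c < s - p"
    note b = big[OF this]
    have "(s - p)\<^sup>2 - c = (s - p)\<^sup>2 * (1 - c / (s - p)\<^sup>2)" using b by (simp add: right_diff_distrib)
    then have "sqrt ((s - p)\<^sup>2 - c) = (s - p) * sqrt (1 - c / (s - p)\<^sup>2)" using b by (simp add: real_sqrt_mult)
    then show "1 / sqrt (1 - c / (s - p)\<^sup>2) = (s - p) / sqrt ((s - p)\<^sup>2 - c)" using b by simp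
  qed
  ultimately show "((\<lambda>s. (s - p) / sqrt ((s - p)\<^sup>2 - c)) \<longlongrightarrow> 1) at_top"
    by (rule Lim_transform_eventually)
qed

lemma horizontal_frame_through:
  fixes e \<omega> :: "'a::euclidean_space"
  assumes \<omega>: "\<omega> \<in> horizontal_sphere e"
  obtains B where "orthonormal (insert \<omega> B)" "\<omega> \<notin> B" "span (insert \<omega> B) = centerset e"
    "span B = {u \<in> centerset e. \<omega> \<bullet> u = 0}"
proof -
  have w: "\<omega> \<bullet> e = 0" "norm \<omega> = 1" "\<omega> \<bullet> \<omega> = 1"
    using \<omega> by (auto simp: horizontal_sphere_def centerset_def norm_eq_1)
  let ?U = "{u \<in> centerset e. \<omega> \<bullet> u = 0}"
  have "subspace ?U" unfolding subspace_def centerset_def by (auto simp: inner_add_left inner_add_right)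
  then obtain B where "orthonormal_basis_of ?U B" using ex_orthonormal_basis_of by blast
  then have B: "B \<subseteq> ?U" "pairwise orthogonal B" "\<And>b. b \<in> B \<Longrightarrow> norm b = 1" "span B = ?U"
    by (auto simp: orthonormal_basis_of_def)
  have "orthonormal (insert \<omega> B)"
    using B w unfolding orthonormal_def pairwise_insert by (auto simp: orthogonal_def inner_commute)
  moreover have "\<omega> \<notin> B" using B(1) w by auto
  moreover have "span (insert \<omega> B) = centerset e"
  proof (intro equalityI subsetI)
    fix x assume "x \<in> span (insert \<omega> B)"
    then obtain k where "x - k *\<^sub>R \<omega> \<in> ?U" unfolding span_insert B(4)[symmetric] by blast
    then show "x \<in> centerset e" using w by (simp add: centerset_def inner_diff_left)
  next
    fix x assume "x \<in> centerset e"
    then have "x - (\<omega> \<bullet> x) *\<^sub>R \<omega> \<in> span B" using w by (simp add: B(4) centerset_def inner_diff_left inner_diff_right)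
    then show "x \<in> span (insert \<omega> B)" unfolding span_insert by blast
  qed
  ultimately show thesis using B(4) that by blast
qed

text \<open>
  A direction \<open>\<omega>\<close> together with a basis \<open>B\<close> of the vectors of the centerset that are orthogonal
  to it.
\<close>

locale half_space_direction = half_space_function e f M R \<delta>
  for e :: "'a::euclidean_space" and f M R \<delta> +
  fixes \<omega> and B
  assumes frame: "orthonormal (insert \<omega> B)" "\<omega> \<notin> B" "span (insert \<omega> B) = centerset e"
    and span_B: "span B = {u \<in> centerset e. \<omega> \<bullet> u = 0}"
begin

lemma orthonormal_B: "orthonormal B" using frame(1) by (rule orthonormal_subset) auto

lemma \<omega>_simps: "norm \<omega> = 1" "\<omega> \<bullet> \<omega> = 1" "\<omega> \<bullet> e = 0" "e \<bullet> \<omega> = 0"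
proof -
  show 1: "norm \<omega> = 1" using frame(1) by (simp add: orthonormal_def)
  then show "\<omega> \<bullet> \<omega> = 1" by (simp add: norm_eq_1)
  have "\<omega> \<in> centerset e" unfolding frame(3)[symmetric] by (simp add: span_base)
  then show "\<omega> \<bullet> e = 0" "e \<bullet> \<omega> = 0" by (simp_all add: centerset_def inner_commute)
qed

lemma span_B_simps:
  assumes "u \<in> span B"
  shows "u \<bullet> e = 0" "u \<bullet> \<omega> = 0"
  using assms by (auto simp: span_B centerset_def inner_commute)

lemma card_B: "real (card B) = real DIM('a) - 2"
proof -
  have "card (insert \<omega> B) = card (Basis - {e})"
    using frame horizontal_frame by (intro orthonormal_card_eq) auto
  moreover have "finite B" by (rule orthonormal_finite[OF orthonormal_B])
  ultimately have "Suc (card B) = DIM('a) - 1" using frame(2) horizontal_frame(3) by simp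
  then show ?thesis by simp
qed

lemma centerset_radon_eq:
  "centerset_radon e g \<omega> x h = (LINT u|frame_measure B. g (x *\<^sub>R \<omega> + h *\<^sub>R e + u))"
  unfolding centerset_radon_def subspace_measure_eq[OF orthonormal_B span_B] by (simp add: add_ac)

text \<open>
  The sphere is sliced by its intersections with the planes \<open>v + span {\<omega>, e}\<close>, \<open>v\<close> orthogonal to both.
  Each slice is a half-circle with centre \<open>w + v\<close>, of radius \<open>sqrt (y\<^sup>2 - |v|\<^sup>2)\<close>.
\<close>

lemma integral_sphere_slices:
  fixes \<Psi> :: "'a \<Rightarrow> real"
  assumes \<Psi>: "continuous_on UNIV \<Psi>" "\<And>z. z \<bullet> e < \<delta> \<Longrightarrow> \<Psi> z = 0" and w: "w \<bullet> e = 0" and y: "0 < y"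
  shows "(LINT t|frame_measure (insert \<omega> B). sphere_density y (norm t) * \<Psi> (w + t + sqrt (y\<^sup>2 - (norm t)\<^sup>2) *\<^sub>R e))
    = (LINT v|frame_measure B. sphere_density y (norm v) * (LINT a|lborel. sphere_density (sqrt (y\<^sup>2 - (norm v)\<^sup>2)) \<bar>a\<bar> *
         \<Psi> (w + a *\<^sub>R \<omega> + v + sqrt (y\<^sup>2 - (norm v)\<^sup>2 - a\<^sup>2) *\<^sub>R e)))"
proof -
  have [measurable]: "\<Psi> \<in> borel_measurable borel" using \<Psi>(1) by (rule borel_measurable_continuous_onI)
  let ?P = "\<lambda>t. \<Psi> (w + t + sqrt (y\<^sup>2 - (norm t)\<^sup>2) *\<^sub>R e)"
  let ?X = "\<lambda>t. clipped_density y (norm t) * ?P t"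
  have "compact (?P ` cball 0 y)"
    by (intro compact_continuous_image continuous_on_compose2[OF \<Psi>(1)] continuous_intros) auto
  then have "bounded (?P ` cball 0 y)" by (rule compact_imp_bounded)
  then obtain D where "\<forall>x\<in>?P ` cball 0 y. norm x \<le> D" by (auto simp only: bounded_iff)
  then have D: "\<bar>?P t\<bar> \<le> D" if "norm t \<le> y" for t using that by simp
  have D0: "0 \<le> D" using D[of 0] y by (metis abs_ge_zero less_imp_le norm_zero order_trans)
  have "(LINT t|frame_measure (insert \<omega> B). sphere_density y (norm t) * ?P t) = (LINT t|frame_measure (insert \<omega> B). ?X t)"
    by (intro integral_cong_AE AE_clipped_density[OF frame(3) \<Psi>(2) w]) simp_all
  also have "\<dots> = (LINT v|frame_measure B. LINT a|lborel. ?X (a *\<^sub>R \<omega> + v))"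
  proof (rule integral_frame_measure_insert[OF frame(1,2)])
    show "?X \<in> borel_measurable borel" by measurable
    show "\<bar>?X t\<bar> \<le> y / \<delta> * D" for t
    proof (cases "norm t \<le> y")
      case True
      then show ?thesis unfolding abs_mult using clipped_density_bound[OF y] D y \<delta>
        by (intro mult_mono) auto
    next
      case False
      then have "clipped_density y (norm t) = 0" using clipped_density_support[of y "norm t"] by linarith
      then show ?thesis using D0 y \<delta> by simp
    qed
    show "norm t \<le> y" if "?X t \<noteq> 0" for t using that clipped_density_support[of y "norm t"] by auto
  qed
  also have "\<dots> = (LINT v|frame_measure B. sphere_density y (norm v) * (LINT a|lborel. sphere_density (sqrt (y\<^sup>2 - (norm v)\<^sup>2)) \<bar>a\<bar> *
         \<Psi> (w + a *\<^sub>R \<omega> + v + sqrt (y\<^sup>2 - (norm v)\<^sup>2 - a\<^sup>2) *\<^sub>R e)))"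
  proof (rule integral_cong_AE)
    show "AE v in frame_measure B. (LINT a|lborel. ?X (a *\<^sub>R \<omega> + v)) = sphere_density y (norm v) * (LINT a|lborel. sphere_density (sqrt (y\<^sup>2 - (norm v)\<^sup>2)) \<bar>a\<bar> *
         \<Psi> (w + a *\<^sub>R \<omega> + v + sqrt (y\<^sup>2 - (norm v)\<^sup>2 - a\<^sup>2) *\<^sub>R e))"
           (is "AE v in _. ?AE v")
      using AE_frame_measure_span[of B]
    proof (rule eventually_mono)
      fix v assume v: "v \<in> span B"
      have "?X (a *\<^sub>R \<omega> + v) = sphere_density y (norm v) * (sphere_density (sqrt (y\<^sup>2 - (norm v)\<^sup>2)) \<bar>a\<bar> *
         \<Psi> (w + a *\<^sub>R \<omega> + v + sqrt (y\<^sup>2 - (norm v)\<^sup>2 - a\<^sup>2) *\<^sub>R e))" for a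
      proof -
        have n: "(norm (a *\<^sub>R \<omega> + v))\<^sup>2 = (norm v)\<^sup>2 + \<bar>a\<bar>\<^sup>2"
          using orthonormal_norm_sq[OF frame(1,2) v, of a] by simp
        then have n': "norm (a *\<^sub>R \<omega> + v) = sqrt ((norm v)\<^sup>2 + \<bar>a\<bar>\<^sup>2)" by (metis norm_ge_zero real_sqrt_unique)
        have "(a *\<^sub>R \<omega> + v) \<bullet> e = 0" using \<omega>_simps span_B_simps[OF v] by (simp add: inner_add_left)
        with \<Psi>(2) w have X: "sphere_density y (norm (a *\<^sub>R \<omega> + v)) * ?P (a *\<^sub>R \<omega> + v) = ?X (a *\<^sub>R \<omega> + v)"
          by (rule clipped_density_eq)
        have P: "?P (a *\<^sub>R \<omega> + v) = \<Psi> (w + a *\<^sub>R \<omega> + v + sqrt (y\<^sup>2 - (norm v)\<^sup>2 - a\<^sup>2) *\<^sub>R e)"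
          unfolding n by (simp add: add_ac diff_diff_eq)
        have S: "sphere_density y (norm (a *\<^sub>R \<omega> + v)) = sphere_density y (norm v) * sphere_density (sqrt (y\<^sup>2 - (norm v)\<^sup>2)) \<bar>a\<bar>"
        proof (cases "norm v < y")
          case True
          then show ?thesis unfolding n' using sphere_density_slice[OF y, of "norm v" "\<bar>a\<bar>"] by simp
        next
          case False
          have "norm v \<le> sqrt ((norm v)\<^sup>2 + \<bar>a\<bar>\<^sup>2)" by (intro real_le_rsqrt) simp
          then have "\<not> sqrt ((norm v)\<^sup>2 + \<bar>a\<bar>\<^sup>2) < y" using False by linarith
          then show ?thesis using False unfolding n' by (simp only: sphere_density_def if_False mult_zero_left)
        qed
        show ?thesis by (rule trans[OF X[symmetric]]) (simp only: P S mult.assoc)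
      qed
      then show "?AE v"
        by (simp only: integral_mult_right_zero)
    qed
  qed measurable
  finally show ?thesis .
qed

text \<open>
  The function \<open>f\<close> averaged over the directions orthogonal to \<open>\<omega>\<close> and \<open>e\<close>, as a function on the
  half-plane.
\<close>

definition profile :: "real \<times> real \<Rightarrow> real" where
  "profile z = subspace_average B (fst z *\<^sub>R \<omega> + snd z *\<^sub>R e)"

lemma profile_eq: "profile (x, h) = centerset_radon e f \<omega> x h"
  by (simp add: profile_def subspace_average_def centerset_radon_eq)

lemma continuous_profile: "continuous_on UNIV profile"
  unfolding profile_def
  by (intro continuous_on_compose2[OF continuous_subspace_average[OF orthonormal_B]] continuous_intros) auto

lemma profile_measurable[measurable]: "profile \<in> borel_measurable borel"
  using continuous_profile by (rule borel_measurable_continuous_onI)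

lemma profile_eq_0: "h < \<delta> \<Longrightarrow> profile (x, h) = 0"
  unfolding profile_def using span_B norm_e \<omega>_simps
  by (intro subspace_average_eq_0) (auto simp: inner_add_left)

lemma coordinates_le:
  assumes u: "u \<in> span B" and f: "f (x *\<^sub>R \<omega> + h *\<^sub>R e + u) \<noteq> 0"
  shows "\<bar>x\<bar> \<le> R" "\<bar>h\<bar> \<le> R" "norm u \<le> R"
proof -
  let ?z = "x *\<^sub>R \<omega> + h *\<^sub>R e + u"
  have z: "norm ?z \<le> R" using f by (rule supp_norm)
  have "\<bar>?z \<bullet> \<omega>\<bar> \<le> norm ?z * norm \<omega>" by (rule Cauchy_Schwarz_ineq2)
  then show "\<bar>x\<bar> \<le> R" using z \<omega>_simps span_B_simps[OF u] by (simp add: inner_add_left)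
  have "\<bar>?z \<bullet> e\<bar> \<le> norm ?z * norm e" by (rule Cauchy_Schwarz_ineq2)
  then show "\<bar>h\<bar> \<le> R" using z \<omega>_simps span_B_simps[OF u] norm_e by (simp add: inner_add_left)
  have "\<bar>?z \<bullet> u\<bar> \<le> norm ?z * norm u" by (rule Cauchy_Schwarz_ineq2)
  moreover have "?z \<bullet> u = norm u * norm u" using span_B_simps[OF u]
    by (simp add: inner_add_left inner_commute[of \<omega> u] inner_commute[of e u] dot_square_norm power2_eq_square)
  ultimately have "norm u * norm u \<le> R * norm u"
    using z mult_right_mono[OF z norm_ge_zero[of u]] by simp
  then show "norm u \<le> R" using R by (cases "norm u = 0") auto
qed

lemma profile_support:
  assumes "profile (x, h) \<noteq> 0"
  shows "\<bar>x\<bar> \<le> R \<and> \<bar>h\<bar> \<le> R"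
proof (rule ccontr)
  assume *: "\<not> (\<bar>x\<bar> \<le> R \<and> \<bar>h\<bar> \<le> R)"
  have "AE u in frame_measure B. f (x *\<^sub>R \<omega> + h *\<^sub>R e + u) = 0"
    using AE_frame_measure_span[of B] by (rule eventually_mono) (use * coordinates_le in blast)
  then have "profile (x, h) = 0"
    by (simp add: profile_def subspace_average_def integral_eq_zero_AE)
  with assms show False ..
qed

lemma profile_bounded: obtains C where "\<And>z. \<bar>profile z\<bar> \<le> C"
proof -
  have "compact (profile ` (cbox (-R) R \<times> cbox (-R) R))"
    by (intro compact_continuous_image compact_Times compact_cbox continuous_on_subset[OF continuous_profile]) simp
  then have "bounded (profile ` (cbox (-R) R \<times> cbox (-R) R))" by (rule compact_imp_bounded)
  then obtain C where C: "\<And>z. z \<in> cbox (-R) R \<times> cbox (-R) R \<Longrightarrow> \<bar>profile z\<bar> \<le> C"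
    by (metis bounded_iff image_eqI real_norm_def)
  have "0 \<le> C" using C[of "(0, 0)"] R by (auto intro: order_trans[OF abs_ge_zero])
  then have "\<bar>profile z\<bar> \<le> C" for z
    using C[of z] profile_support[of "fst z" "snd z"]
    by (cases "profile z = 0") (auto simp: mem_Times_iff abs_le_iff)
  then show thesis by (rule that)
qed

text \<open>
  After averaging, the slices of the sphere are half-circles with the common centre \<open>(p, 0)\<close>, and
  their radii are distributed like the heights of the half-sphere of radius \<open>y\<close> over an
  \<open>(n - 2)\<close>-dimensional equatorial ball.
\<close>

lemma centerset_radon_sonar:
  assumes y: "0 < y"
  shows "centerset_radon e (sonar e f) \<omega> p y = frac_int ((real DIM('a) - 2) / 2) (arc_integral profile p) y"
proof -
  let ?q = "\<lambda>v. sqrt (y\<^sup>2 - (norm v)\<^sup>2)"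
  have [measurable]: "arc_integral profile p \<in> borel_measurable borel"
    using continuous_arc_integral[OF continuous_profile] by (rule borel_measurable_continuous_onI)
  note [measurable] = subspace_average_measurable[OF orthonormal_B]
  have span_B': "span B \<subseteq> centerset e" by (auto simp: span_B)
  have z: "(p *\<^sub>R \<omega> + y *\<^sub>R e) \<bullet> e = y" "(p *\<^sub>R \<omega>) \<bullet> e = 0" using \<omega>_simps norm_e by (simp_all add: inner_add_left)
  have "centerset_radon e (sonar e f) \<omega> p y = (LINT t|frame_measure (insert \<omega> B).
      sphere_density y (norm t) * subspace_average B (p *\<^sub>R \<omega> + t + sqrt (y\<^sup>2 - (norm t)\<^sup>2) *\<^sub>R e))"
    unfolding centerset_radon_eq integral_sonar_subspace[OF orthonormal_B span_B' frame(1,3) z(1) y] by simp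
  also have "\<dots> = (LINT v|frame_measure B. sphere_density y (norm v) * (LINT a|lborel. sphere_density (?q v) \<bar>a\<bar> *
         subspace_average B (p *\<^sub>R \<omega> + a *\<^sub>R \<omega> + v + sqrt (y\<^sup>2 - (norm v)\<^sup>2 - a\<^sup>2) *\<^sub>R e)))"
    by (intro integral_sphere_slices continuous_subspace_average orthonormal_B subspace_average_eq_0 span_B' z y)
  also have "\<dots> = (LINT v|frame_measure B. sphere_density y (norm v) * arc_integral profile p (?q v))"
  proof (rule integral_cong_AE)
    show "AE v in frame_measure B. sphere_density y (norm v) * (LINT a|lborel. sphere_density (?q v) \<bar>a\<bar> *
         subspace_average B (p *\<^sub>R \<omega> + a *\<^sub>R \<omega> + v + sqrt (y\<^sup>2 - (norm v)\<^sup>2 - a\<^sup>2) *\<^sub>R e))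
       = sphere_density y (norm v) * arc_integral profile p (?q v)" (is "AE v in _. ?AE v")
      using AE_frame_measure_span[of B]
    proof (rule eventually_mono)
      fix v assume v: "v \<in> span B"
      show "?AE v"
      proof (cases "norm v < y")
        case True
        then have "0 < y\<^sup>2 - (norm v)\<^sup>2" by (simp add: power_strict_mono)
        then have q: "0 < ?q v" "(?q v)\<^sup>2 = y\<^sup>2 - (norm v)\<^sup>2" by auto
        have "subspace_average B (p *\<^sub>R \<omega> + a *\<^sub>R \<omega> + v + sqrt (y\<^sup>2 - (norm v)\<^sup>2 - a\<^sup>2) *\<^sub>R e)
            = profile (p + a, sqrt ((?q v)\<^sup>2 - a\<^sup>2))" for a
          using subspace_average_translate[OF orthonormal_B v, of "p *\<^sub>R \<omega> + a *\<^sub>R \<omega> + sqrt (y\<^sup>2 - (norm v)\<^sup>2 - a\<^sup>2) *\<^sub>R e"]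
          unfolding q(2) profile_def by (simp add: scaleR_add_left add_ac)
        then show ?thesis using integral_arc[OF profile_measurable q(1), of p] by simp
      qed (simp add: sphere_density_def)
    qed
  qed measurable
  also have "\<dots> = frac_int (real (card B) / 2) (arc_integral profile p) y"
    by (rule integral_sphere_density[OF orthonormal_B y]) measurable
  finally show ?thesis by (simp add: card_B)
qed

theorem radon_s_eq:
  assumes dim: "2 \<le> DIM('a)" and \<beta>: "\<beta> \<in> {0<..<pi/2}"
  shows "radon_s e f \<omega> p \<beta> = W_op (weighted_radon (\<lambda>s. 1 / s)
          (\<lambda>\<omega> p. frac_deriv ((real DIM('a) - 2) / 2) (centerset_radon e (sonar e f) \<omega> p)) \<omega> p) \<beta>"
proof -
  define g where "g z = profile (p + fst z, snd z)" for z
  have g: "continuous_on UNIV g" unfolding g_def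
    by (intro continuous_on_compose2[OF continuous_profile] continuous_intros) auto
  obtain C where C: "\<And>z. \<bar>profile z\<bar> \<le> C" using profile_bounded by blast
  have fd: "frac_deriv ((real DIM('a) - 2) / 2) (centerset_radon e (sonar e f) \<omega> x) y = arc_integral profile x y"
    if y: "0 < y" for x y
  proof (rule frac_deriv_frac_int[where \<delta> = "\<delta> / 2"])
    show "arc_integral profile x s = 0" if "s \<le> \<delta> / 2" for s
      using that \<delta> by (intro arc_integral_eq_0[where \<delta> = \<delta>] profile_eq_0) auto
  qed (use dim \<delta> y in \<open>auto simp: centerset_radon_sonar intro!: continuous_arc_integral continuous_profile\<close>)
  have "W_op (weighted_radon (\<lambda>s. 1 / s)
          (\<lambda>\<omega> p. frac_deriv ((real DIM('a) - 2) / 2) (centerset_radon e (sonar e f) \<omega> p)) \<omega> p) \<beta>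
      = (LINT r:{0<..}|lborel. g (r * cos \<beta>, r * sin \<beta>))"
  proof (rule W_op_wedge[OF g \<beta>, where C = C and R = "R + \<bar>p\<bar>"])
    show "\<bar>g z\<bar> \<le> C" for z by (simp add: g_def C)
    show "\<bar>x\<bar> \<le> R + \<bar>p\<bar> \<and> \<bar>y\<bar> \<le> R + \<bar>p\<bar>" if "g (x, y) \<noteq> 0" for x y
      using profile_support[of "p + x" y] that by (auto simp: g_def)
    fix \<theta> :: real assume \<theta>: "\<theta> \<in> {0<..<pi/2}"
    then have sin: "0 < sin \<theta>" by (intro sin_gt_zero) auto
    have arc: "arc_integral profile (p + s) q = arc_integral g s q" for s q
      by (simp add: arc_integral_def g_def add.assoc)
    show "weighted_radon (\<lambda>s. 1 / s)
          (\<lambda>\<omega> p. frac_deriv ((real DIM('a) - 2) / 2) (centerset_radon e (sonar e f) \<omega> p)) \<omega> p \<theta>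
       = (LINT s:{0<..}|lborel. arc_integral g s (s * sin \<theta>) * (1 / s))"
      unfolding weighted_radon_def
      by (intro set_lebesgue_integral_cong) (use sin in \<open>auto simp: fd arc\<close>)
  qed
  also have "\<dots> = radon_s e f \<omega> p \<beta>" by (simp add: radon_s_def g_def profile_eq)
  finally show ?thesis ..
qed

text \<open>
  The part of the sphere with centre \<open>s * \<omega>\<close> and radius \<open>s - p\<close> that is close to the plane
  \<open>\<omega> \<bullet> x = p\<close>, as a graph over that plane with coordinates \<open>(v, h)\<close>: the value of \<open>f\<close> on it, times
  the area element.
\<close>

definition shell :: "real \<Rightarrow> real \<Rightarrow> 'a \<Rightarrow> real \<Rightarrow> real" where
  "shell p s v h = (if norm v < s - p \<and> 0 < h \<and> (norm v)\<^sup>2 + h\<^sup>2 < (s - p)\<^sup>2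
     then (s - p) / sqrt ((s - p)\<^sup>2 - ((norm v)\<^sup>2 + h\<^sup>2)) *
       f ((s - sqrt ((s - p)\<^sup>2 - ((norm v)\<^sup>2 + h\<^sup>2))) *\<^sub>R \<omega> + h *\<^sub>R e + v) else 0)"

lemma shell_measurable[measurable]:
  assumes [measurable]: "a \<in> borel_measurable N" "b \<in> borel_measurable N"
  shows "(\<lambda>x. shell p s (a x) (b x)) \<in> borel_measurable N"
  unfolding shell_def by measurable

text \<open>
  For \<open>s > R\<close> the far half of the sphere lies outside the support of \<open>f\<close>.  On the near half,
  \<open>integral_left_arc\<close> changes the graph over the centerset to a graph over the plane.
\<close>

lemma sonar_eq_shell:
  assumes s: "R < s" "p < s"
  shows "sonar e f (s *\<^sub>R \<omega> + \<bar>p - s\<bar> *\<^sub>R e) = (LINT v|frame_measure B. LINT h|lborel. shell p s v h)"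
proof -
  define y where "y = s - p"
  have y: "0 < y" "\<bar>p - s\<bar> = y" using s by (auto simp: y_def)
  let ?q = "\<lambda>v. sqrt (y\<^sup>2 - (norm v)\<^sup>2)"
  have w: "(s *\<^sub>R \<omega>) \<bullet> e = 0" using \<omega>_simps by simp
  have "sonar e f (s *\<^sub>R \<omega> + y *\<^sub>R e) = (LINT t|frame_measure (insert \<omega> B).
      sphere_density y (norm t) * f (s *\<^sub>R \<omega> + t + sqrt (y\<^sup>2 - (norm t)\<^sup>2) *\<^sub>R e))"
    using \<omega>_simps norm_e by (subst sonar_eq[OF frame(1,3), of _ y]) (simp_all add: inner_add_left)
  also have "\<dots> = (LINT v|frame_measure B. sphere_density y (norm v) * (LINT a|lborel. sphere_density (?q v) \<bar>a\<bar> *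
         f (s *\<^sub>R \<omega> + a *\<^sub>R \<omega> + v + sqrt (y\<^sup>2 - (norm v)\<^sup>2 - a\<^sup>2) *\<^sub>R e)))"
    by (intro integral_sphere_slices cont supp_height_le w y)
  also have "\<dots> = (LINT v|frame_measure B. LINT h|lborel. shell p s v h)"
  proof (rule integral_cong_AE)
    show "AE v in frame_measure B. sphere_density y (norm v) * (LINT a|lborel. sphere_density (?q v) \<bar>a\<bar> *
         f (s *\<^sub>R \<omega> + a *\<^sub>R \<omega> + v + sqrt (y\<^sup>2 - (norm v)\<^sup>2 - a\<^sup>2) *\<^sub>R e)) = (LINT h|lborel. shell p s v h)"
           (is "AE v in _. ?AE v")
      using AE_frame_measure_span[of B]
    proof (rule eventually_mono)
      fix v assume v: "v \<in> span B"
      show "?AE v"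
      proof (cases "norm v < y")
        case True
        then have "0 < y\<^sup>2 - (norm v)\<^sup>2" by (simp add: power_strict_mono)
        define q where "q = ?q v"
        have q: "0 < q" "q\<^sup>2 = y\<^sup>2 - (norm v)\<^sup>2" using \<open>0 < y\<^sup>2 - (norm v)\<^sup>2\<close> by (auto simp: q_def)
        define \<Phi> where "\<Phi> z = f ((s + fst z) *\<^sub>R \<omega> + snd z *\<^sub>R e + v)" for z :: "real \<times> real"
        have [measurable]: "\<Phi> \<in> borel_measurable borel" unfolding \<Phi>_def
          by (intro borel_measurable_continuous_onI continuous_on_compose2[OF cont] continuous_intros) auto
        have \<Phi>: "\<Phi> (a, h) = 0" if "0 \<le> a" for a h
        proof (rule ccontr)
          assume "\<Phi> (a, h) \<noteq> 0"
          then have "f ((s + a) *\<^sub>R \<omega> + h *\<^sub>R e + v) \<noteq> 0" by (simp add: \<Phi>_def)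
          then have "\<bar>s + a\<bar> \<le> R" by (rule coordinates_le(1)[OF v])
          then show False using that s R by simp
        qed
        have "(LINT a|lborel. sphere_density q \<bar>a\<bar> * f (s *\<^sub>R \<omega> + a *\<^sub>R \<omega> + v + sqrt (y\<^sup>2 - (norm v)\<^sup>2 - a\<^sup>2) *\<^sub>R e))
           = (LINT a|lborel. (if - q < a \<and> a < 0 then q / sqrt (q\<^sup>2 - a\<^sup>2) else 0) * \<Phi> (a, sqrt (q\<^sup>2 - a\<^sup>2)))"
             (is "integral\<^sup>L _ ?before' = integral\<^sup>L _ ?after'")
        proof (rule Bochner_Integration.integral_cong[OF refl])
          fix a
          have "f (s *\<^sub>R \<omega> + a *\<^sub>R \<omega> + v + sqrt (y\<^sup>2 - (norm v)\<^sup>2 - a\<^sup>2) *\<^sub>R e) = \<Phi> (a, sqrt (q\<^sup>2 - a\<^sup>2))"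
            unfolding q(2) \<Phi>_def by (simp add: scaleR_add_left add_ac)
          moreover have "sphere_density q \<bar>a\<bar> * \<Phi> (a, sqrt (q\<^sup>2 - a\<^sup>2)) = (if - q < a \<and> a < 0 then q / sqrt (q\<^sup>2 - a\<^sup>2) else 0) * \<Phi> (a, sqrt (q\<^sup>2 - a\<^sup>2))"
            using \<Phi>[of a] by (cases "0 \<le> a") (auto simp: sphere_density_def)
          ultimately show "?before' a = ?after' a" by simp
        qed
        also have "\<dots> = (LINT h|lborel. (if 0 < h \<and> h < q then q / sqrt (q\<^sup>2 - h\<^sup>2) else 0) * \<Phi> (- sqrt (q\<^sup>2 - h\<^sup>2), h))"
          by (rule integral_left_arc[OF _ q(1)]) measurable
        finally have "sphere_density y (norm v) * (LINT a|lborel. sphere_density q \<bar>a\<bar> * f (s *\<^sub>R \<omega> + a *\<^sub>R \<omega> + v + sqrt (y\<^sup>2 - (norm v)\<^sup>2 - a\<^sup>2) *\<^sub>R e))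
          = (LINT h|lborel. sphere_density y (norm v) * ((if 0 < h \<and> h < q then q / sqrt (q\<^sup>2 - h\<^sup>2) else 0) * \<Phi> (- sqrt (q\<^sup>2 - h\<^sup>2), h)))"
          by (simp only: integral_mult_right_zero)
        also have "\<dots> = (LINT h|lborel. shell p s v h)"
          (is "integral\<^sup>L _ ?before' = integral\<^sup>L _ ?after'")
        proof (rule Bochner_Integration.integral_cong[OF refl])
          fix h
          have d: "sphere_density y (norm v) = y / q" using True by (simp add: sphere_density_def q_def)
          have iff: "(norm v)\<^sup>2 + h\<^sup>2 < y\<^sup>2 \<longleftrightarrow> h < q" if "0 < h"
          proof -
            have "h < q \<longleftrightarrow> h\<^sup>2 < q\<^sup>2" using that q(1) by (auto intro: power_strict_mono power_less_imp_less_base)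
            then show ?thesis unfolding q(2) by auto
          qed
          have "y\<^sup>2 - ((norm v)\<^sup>2 + h\<^sup>2) = q\<^sup>2 - h\<^sup>2" by (simp add: q(2))
          then have sh: "shell p s v h = (if norm v < y \<and> 0 < h \<and> (norm v)\<^sup>2 + h\<^sup>2 < y\<^sup>2
             then y / sqrt (q\<^sup>2 - h\<^sup>2) * f ((s - sqrt (q\<^sup>2 - h\<^sup>2)) *\<^sub>R \<omega> + h *\<^sub>R e + v) else 0)"
            unfolding shell_def y_def[symmetric] by (simp only:)
          show "?before' h = ?after' h"
            using True iff q(1) by (cases "0 < h") (auto simp: sh d \<Phi>_def)
        qed
        finally show ?thesis by (simp add: q_def)
      next
        case False
        then show ?thesis by (simp add: sphere_density_def shell_def y_def[symmetric])
      qed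
    qed
  qed measurable
  finally show ?thesis using y by simp
qed

text \<open>
  On the support of \<open>f\<close> both \<open>|v|\<close> and \<open>h\<close> are at most \<open>R\<close>, so a radius of at least \<open>2 * R\<close> bounds
  the area element by \<open>2\<close>.  This is the dominating function for the limit.
\<close>

lemma shell_bound:
  assumes v: "v \<in> span B" and s: "2 * R + p \<le> s"
  shows "\<bar>shell p s v h\<bar> \<le> 2 * M * (indicator (cball 0 R) v * indicator {0..R} h)"
proof (cases "shell p s v h = 0")
  case False
  let ?c = "(norm v)\<^sup>2 + h\<^sup>2" and ?y = "s - p"
  let ?z = "(s - sqrt (?y\<^sup>2 - ?c)) *\<^sub>R \<omega> + h *\<^sub>R e + v"
  have cond: "0 < h" "?c < ?y\<^sup>2" "f ?z \<noteq> 0"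
    and eq: "shell p s v h = ?y / sqrt (?y\<^sup>2 - ?c) * f ?z"
    using False by (auto simp: shell_def split: if_splits)
  note le = coordinates_le[OF v cond(3)]
  have "(norm v)\<^sup>2 \<le> R\<^sup>2" "h\<^sup>2 \<le> R\<^sup>2" using le R cond(1) by (auto intro!: power_mono)
  moreover have "(2 * R)\<^sup>2 \<le> ?y\<^sup>2" using s R by (intro power_mono) auto
  moreover have "0 \<le> R\<^sup>2" "(2 * R)\<^sup>2 = 4 * R\<^sup>2" by (simp_all add: power_mult_distrib)
  moreover have "(?y / 2)\<^sup>2 = ?y\<^sup>2 / 4" by (simp add: power_divide)
  ultimately have "(?y / 2)\<^sup>2 \<le> ?y\<^sup>2 - ?c" by linarith
  then have root: "?y / 2 \<le> sqrt (?y\<^sup>2 - ?c)" by (rule real_le_rsqrt)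
  have "0 < ?y" using s R by simp
  then have "\<bar>?y / sqrt (?y\<^sup>2 - ?c)\<bar> \<le> 2" using root cond(2) by (simp add: pos_divide_le_eq)
  then have "\<bar>shell p s v h\<bar> \<le> 2 * M" unfolding eq abs_mult using bound by (intro mult_mono) auto
  then show ?thesis using le cond(1) by simp
qed (use M_nonneg in simp)

lemma radon_v_eq:
  "radon_v e f \<omega> p = (LINT v|frame_measure B. LINT h|lborel. (if 0 < h then f (p *\<^sub>R \<omega> + h *\<^sub>R e + v) else 0))"
proof -
  interpret M: sigma_finite_measure "frame_measure B" by (rule sigma_finite_frame_measure[OF orthonormal_B])
  interpret P: pair_sigma_finite "frame_measure B" "lborel :: real measure" ..
  define k where "k v h = (if norm v \<le> R \<and> 0 < h \<and> h \<le> R then f (p *\<^sub>R \<omega> + h *\<^sub>R e + v) else 0)" for v h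
  have [measurable]: "(\<lambda>x. k (a x) (b x)) \<in> borel_measurable N"
    if [measurable]: "a \<in> borel_measurable N" "b \<in> borel_measurable N" for a b and N :: "'n measure"
    unfolding k_def by measurable
  have I: "integrable (frame_measure B \<Otimes>\<^sub>M lborel) (\<lambda>(v, h). k v h)"
  proof (rule P.integrable_bounded_support_pair)
    show "emeasure (frame_measure B) (cball 0 R) < \<infinity>" by (rule emeasure_frame_measure_cball_finite[OF orthonormal_B])
    show "emeasure lborel {0..R} < \<infinity>" by (auto simp: emeasure_lborel_Icc_eq)
    show "\<bar>case (v, h) of (v, h) \<Rightarrow> k v h\<bar> \<le> M" for v h using bound M_nonneg by (simp add: k_def)
    show "v \<in> cball 0 R \<and> h \<in> {0..R}" if "(case (v, h) of (v, h) \<Rightarrow> k v h) \<noteq> 0" for v h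
      using that by (auto simp: k_def split: if_splits)
  qed simp_all
  have k: "(if 0 < h then f (p *\<^sub>R \<omega> + h *\<^sub>R e + v) else 0) = k v h" if "v \<in> span B" for v h
    using coordinates_le[OF that, of p h] unfolding k_def by (cases "f (p *\<^sub>R \<omega> + h *\<^sub>R e + v) = 0") auto
  have "radon_v e f \<omega> p = (LINT h|lborel. indicator {0<..} h *\<^sub>R (LINT u|frame_measure B. f (p *\<^sub>R \<omega> + h *\<^sub>R e + u)))"
    unfolding radon_v_def set_lebesgue_integral_def centerset_radon_eq ..
  also have "\<dots> = (LINT h|lborel. LINT v|frame_measure B. k v h)"
    (is "integral\<^sup>L _ ?before = integral\<^sup>L _ ?after")
  proof (rule Bochner_Integration.integral_cong[OF refl])
    fix h :: real
    have "(LINT v|frame_measure B. (if 0 < h then f (p *\<^sub>R \<omega> + h *\<^sub>R e + v) else 0)) = (LINT v|frame_measure B. k v h)"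
    proof (rule integral_cong_AE)
      show "AE v in frame_measure B. (if 0 < h then f (p *\<^sub>R \<omega> + h *\<^sub>R e + v) else 0) = k v h"
        using AE_frame_measure_span[of B] by (rule eventually_mono) (rule k)
    qed measurable
    then show "?before h = ?after h"
      by (cases "0 < h") simp_all
  qed
  also have "\<dots> = (LINT v|frame_measure B. LINT h|lborel. k v h)"
    by (rule P.Fubini_integral[OF I])
  also have "\<dots> = (LINT v|frame_measure B. LINT h|lborel. (if 0 < h then f (p *\<^sub>R \<omega> + h *\<^sub>R e + v) else 0))"
  proof (rule integral_cong_AE)
    show "AE v in frame_measure B. (LINT h|lborel. k v h) = (LINT h|lborel. (if 0 < h then f (p *\<^sub>R \<omega> + h *\<^sub>R e + v) else 0))"
      using AE_frame_measure_span[of B] by (rule eventually_mono) (simp only: k)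
  qed measurable
  finally show ?thesis .
qed

lemma tendsto_shell:
  "((\<lambda>s. shell p s v h) \<longlongrightarrow> (if 0 < h then f (p *\<^sub>R \<omega> + h *\<^sub>R e + v) else 0)) at_top"
proof (cases "0 < h")
  case True
  let ?c = "(norm v)\<^sup>2 + h\<^sup>2"
  have c: "0 \<le> ?c" by simp
  have "isCont f x" for x using cont by (simp add: continuous_on_eq_continuous_at)
  then have "((\<lambda>s. (s - p) / sqrt ((s - p)\<^sup>2 - ?c) * f ((s - sqrt ((s - p)\<^sup>2 - ?c)) *\<^sub>R \<omega> + h *\<^sub>R e + v))
      \<longlongrightarrow> 1 * f (p *\<^sub>R \<omega> + h *\<^sub>R e + v)) at_top"
    by (intro tendsto_mult isCont_tendsto_compose[where g = f] tendsto_add tendsto_scaleR tendsto_const tendsto_tangent_plane[OF c])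
  moreover have "\<forall>\<^sub>F s in at_top. (s - p) / sqrt ((s - p)\<^sup>2 - ?c) * f ((s - sqrt ((s - p)\<^sup>2 - ?c)) *\<^sub>R \<omega> + h *\<^sub>R e + v) = shell p s v h"
    using eventually_gt_at_top[of "p + norm v + h"]
  proof (rule eventually_mono)
    fix s assume s: "p + norm v + h < s"
    then have "(norm v + h)\<^sup>2 < (s - p)\<^sup>2" using True by (intro power_strict_mono) (auto intro: add_nonneg_nonneg)
    moreover have "0 \<le> 2 * norm v * h" using True by simp
    ultimately have "?c < (s - p)\<^sup>2" unfolding power2_sum by linarith
    moreover have "norm v < s - p" using s True by simp
    ultimately show "(s - p) / sqrt ((s - p)\<^sup>2 - ?c) * f ((s - sqrt ((s - p)\<^sup>2 - ?c)) *\<^sub>R \<omega> + h *\<^sub>R e + v) = shell p s v h"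
      using True by (simp add: shell_def)
  qed
  ultimately show ?thesis using True by (auto intro: Lim_transform_eventually)
qed (simp add: shell_def)

lemma tendsto_sonar_at_top:
  "((\<lambda>s. sonar e f (s *\<^sub>R \<omega> + \<bar>p - s\<bar> *\<^sub>R e)) \<longlongrightarrow> radon_v e f \<omega> p) at_top"
proof -
  have slice: "\<bar>LINT h|lborel. shell p s v h\<bar> \<le> 2 * M * R * indicator (cball 0 R) v"
    if "v \<in> span B" "2 * R + p \<le> s" for v s
  proof -
    have I: "integrable lborel (\<lambda>h. 2 * M * (indicator (cball 0 R) v * indicator {0..R} h))"
      by (intro integrable_mult_right) (auto simp: integrable_indicator_iff emeasure_lborel_Icc_eq)
    have "\<bar>LINT h|lborel. shell p s v h\<bar> \<le> (LINT h|lborel. \<bar>shell p s v h\<bar>)" by (rule integral_abs_bound)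
    also have "\<dots> \<le> (LINT h|lborel. 2 * M * (indicator (cball 0 R) v * indicator {0..R} h))"
      using I by (rule integral_mono') (use shell_bound[OF that] M_nonneg in auto)
    also have "\<dots> = 2 * M * R * indicator (cball 0 R) v"
      using R by simp
    finally show ?thesis .
  qed
  have "((\<lambda>s. LINT v|frame_measure B. LINT h|lborel. shell p s v h) \<longlongrightarrow>
     (LINT v|frame_measure B. LINT h|lborel. (if 0 < h then f (p *\<^sub>R \<omega> + h *\<^sub>R e + v) else 0))) at_top"
  proof (rule integral_dominated_convergence_at_top[where w = "\<lambda>v. 2 * M * R * indicator (cball 0 R) v"])
    show "integrable (frame_measure B) (\<lambda>v. 2 * M * R * indicator (cball 0 R) v)"
      using emeasure_frame_measure_cball_finite[OF orthonormal_B, of R]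
      by (intro integrable_mult_right) (simp add: integrable_indicator_iff)
    show "\<forall>\<^sub>F s in at_top. AE v in frame_measure B. norm (LINT h|lborel. shell p s v h) \<le> 2 * M * R * indicator (cball 0 R) v"
      using eventually_ge_at_top[of "2 * R + p"]
    proof (rule eventually_mono)
      fix s assume s: "2 * R + p \<le> s"
      show "AE v in frame_measure B. norm (LINT h|lborel. shell p s v h) \<le> 2 * M * R * indicator (cball 0 R) v"
        using AE_frame_measure_span[of B] by (rule eventually_mono) (use slice s in simp)
    qed
    show "AE v in frame_measure B. ((\<lambda>s. LINT h|lborel. shell p s v h) \<longlongrightarrow>
        (LINT h|lborel. (if 0 < h then f (p *\<^sub>R \<omega> + h *\<^sub>R e + v) else 0))) at_top"
          (is "AE v in _. ?AE v")
      using AE_frame_measure_span[of B]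
    proof (rule eventually_mono)
      fix v assume v: "v \<in> span B"
      show "?AE v"
      proof (rule integral_dominated_convergence_at_top[where w = "\<lambda>h. 2 * M * (indicator (cball 0 R) v * indicator {0..R} h)"])
        show "integrable lborel (\<lambda>h. 2 * M * (indicator (cball 0 R) v * indicator {0..R} h))"
          by (intro integrable_mult_right) (auto simp: integrable_indicator_iff emeasure_lborel_Icc_eq)
        show "\<forall>\<^sub>F s in at_top. AE h in lborel. norm (shell p s v h) \<le> 2 * M * (indicator (cball 0 R) v * indicator {0..R} h)"
          using eventually_ge_at_top[of "2 * R + p"] by (rule eventually_mono) (use shell_bound[OF v] in simp)
      qed (simp_all add: tendsto_shell)
    qed
  qed measurable
  then have "((\<lambda>s. LINT v|frame_measure B. LINT h|lborel. shell p s v h) \<longlongrightarrow> radon_v e f \<omega> p) at_top"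
    by (simp only: radon_v_eq)
  moreover have "\<forall>\<^sub>F s in at_top. (LINT v|frame_measure B. LINT h|lborel. shell p s v h) = sonar e f (s *\<^sub>R \<omega> + \<bar>p - s\<bar> *\<^sub>R e)"
    using eventually_gt_at_top[of "max R p"] by (rule eventually_mono) (rule sonar_eq_shell[symmetric], simp_all)
  ultimately show ?thesis by (rule Lim_transform_eventually)
qed

end

context half_space_function
begin

lemma half_space_direction_exists:
  assumes "\<omega> \<in> horizontal_sphere e"
  shows "\<exists>B. half_space_direction e f M R \<delta> \<omega> B"
proof -
  from assms obtain B where "orthonormal (insert \<omega> B)" "\<omega> \<notin> B" "span (insert \<omega> B) = centerset e"
      "span B = {u \<in> centerset e. \<omega> \<bullet> u = 0}"
    by (rule horizontal_frame_through)
  then have "half_space_direction e f M R \<delta> \<omega> B"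
    by unfold_locales auto
  then show ?thesis ..
qed

text \<open>
  The limit for \<open>s\<close> to minus infinity follows from the other one by the symmetry that
  replaces \<open>(\<omega>, p, s)\<close> by \<open>(- \<omega>, - p, - s)\<close>.
\<close>

theorem radon_v_limit:
  assumes \<omega>: "\<omega> \<in> horizontal_sphere e"
  shows "has_limit_op e (sonar e f) \<omega> p (radon_v e f \<omega> p)"
proof -
  have top: "((\<lambda>s. sonar e f (s *\<^sub>R \<omega> + \<bar>p - s\<bar> *\<^sub>R e)) \<longlongrightarrow> radon_v e f \<omega> p) at_top"
    if \<omega>: "\<omega> \<in> horizontal_sphere e" for \<omega> p
  proof -
    obtain B where "half_space_direction e f M R \<delta> \<omega> B" using half_space_direction_exists[OF \<omega>] ..
    then show ?thesis by (rule half_space_direction.tendsto_sonar_at_top)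
  qed
  have "- \<omega> \<in> horizontal_sphere e" using \<omega> by (auto simp: horizontal_sphere_def centerset_def)
  from top[OF this, of "- p"]
  have "((\<lambda>s. sonar e f (s *\<^sub>R - \<omega> + \<bar>- p - s\<bar> *\<^sub>R e)) \<longlongrightarrow> radon_v e f (- \<omega>) (- p)) at_top" .
  also have "(\<lambda>s. sonar e f (s *\<^sub>R - \<omega> + \<bar>- p - s\<bar> *\<^sub>R e)) = (\<lambda>s. sonar e f ((- s) *\<^sub>R \<omega> + \<bar>p - (- s)\<bar> *\<^sub>R e))"
  proof -
    have "\<bar>- p - s\<bar> = \<bar>p - (- s)\<bar>" for s :: real by arith
    then show ?thesis by (simp only: scaleR_minus_left scaleR_minus_right)
  qed
  also have "radon_v e f (- \<omega>) (- p) = radon_v e f \<omega> p"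
    by (simp add: radon_v_def centerset_radon_def)
  finally have "((\<lambda>s. sonar e f (s *\<^sub>R \<omega> + \<bar>p - s\<bar> *\<^sub>R e)) \<longlongrightarrow> radon_v e f \<omega> p) at_bot"
    by (simp add: filterlim_at_bot_mirror)
  with top[OF \<omega>] show ?thesis
    unfolding has_limit_op_def at_infinity_eq_at_top_bot by (simp add: filterlim_sup)
qed

end

lemma Cc_infinity_half_space_function:
  fixes e :: "'a::euclidean_space"
  assumes e: "e \<in> Basis" and f: "f \<in> Cc_infinity e"
  obtains M R \<delta> where "half_space_function e f M R \<delta>"
proof -
  define K where "K = closure {z. f z \<noteq> 0}"
  have "C_k 0 f" using f unfolding Cc_infinity_def by blast
  then have cont: "continuous_on UNIV f" by simp
  have K: "compact K" "K \<subseteq> upper_half e" using f by (auto simp: Cc_infinity_def K_def)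
  have fK: "z \<in> K" if "f z \<noteq> 0" for z using that closure_subset[of "{z. f z \<noteq> 0}"] by (auto simp: K_def)
  have "bounded (f ` K)" using K(1) cont
    by (intro compact_imp_bounded compact_continuous_image continuous_on_subset[OF cont]) auto
  then obtain M where M: "\<And>z. z \<in> K \<Longrightarrow> \<bar>f z\<bar> \<le> M" by (metis bounded_iff image_eqI real_norm_def)
  obtain R where R: "0 < R" "\<And>z. z \<in> K \<Longrightarrow> norm z \<le> R"
    using compact_imp_bounded[OF K(1)] by (auto simp: bounded_pos)
  have "\<exists>\<delta>>0. \<forall>z\<in>K. \<delta> \<le> z \<bullet> e"
  proof (cases "K = {}")
    case False
    have "continuous_on K (\<lambda>z. z \<bullet> e)" by (intro continuous_intros)
    then obtain z where "z \<in> K" "\<forall>x\<in>K. z \<bullet> e \<le> x \<bullet> e"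
      using continuous_attains_inf[OF K(1) False] by blast
    then show ?thesis using K(2) by (auto simp: upper_half_def)
  qed (auto intro: exI[of _ 1])
  then obtain \<delta> where \<delta>: "0 < \<delta>" "\<And>z. z \<in> K \<Longrightarrow> \<delta> \<le> z \<bullet> e" by blast
  have "half_space_function e f (max M 0) R \<delta>"
  proof
    show "\<bar>f z\<bar> \<le> max M 0" for z using M[of z] fK[of z] by (cases "f z = 0") auto
  qed (use e cont R \<delta> fK in auto)
  then show thesis by (rule that)
qed

theorem theoremt:
  fixes e :: "'a::euclidean_space" and f :: "'a \<Rightarrow> real"
  assumes e: "e \<in> Basis" and f: "f \<in> Cc_infinity e"
  shows "(\<forall>y>0. radon_h e f y = frac_deriv ((real DIM('a) - 1) / 2) (radon_h e (sonar e f)) y) \<and>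
    (DIM('a) \<ge> 2 \<longrightarrow>
      (\<forall>\<omega>\<in>horizontal_sphere e. \<forall>p\<ge>0. has_limit_op e (sonar e f) \<omega> p (radon_v e f \<omega> p))) \<and>
    (DIM('a) \<ge> 2 \<longrightarrow>
      (\<forall>\<omega>\<in>horizontal_sphere e. \<forall>p. \<forall>\<beta>\<in>{0<..<pi/2}.
        radon_s e f \<omega> p \<beta> =
        W_op (weighted_radon (\<lambda>s. 1 / s)
          (\<lambda>\<omega> p. frac_deriv ((real DIM('a) - 2) / 2) (centerset_radon e (sonar e f) \<omega> p)) \<omega> p) \<beta>))"
proof -
  obtain M R \<delta> where "half_space_function e f M R \<delta>" using e f by (rule Cc_infinity_half_space_function)
  then interpret half_space_function e f M R \<delta> .
  show ?thesis
  proof (intro conjI allI ballI impI)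
    show "radon_h e f y = frac_deriv ((real DIM('a) - 1) / 2) (radon_h e (sonar e f)) y" if "0 < y" for y
      using that by (rule radon_h_eq)
    show "has_limit_op e (sonar e f) \<omega> p (radon_v e f \<omega> p)" if "\<omega> \<in> horizontal_sphere e" for \<omega> p
      using that by (rule radon_v_limit)
    fix \<omega> :: 'a and p \<beta> :: real
    assume "DIM('a) \<ge> 2" and \<omega>: "\<omega> \<in> horizontal_sphere e" and "\<beta> \<in> {0<..<pi/2}"
    moreover obtain B where "half_space_direction e f M R \<delta> \<omega> B"
      using half_space_direction_exists[OF \<omega>] ..
    ultimately show "radon_s e f \<omega> p \<beta> = W_op (weighted_radon (\<lambda>s. 1 / s)
          (\<lambda>\<omega> p. frac_deriv ((real DIM('a) - 2) / 2) (centerset_radon e (sonar e f) \<omega> p)) \<omega> p) \<beta>"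
      by (intro half_space_direction.radon_s_eq)
  qed
qed

end
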